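(* In the bifurcating autoregressive (BAR) model, assume that the distribution $\nu$ of the ancestor $X_1$ has finite moments of all orders. Let $\mu$ be the unique stationary distribution of the induced Markov chain $(Y_r,r\in\mathbb N)$, with first and second moments $\mu_1(\theta)$ and $\mu_2(\theta,\sigma^2)$. Then $|\mathbb T_r|^{1/2}(\hat\theta^r-\theta)$ converges in law, as $r\to\infty$, to $\mathcal N_4(0,\Sigma')$, where $$\Sigma'=\sigma^2\begin{pmatrix}K&\rho K\\\rho K&K\end{pmatrix}\quad\text{with}\quad K=\frac1{\mu_2(\theta,\sigma^2)-\mu_1(\theta)^2}\begin{pmatrix}1&-\mu_1(\theta)\\-\mu_1(\theta)&\mu_2(\theta,\sigma^2)\end{pmatrix}.$$
   Context: Tree. $\mathbb T=\mathbb N^*=\{1,2,\dots\}$ is the binary tree (vertex $n$ has daughters $2n$, $2n+1$); $\mathbb T_r=\{1,\dots,2^{r+1}-1\}$ is the set of the first $r+1$ generations. BAR model. $X_1$ has distribution $\nu$ on $\mathbb R$ and for all $n\ge1$, $$X_{2n}=\alpha_0X_n+\beta_0+\varepsilon_{2n},\qquad X_{2n+1}=\alpha_1X_n+\beta_1+\varepsilon_{2n+1},$$ where $\alpha_0,\alpha_1\in(-1,1)$, $\beta_0,\beta_1\in\mathbb R$, and $((\varepsilon_{2n},\varepsilon_{2n+1}),n\ge1)$ is a sequence, independent of $X_1$, of i.i.d. centered bivariate Gaussian vectors with covariance matrix $\sigma^2\begin{pmatrix}1&\rho\\\rho&1\end{pmatrix}$, $\sigma^2>0$, $\rho\in(-1,1)$.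 Write $\theta=(\alpha_0,\beta_0,\alpha_1,\beta_1)$. Induced chain. $(Y_r)$ is the real Markov chain with initial law $\nu$ and transition probability $Q(x,\cdot)=\tfrac12\mathcal N(\alpha_0x+\beta_0,\sigma^2)+\tfrac12\mathcal N(\alpha_1x+\beta_1,\sigma^2)$; it has a unique stationary distribution $\mu$. With $\bar\alpha=(\alpha_0+\alpha_1)/2$, $\bar\beta=(\beta_0+\beta_1)/2$, $\overline{\alpha\beta}=(\alpha_0\beta_0+\alpha_1\beta_1)/2$, $\overline{\alpha^2}=(\alpha_0^2+\alpha_1^2)/2$, $\overline{\beta^2}=(\beta_0^2+\beta_1^2)/2$, its first two moments are $$\int x\,\mu(dx)=\mu_1(\theta)=\frac{\bar\beta}{1-\bar\alpha},\qquad\int x^2\mu(dx)=\mu_2(\theta,\sigma^2)=\frac{2\overline{\alpha\beta}\,\bar\beta/(1-\bar\alpha)+\overline{\beta^2}+\sigma^2}{1-\overline{\alpha^2}}.$$ Estimator. $\hat\theta^r=(\hat\alpha_0^r,\hat\beta_0^r,\hat\alpha_1^r,\hat\beta_1^r)$ with, for $\varepsilon\in\{0,1\}$, $$\hat\alpha_\varepsilon^r=\frac{|\mathbb T_r|^{-1}\sum_{i\in\mathbb T_r}X_iX_{2i+\varepsilon}-\big(|\mathbb T_r|^{-1}\sum_{i\in\mathbb T_r}X_i\big)\big(|\mathbb T_r|^{-1}\sum_{i\in\mathbb T_r}X_{2i+\varepsilon}\big)}{|\mathbb T_r|^{-1}\sum_{i\in\mathbb T_r}X_i^2-\big(|\mathbb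 T_r|^{-1}\sum_{i\in\mathbb T_r}X_i\big)^2},$$ $$\hat\beta_\varepsilon^r=|\mathbb T_r|^{-1}\sum_{i\in\mathbb T_r}X_{2i+\varepsilon}-\hat\alpha_\varepsilon^r|\mathbb T_r|^{-1}\sum_{i\in\mathbb T_r}X_i$$ (defined when the denominator is nonzero, arbitrary otherwise). *)

theory Defs
  imports "HOL-Probability.Probability"
begin

text \<open>The normal law \<open>N(m, S)\<close> on \<open>\<real>\<^sup>n\<close> given by its Lebesgue density. This is meaningful only for a
  symmetric positive definite covariance matrix \<open>S\<close>; every covariance matrix used here is of
  this kind.\<close>

definition multivariate_normal :: "real^'n \<Rightarrow> real^'n^'n \<Rightarrow> (real^'n) measure" where
  "multivariate_normal m S = density lborel
     (\<lambda>x. ennreal (exp (- ((x - m) \<bullet> (matrix_inv S *v (x - m))) / 2)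
                     / sqrt ((2 * pi) ^ CARD('n) * det S)))"

definition converges_in_law ::
  "'a measure \<Rightarrow> (nat \<Rightarrow> 'a \<Rightarrow> 'b::topological_space) \<Rightarrow> 'b measure \<Rightarrow> bool" where
  "converges_in_law M Z L \<longleftrightarrow>
     (\<forall>n. Z n \<in> borel_measurable M) \<and>
     (\<forall>f :: 'b \<Rightarrow> real. continuous_on UNIV f \<longrightarrow> bounded (range f) \<longrightarrow>
        (\<lambda>n. \<integral>\<omega>. f (Z n \<omega>) \<partial>M) \<longlonglongrightarrow> (\<integral>x. f x \<partial>L))"

definition block_matrix :: "real^2^2 \<Rightarrow> real^2^2 \<Rightarrow> real^2^2 \<Rightarrow> real^2^2 \<Rightarrow> real^4^4" where
  "block_matrix A B C D = vector
     [vector [A$1$1, A$1$2, B$1$1, B$1$2],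
      vector [A$2$1, A$2$2, B$2$1, B$2$2],
      vector [C$1$1, C$1$2, D$1$1, D$1$2],
      vector [C$2$1, C$2$2, D$2$1, D$2$2]]"

text \<open>Vertices of the binary tree are the natural numbers \<open>n \<ge> 1\<close>. The values of \<open>X\<close> at \<open>0\<close> and
  of \<open>\<epsilon>\<close> at \<open>0\<close> and \<open>1\<close> play no role. Independence of
  the ancestor from the noise sequence is stated as independence of the generated \<open>\<sigma>\<close>-algebras,
  because \<open>indep_var\<close> requires both random variables to have the same value type.\<close>

definition noise_pair :: "(nat \<Rightarrow> 'a \<Rightarrow> real) \<Rightarrow> nat \<Rightarrow> 'a \<Rightarrow> real^2" where
  "noise_pair \<epsilon> n \<omega> = vector [\<epsilon> (2 * n) \<omega>, \<epsilon> (2 * n + 1) \<omega>]"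

locale bar_model = prob_space M for M :: "'a measure" +
  fixes X \<epsilon> :: "nat \<Rightarrow> 'a \<Rightarrow> real" and \<nu> :: "real measure"
    and \<alpha>\<^sub>0 \<beta>\<^sub>0 \<alpha>\<^sub>1 \<beta>\<^sub>1 \<sigma> \<rho> :: real
  assumes alpha_range: "\<alpha>\<^sub>0 \<in> {-1<..<1}" "\<alpha>\<^sub>1 \<in> {-1<..<1}"
    and sigma_pos: "\<sigma> > 0"
    and rho_range: "\<rho> \<in> {-1<..<1}"
    and ancestor_measurable: "X 1 \<in> borel_measurable M"
    and ancestor_law: "distr M borel (X 1) = \<nu>"
    and left_daughter:
      "\<And>n \<omega>. n \<ge> 1 \<Longrightarrow> \<omega> \<in> space M \<Longrightarrow> X (2 * n) \<omega> = \<alpha>\<^sub>0 * X n \<omega> + \<beta>\<^sub>0 + \<epsilon> (2 * n) \<omega>"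
    and right_daughter:
      "\<And>n \<omega>. n \<ge> 1 \<Longrightarrow> \<omega> \<in> space M \<Longrightarrow>
         X (2 * n + 1) \<omega> = \<alpha>\<^sub>1 * X n \<omega> + \<beta>\<^sub>1 + \<epsilon> (2 * n + 1) \<omega>"
    and noise_indep: "indep_vars (\<lambda>_. borel) (noise_pair \<epsilon>) {1..}"
    and noise_law:
      "\<And>n. n \<ge> 1 \<Longrightarrow>
         distr M borel (noise_pair \<epsilon> n)
           = multivariate_normal 0 (\<sigma>\<^sup>2 *\<^sub>R vector [vector [1, \<rho>], vector [\<rho>, 1]])"
    and noise_indep_ancestor:
      "indep_set (sets (vimage_algebra (space M) (X 1) borel))
         (sets (vimage_algebra (space M) (\<lambda>\<omega>. \<lambda>n\<in>{1..}. noise_pair \<epsilon> n \<omega>) (\<Pi>\<^sub>M n\<in>{1..}. borel)))"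

definition bar_kernel ::
  "real \<Rightarrow> real \<Rightarrow> real \<Rightarrow> real \<Rightarrow> real \<Rightarrow> real \<Rightarrow> real measure" where
  "bar_kernel \<alpha>\<^sub>0 \<beta>\<^sub>0 \<alpha>\<^sub>1 \<beta>\<^sub>1 \<sigma> x = density lborel
     (\<lambda>y. ennreal (normal_density (\<alpha>\<^sub>0 * x + \<beta>\<^sub>0) \<sigma> y / 2 + normal_density (\<alpha>\<^sub>1 * x + \<beta>\<^sub>1) \<sigma> y / 2))"

definition stationary_distribution :: "(real \<Rightarrow> real measure) \<Rightarrow> real measure \<Rightarrow> bool" where
  "stationary_distribution Q \<mu> \<longleftrightarrow> prob_space \<mu> \<and> sets \<mu> = sets borel \<and>
     (\<forall>A\<in>sets borel. (\<integral>\<^sup>+x. emeasure (Q x) A \<partial>\<mu>) = emeasure \<mu> A)"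

definition bar_mu1 :: "real \<Rightarrow> real \<Rightarrow> real \<Rightarrow> real \<Rightarrow> real" where
  "bar_mu1 \<alpha>\<^sub>0 \<beta>\<^sub>0 \<alpha>\<^sub>1 \<beta>\<^sub>1 = ((\<beta>\<^sub>0 + \<beta>\<^sub>1) / 2) / (1 - (\<alpha>\<^sub>0 + \<alpha>\<^sub>1) / 2)"

definition bar_mu2 :: "real \<Rightarrow> real \<Rightarrow> real \<Rightarrow> real \<Rightarrow> real \<Rightarrow> real" where
  "bar_mu2 \<alpha>\<^sub>0 \<beta>\<^sub>0 \<alpha>\<^sub>1 \<beta>\<^sub>1 \<sigma> =
     (2 * ((\<alpha>\<^sub>0 * \<beta>\<^sub>0 + \<alpha>\<^sub>1 * \<beta>\<^sub>1) / 2) * ((\<beta>\<^sub>0 + \<beta>\<^sub>1) / 2) / (1 - (\<alpha>\<^sub>0 + \<alpha>\<^sub>1) / 2)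
        + (\<beta>\<^sub>0\<^sup>2 + \<beta>\<^sub>1\<^sup>2) / 2 + \<sigma>\<^sup>2)
     / (1 - (\<alpha>\<^sub>0\<^sup>2 + \<alpha>\<^sub>1\<^sup>2) / 2)"

definition tree_upto :: "nat \<Rightarrow> nat set" where
  "tree_upto r = {1..2 ^ (r + 1) - 1}"

definition tree_mean :: "nat \<Rightarrow> (nat \<Rightarrow> real) \<Rightarrow> real" where
  "tree_mean r f = (\<Sum>i\<in>tree_upto r. f i) / real (card (tree_upto r))"

text \<open>The least squares estimators as functions of the observed tree \<open>x\<close>, where \<open>e \<in> {0, 1}\<close>
  selects the daughter. They are meaningful only if \<open>ls_denominator r x \<noteq> 0\<close>.\<close>

definition ls_denominator :: "nat \<Rightarrow> (nat \<Rightarrow> real) \<Rightarrow> real" where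
  "ls_denominator r x = tree_mean r (\<lambda>i. (x i)\<^sup>2) - (tree_mean r x)\<^sup>2"

definition ls_alpha :: "nat \<Rightarrow> nat \<Rightarrow> (nat \<Rightarrow> real) \<Rightarrow> real" where
  "ls_alpha e r x =
     (tree_mean r (\<lambda>i. x i * x (2 * i + e)) - tree_mean r x * tree_mean r (\<lambda>i. x (2 * i + e)))
     / ls_denominator r x"

definition ls_beta :: "nat \<Rightarrow> nat \<Rightarrow> (nat \<Rightarrow> real) \<Rightarrow> real" where
  "ls_beta e r x = tree_mean r (\<lambda>i. x (2 * i + e)) - ls_alpha e r x * tree_mean r x"

definition ls_theta :: "nat \<Rightarrow> (nat \<Rightarrow> real) \<Rightarrow> real^4" where
  "ls_theta r x = vector [ls_alpha 0 r x, ls_beta 0 r x, ls_alpha 1 r x, ls_beta 1 r x]"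

definition asymptotic_K :: "real \<Rightarrow> real \<Rightarrow> real^2^2" where
  "asymptotic_K m\<^sub>1 m\<^sub>2 =
     (1 / (m\<^sub>2 - m\<^sub>1\<^sup>2)) *\<^sub>R vector [vector [1, - m\<^sub>1], vector [- m\<^sub>1, m\<^sub>2]]"

definition asymptotic_covariance :: "real \<Rightarrow> real \<Rightarrow> real^2^2 \<Rightarrow> real^4^4" where
  "asymptotic_covariance \<sigma> \<rho> K = \<sigma>\<^sup>2 *\<^sub>R block_matrix K (\<rho> *\<^sub>R K) (\<rho> *\<^sub>R K) K"

end

theory Submission
  imports Defs
begin

text \<open>The stationary law and the asymptotic normality are independent of each other. One step of the
  induced chain turns a characteristic function \<open>\<phi>\<close> into
  \<open>t \<mapsto> exp (- \<sigma>\<^sup>2 t\<^sup>2 / 2) (exp (\<i> \<beta>\<^sub>0 t) \<phi> (\<alpha>\<^sub>0 t) + exp (\<i> \<beta>\<^sub>1 t) \<phi> (\<alpha>\<^sub>1 t)) / 2\<close>; since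
  characteristic functions agree at \<open>0\<close>, two orbits of this map approach each other, which gives uniqueness
  and shows that weak limits of the iterates are stationary.

  For the estimator, enumerate the tree in its natural order. The parent of \<open>i\<close> precedes \<open>i\<close>, so \<open>X\<^sub>i\<close> depends only on
  the ancestor and the noise pairs with index below \<open>i\<close>, and \<open>\<Sum> (p\<^sub>i \<epsilon>\<^sub>2\<^sub>i + q\<^sub>i \<epsilon>\<^sub>2\<^sub>i\<^sub>+\<^sub>1)\<close> with \<open>p\<^sub>i\<close>, \<open>q\<^sub>i\<close>
  affine in \<open>X\<^sub>i\<close> is a martingale with conditionally Gaussian increments. Summing the
  recursion over a generation expresses the tree averages of \<open>X\<close> and \<open>X\<^sup>2\<close> over \<open>r + 2\<close> generations as a
  contraction of those over \<open>r + 1\<close> plus martingale averages, which yields their \<open>L\<^sup>1\<close> limits without any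
  covariance computation. These limits identify the conditional variances, hence the limiting characteristic function of
  the normalised score jointly with both tree averages. The estimation error is a
  continuous function of that vector away from a vanishing denominator, so Levy's theorem concludes.\<close>

section \<open>The stationary distribution of the induced chain\<close>

text \<open>Two features shape the argument: the denominators of the estimators are random, and the
  weights of the score are unbounded. Against the first, the score converges jointly with both tree
  averages, as one vector in \<open>(real^4) \<times> real \<times> real\<close> whose last two
  limit coordinates are constants; one continuous map then replaces a chain of Slutsky arguments.
  Against the second, Gaussian noise has an exact conditional characteristic function:
  \<open>iexp\<close> of the sum times the exponential of half the accumulated variance has mean
  one. No Lindeberg condition and no expansion of the increments enters; what remains is an
  \<open>L^1\<close> limit of the accumulated variance, which is affine in the averages of
  \<open>X\<close> and \<open>X^2\<close>. The cross terms of the score are centred at the limit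
  \<mu>1 and not at the empirical mean: this keeps their weights predictable and makes noise sums
  and cross sums uncorrelated in the limit. The passage to the empirical mean is left to the
  continuous map.\<close>

lemma has_bochner_integral_normal_iexp:
  fixes m s t :: real
  assumes "s > 0"
  shows "has_bochner_integral lborel (\<lambda>y. normal_density m s y *\<^sub>R iexp (t * y))
           (iexp (t * m) * of_real (exp (- (s * t)\<^sup>2 / 2)))"
proof -
  have std: "has_bochner_integral lborel (\<lambda>y. std_normal_density y *\<^sub>R iexp ((s * t) * y))
      (of_real (exp (- (s * t)\<^sup>2 / 2)))"
  proof -
    interpret N: real_distribution std_normal_distribution by (rule real_dist_normal_dist)
    have "(\<integral>y. iexp ((s * t) * y) \<partial>std_normal_distribution) = of_real (exp (- (s * t)\<^sup>2 / 2))"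
      using char_std_normal_distribution unfolding char_def by metis
    moreover have "integrable std_normal_distribution (\<lambda>y. iexp ((s * t) * y))"
      by (rule N.integrable_iexp) auto
    ultimately show ?thesis
      by (simp add: has_bochner_integral_iff integral_density integrable_density)
  qed
  have "(\<lambda>x. normal_density m s (m + s * x) *\<^sub>R iexp (t * (m + s * x))) =
        (\<lambda>x. (iexp (t * m) / of_real s) * (std_normal_density x *\<^sub>R iexp ((s * t) * x)))"
    using assms
    by (auto simp: fun_eq_iff normal_density_def real_sqrt_mult power_mult_distrib exp_add[symmetric]
       scaleR_conv_of_real field_simps)
  moreover have "has_bochner_integral lborel
      (\<lambda>x. (iexp (t * m) / of_real s) * (std_normal_density x *\<^sub>R iexp ((s * t) * x)))
      ((iexp (t * m) / of_real s) * of_real (exp (- (s * t)\<^sup>2 / 2)))"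
    by (intro has_bochner_integral_mult_right std)
  moreover have "(iexp (t * m) * of_real (exp (- (s * t)\<^sup>2 / 2))) /\<^sub>R \<bar>s\<bar> =
      (iexp (t * m) / of_real s) * of_real (exp (- (s * t)\<^sup>2 / 2))"
    using assms by (simp add: scaleR_conv_of_real field_simps)
  ultimately show ?thesis
    using assms by (subst lborel_has_bochner_integral_real_affine_iff[where c = s and t = m]) simp_all
qed

lemma has_bochner_integral_normal_square:
  fixes m s c :: real
  assumes "s > 0"
  shows "has_bochner_integral lborel (\<lambda>y. normal_density m s y * (y - c)\<^sup>2) ((m - c)\<^sup>2 + s\<^sup>2)"
proof -
  have 1: "has_bochner_integral lborel (\<lambda>y. normal_density m s y * (y - m)\<^sup>2) (s\<^sup>2)"
    using normal_moment_even[OF assms, of m 1] by (simp add: power2_eq_square)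
  have 2: "has_bochner_integral lborel (\<lambda>y. normal_density m s y * y) m"
    by (rule normal_moment_nz_1[OF assms])
  have 3: "has_bochner_integral lborel (\<lambda>y. normal_density m s y) 1"
    using assms by (simp add: has_bochner_integral_iff)
  \<comment> \<open>Expansion \<open>(y - c)^2 = (y - m)^2 + 2 (m - c) y + (c^2 - m^2)\<close>,
    which needs only the variance and the mean.\<close>
  have "has_bochner_integral lborel
     (\<lambda>y. (normal_density m s y * (y - m)\<^sup>2 + 2 * (m - c) * (normal_density m s y * y))
          + (c\<^sup>2 - m\<^sup>2) * normal_density m s y) ((s\<^sup>2 + 2 * (m - c) * m) + (c\<^sup>2 - m\<^sup>2) * 1)"
    by (intro has_bochner_integral_add has_bochner_integral_mult_right 1 2 3)
  then show ?thesis
    by (rule has_bochner_integral_cong[THEN iffD1, rotated -1])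
       (auto simp: power2_eq_square algebra_simps)
qed

text \<open>Adding \<open>B\<close> makes the integrand nonnegative, so the identity for nonnegative
  integrals over \<open>bind\<close> applies. All measures involved are probabilities, hence the
  shift contributes exactly \<open>B\<close> on both sides and can be removed again.\<close>

lemma integral_bind_bounded:
  fixes f :: "'b \<Rightarrow> real"
  assumes M: "prob_space M" and K: "K \<in> M \<rightarrow>\<^sub>M prob_algebra N"
    and f: "f \<in> borel_measurable N" and B: "\<And>x. \<bar>f x\<bar> \<le> B"
  shows "(\<integral>y. f y \<partial>(M \<bind> K)) = (\<integral>x. (\<integral>y. f y \<partial>K x) \<partial>M)"
proof -
  interpret M: prob_space M by fact
  have K': "K \<in> M \<rightarrow>\<^sub>M subprob_algebra N"
    using K by (rule measurable_prob_algebraD)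
  have Kx: "prob_space (K x)" "sets (K x) = sets N" if "x \<in> space M" for x
    using measurable_space[OF K that] by (auto simp: space_prob_algebra)
  interpret MK: prob_space "M \<bind> K"
    by (rule prob_space_bind'[OF _ K]) (simp add: space_prob_algebra M)
  have sMK: "sets (M \<bind> K) = sets N"
    by (rule sets_bind'[OF _ K]) (simp add: space_prob_algebra M)
  have fMK: "f \<in> borel_measurable (M \<bind> K)" using f sMK by (simp cong: measurable_cong_sets)
  have B0: "0 \<le> f x + B" for x using B[of x] by (simp add: abs_le_iff)
  have nn: "(\<integral>\<^sup>+y. ennreal (f y + B) \<partial>P) = ennreal ((\<integral>y. f y \<partial>P) + B) \<and> 0 \<le> (\<integral>y. f y \<partial>P) + B
      \<and> \<bar>\<integral>y. f y \<partial>P\<bar> \<le> B"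
    if P: "prob_space P" and fP: "f \<in> borel_measurable P" for P
  proof -
    interpret P: prob_space P by fact
    have i: "integrable P f"
      by (rule P.integrable_const_bound[of _ B]) (use B fP in auto)
    have "(\<integral>y. f y + B \<partial>P) = (\<integral>y. f y \<partial>P) + B"
      using i by (simp add: P.prob_space)
    moreover have "0 \<le> (\<integral>y. f y + B \<partial>P)" by (rule integral_nonneg_AE) (simp add: B0)
    moreover have "(\<integral>\<^sup>+y. ennreal (f y + B) \<partial>P) = ennreal (\<integral>y. f y + B \<partial>P)"
      by (rule nn_integral_eq_integral) (use i B0 in auto)
    moreover have "\<bar>\<integral>y. f y \<partial>P\<bar> \<le> B"
    proof -
      have "(\<integral>y. f y \<partial>P) \<le> (\<integral>y. B \<partial>P)" using i B by (intro integral_mono) (auto simp: abs_le_iff)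
      moreover have "(\<integral>y. - B \<partial>P) \<le> (\<integral>y. f y \<partial>P)"
      proof (intro integral_mono)
        fix x show "- B \<le> f x" using B[of x] by (simp add: abs_le_iff)
      qed (use i in auto)
      ultimately show ?thesis by (simp add: P.prob_space abs_le_iff)
    qed
    ultimately show ?thesis by simp
  qed
  have nnK: "(\<integral>\<^sup>+y. ennreal (f y + B) \<partial>K x) = ennreal ((\<integral>y. f y \<partial>K x) + B)" "0 \<le> (\<integral>y. f y \<partial>K x) + B"
      "\<bar>\<integral>y. f y \<partial>K x\<bar> \<le> B" if "x \<in> space M" for x
    using nn[OF Kx(1)[OF that]] f Kx(2)[OF that] by (auto cong: measurable_cong_sets)
  have meas: "(\<lambda>x. \<integral>y. f y \<partial>K x) \<in> borel_measurable M"
  proof -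
    have "(\<lambda>x. enn2real (\<integral>\<^sup>+y. ennreal (f y + B) \<partial>K x) - B) \<in> borel_measurable M"
      using measurable_compose[OF K' nn_integral_measurable_subprob_algebra[of "\<lambda>y. ennreal (f y + B)" N]] f
      by measurable
    then show ?thesis
      by (rule measurable_cong[THEN iffD1, rotated]) (simp add: nnK)
  qed
  have int: "integrable M (\<lambda>x. \<integral>y. f y \<partial>K x)"
    by (rule M.integrable_const_bound[of _ B]) (use meas nnK(3) in auto)
  have "ennreal ((\<integral>y. f y \<partial>(M \<bind> K)) + B) = (\<integral>\<^sup>+y. ennreal (f y + B) \<partial>(M \<bind> K))"
    using nn[OF MK.prob_space_axioms fMK] by simp
  also have "\<dots> = (\<integral>\<^sup>+x. (\<integral>\<^sup>+y. ennreal (f y + B) \<partial>K x) \<partial>M)"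
    by (rule nn_integral_bind[OF _ K']) (use f in measurable)
  also have "\<dots> = (\<integral>\<^sup>+x. ennreal ((\<integral>y. f y \<partial>K x) + B) \<partial>M)"
    by (rule nn_integral_cong) (simp add: nnK)
  also have "\<dots> = ennreal (\<integral>x. (\<integral>y. f y \<partial>K x) + B \<partial>M)"
    by (rule nn_integral_eq_integral) (use int nnK in auto)
  also have "(\<integral>x. (\<integral>y. f y \<partial>K x) + B \<partial>M) = (\<integral>x. (\<integral>y. f y \<partial>K x) \<partial>M) + B"
    using int by (simp add: M.prob_space)
  finally have "(\<integral>y. f y \<partial>(M \<bind> K)) + B = (\<integral>x. (\<integral>y. f y \<partial>K x) \<partial>M) + B"
  proof (subst (asm) ennreal_inj)
    have "0 \<le> (\<integral>x. (\<integral>y. f y \<partial>K x) + B \<partial>M)" 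
      by (rule integral_nonneg_AE) (use nnK in auto)
    then show "0 \<le> (\<integral>x. (\<integral>y. f y \<partial>K x) \<partial>M) + B"
      using int by (simp add: M.prob_space)
  qed (use nn[OF MK.prob_space_axioms fMK] in auto)
  then show ?thesis by simp
qed

lemma real_distribution_iff: "real_distribution M \<longleftrightarrow> prob_space M \<and> sets M = sets borel"
  by (simp add: real_distribution_def real_distribution_axioms_def)

text \<open>The stationary analysis lives on the parameters alone, apart from any tree process. The
  correlation \<rho> is absent because the kernel follows one daughter at a time.\<close>

locale bar_params =
  fixes \<alpha>\<^sub>0 \<beta>\<^sub>0 \<alpha>\<^sub>1 \<beta>\<^sub>1 \<sigma> :: real
  assumes a0: "\<bar>\<alpha>\<^sub>0\<bar> < 1" and a1: "\<bar>\<alpha>\<^sub>1\<bar> < 1" and sig: "\<sigma> > 0"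
begin

abbreviation Q :: "real \<Rightarrow> real measure" where "Q \<equiv> bar_kernel \<alpha>\<^sub>0 \<beta>\<^sub>0 \<alpha>\<^sub>1 \<beta>\<^sub>1 \<sigma>"

section \<open>The kernel: measurability, second moments and characteristic function\<close>

lemma sets_Q [simp, measurable_cong]: "sets (Q x) = sets borel"
  by (simp add: bar_kernel_def)

lemma nn_integral_Q:
  assumes [measurable]: "g \<in> borel_measurable borel" and g0: "\<And>y. 0 \<le> g y"
    and "has_bochner_integral lborel (\<lambda>y. normal_density (\<alpha>\<^sub>0 * x + \<beta>\<^sub>0) \<sigma> y * g y) A"
    and "has_bochner_integral lborel (\<lambda>y. normal_density (\<alpha>\<^sub>1 * x + \<beta>\<^sub>1) \<sigma> y * g y) B"
  shows "(\<integral>\<^sup>+y. ennreal (g y) \<partial>Q x) = ennreal ((A + B) / 2)"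
proof -
  have "has_bochner_integral lborel (\<lambda>y. (normal_density (\<alpha>\<^sub>0 * x + \<beta>\<^sub>0) \<sigma> y * g y
          + normal_density (\<alpha>\<^sub>1 * x + \<beta>\<^sub>1) \<sigma> y * g y) / 2) ((A + B) / 2)"
    by (intro has_bochner_integral_divide_zero has_bochner_integral_add assms)
  then have "has_bochner_integral lborel (\<lambda>y. (normal_density (\<alpha>\<^sub>0 * x + \<beta>\<^sub>0) \<sigma> y / 2
          + normal_density (\<alpha>\<^sub>1 * x + \<beta>\<^sub>1) \<sigma> y / 2) * g y) ((A + B) / 2)"
    by (simp add: field_simps)
  then have "(\<integral>\<^sup>+y. ennreal ((normal_density (\<alpha>\<^sub>0 * x + \<beta>\<^sub>0) \<sigma> y / 2
          + normal_density (\<alpha>\<^sub>1 * x + \<beta>\<^sub>1) \<sigma> y / 2) * g y) \<partial>lborel) = ennreal ((A + B) / 2)"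
    unfolding has_bochner_integral_iff
    by (elim conjE) (subst nn_integral_eq_integral, auto simp: g0 simp del: eq_divide_eq_numeral1)
  then show ?thesis
    unfolding bar_kernel_def
    by (subst nn_integral_density) (auto simp: ennreal_mult' g0)
qed

lemma prob_space_Q: "prob_space (Q x)"
proof
  have "(\<integral>\<^sup>+y. ennreal 1 \<partial>Q x) = ennreal ((1 + 1) / 2)"
    by (rule nn_integral_Q) (auto simp: has_bochner_integral_iff sig)
  then show "emeasure (Q x) (space (Q x)) = 1" by simp
qed

lemma measurable_Q: "Q \<in> borel \<rightarrow>\<^sub>M prob_algebra borel"
proof (rule measurable_prob_algebraI)
  show "prob_space (Q x)" for x by (rule prob_space_Q)
  show "Q \<in> borel \<rightarrow>\<^sub>M subprob_algebra borel"
  proof (rule measurable_subprob_algebra)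
    show "subprob_space (Q a)" for a using prob_space_Q by (rule prob_space_imp_subprob_space)
    show "(\<lambda>a. emeasure (Q a) A) \<in> borel_measurable borel" if [measurable]: "A \<in> sets borel" for A
      unfolding bar_kernel_def normal_density_def by (simp add: emeasure_density)
  qed simp
qed

lemma nn_integral_square_Q:
  "(\<integral>\<^sup>+y. ennreal ((y - c)\<^sup>2) \<partial>Q x) =
     ennreal (((\<alpha>\<^sub>0 * x + \<beta>\<^sub>0 - c)\<^sup>2 + (\<alpha>\<^sub>1 * x + \<beta>\<^sub>1 - c)\<^sup>2) / 2 + \<sigma>\<^sup>2)"
proof -
  have "(\<integral>\<^sup>+y. ennreal ((y - c)\<^sup>2) \<partial>Q x) = ennreal
     ((((\<alpha>\<^sub>0 * x + \<beta>\<^sub>0 - c)\<^sup>2 + \<sigma>\<^sup>2) + ((\<alpha>\<^sub>1 * x + \<beta>\<^sub>1 - c)\<^sup>2 + \<sigma>\<^sup>2)) / 2)"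
    by (rule nn_integral_Q) (auto intro!: has_bochner_integral_normal_square sig)
  then show ?thesis by (simp add: field_simps)
qed

lemma char_Q:
  "char (Q x) t = (iexp (t * (\<alpha>\<^sub>0 * x + \<beta>\<^sub>0)) + iexp (t * (\<alpha>\<^sub>1 * x + \<beta>\<^sub>1))) / 2 * of_real (exp (- (\<sigma> * t)\<^sup>2 / 2))"
proof -
  have "char (Q x) t = (\<integral>y. (normal_density (\<alpha>\<^sub>0 * x + \<beta>\<^sub>0) \<sigma> y *\<^sub>R iexp (t * y) +
      normal_density (\<alpha>\<^sub>1 * x + \<beta>\<^sub>1) \<sigma> y *\<^sub>R iexp (t * y)) / 2 \<partial>lborel)"
    unfolding char_def bar_kernel_def
    by (subst integral_density) (auto simp: scaleR_conv_of_real field_simps)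
  also have "\<dots> = (iexp (t * (\<alpha>\<^sub>0 * x + \<beta>\<^sub>0)) * of_real (exp (- (\<sigma> * t)\<^sup>2 / 2)) +
      iexp (t * (\<alpha>\<^sub>1 * x + \<beta>\<^sub>1)) * of_real (exp (- (\<sigma> * t)\<^sup>2 / 2))) / 2"
    by (intro has_bochner_integral_integral_eq has_bochner_integral_divide_zero
        has_bochner_integral_add has_bochner_integral_normal_iexp sig)
  finally show ?thesis by (simp add: algebra_simps)
qed

lemma real_distribution_bind_Q:
  assumes "real_distribution \<mu>" shows "real_distribution (\<mu> \<bind> Q)"
proof -
  have "\<mu> \<in> space (prob_algebra borel)"
    using assms by (simp add: real_distribution_iff space_prob_algebra)
  from prob_space_bind'[OF this measurable_Q] sets_bind'[OF this measurable_Q]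
  show ?thesis by (simp add: real_distribution_iff)
qed

lemma char_bind_Q:
  assumes "real_distribution \<mu>"
  shows "char (\<mu> \<bind> Q) t = (iexp (t * \<beta>\<^sub>0) * char \<mu> (\<alpha>\<^sub>0 * t) + iexp (t * \<beta>\<^sub>1) * char \<mu> (\<alpha>\<^sub>1 * t)) / 2
     * of_real (exp (- (\<sigma> * t)\<^sup>2 / 2))"
proof -
  interpret \<mu>: real_distribution \<mu> by fact
  interpret \<mu>Q: real_distribution "\<mu> \<bind> Q" by (rule real_distribution_bind_Q) fact
  interpret Q: prob_space "Q x" for x by (rule prob_space_Q)
  have MQ: "Q \<in> \<mu> \<rightarrow>\<^sub>M prob_algebra borel"
    using measurable_Q by (simp cong: measurable_cong_sets)
  have int: "integrable P (\<lambda>x. iexp (s * x))" if "real_distribution P" for P s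
  proof -
    interpret real_distribution P by fact
    show ?thesis by (rule integrable_iexp) auto
  qed
  have intQ: "integrable (Q x) (\<lambda>y. iexp (s * y))" for x s
    by (rule int) (simp add: real_distribution_iff prob_space_Q)
  have cmeas: "(\<lambda>x. char (Q x) t) \<in> borel_measurable \<mu>"
    unfolding char_Q by measurable
  have cint: "integrable \<mu> (\<lambda>x. char (Q x) t)"
    by (rule \<mu>.integrable_const_bound[of _ 1])
       (use cmeas real_distribution.cmod_char_le_1 in \<open>auto simp: real_distribution_iff prob_space_Q\<close>)
  have "char (\<mu> \<bind> Q) t = (\<integral>x. char (Q x) t \<partial>\<mu>)"
  \<comment> \<open>\<open>integral_bind_bounded\<close> is a statement on bounded real integrands,
    so real and imaginary parts are pushed through the kernel separately.\<close>
  proof (rule complex_eqI)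
    have "Re (char (\<mu> \<bind> Q) t) = (\<integral>y. Re (iexp (t * y)) \<partial>(\<mu> \<bind> Q))"
      unfolding char_def by (rule integral_Re[symmetric, OF int]) (rule \<mu>Q.real_distribution_axioms)
    also have "\<dots> = (\<integral>x. (\<integral>y. Re (iexp (t * y)) \<partial>Q x) \<partial>\<mu>)"
      by (rule integral_bind_bounded[OF \<mu>.prob_space_axioms MQ, of _ 1]) 
         (auto intro: order_trans[OF abs_Re_le_cmod])
    also have "\<dots> = (\<integral>x. Re (char (Q x) t) \<partial>\<mu>)"
      unfolding char_def by (subst integral_Re[OF intQ]) simp
    also have "\<dots> = Re (\<integral>x. char (Q x) t \<partial>\<mu>)" by (rule integral_Re[OF cint])
    finally show "Re (char (\<mu> \<bind> Q) t) = Re (\<integral>x. char (Q x) t \<partial>\<mu>)" .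
    have "Im (char (\<mu> \<bind> Q) t) = (\<integral>y. Im (iexp (t * y)) \<partial>(\<mu> \<bind> Q))"
      unfolding char_def by (rule integral_Im[symmetric, OF int]) (rule \<mu>Q.real_distribution_axioms)
    also have "\<dots> = (\<integral>x. (\<integral>y. Im (iexp (t * y)) \<partial>Q x) \<partial>\<mu>)"
      by (rule integral_bind_bounded[OF \<mu>.prob_space_axioms MQ, of _ 1]) 
         (auto intro: order_trans[OF abs_Im_le_cmod])
    also have "\<dots> = (\<integral>x. Im (char (Q x) t) \<partial>\<mu>)"
      unfolding char_def by (subst integral_Im[OF intQ]) simp
    also have "\<dots> = Im (\<integral>x. char (Q x) t \<partial>\<mu>)" by (rule integral_Im[OF cint])
    finally show "Im (char (\<mu> \<bind> Q) t) = Im (\<integral>x. char (Q x) t \<partial>\<mu>)" .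
  qed
  also have "\<dots> = (\<integral>x. (iexp (t * \<beta>\<^sub>0) * iexp ((\<alpha>\<^sub>0 * t) * x) + iexp (t * \<beta>\<^sub>1) * iexp ((\<alpha>\<^sub>1 * t) * x)) / 2
     * of_real (exp (- (\<sigma> * t)\<^sup>2 / 2)) \<partial>\<mu>)"
    unfolding char_Q by (simp add: exp_add[symmetric] algebra_simps)
  also have "\<dots> = (iexp (t * \<beta>\<^sub>0) * char \<mu> (\<alpha>\<^sub>0 * t) + iexp (t * \<beta>\<^sub>1) * char \<mu> (\<alpha>\<^sub>1 * t)) / 2
     * of_real (exp (- (\<sigma> * t)\<^sup>2 / 2))"
    unfolding char_def
    by (intro has_bochner_integral_integral_eq has_bochner_integral_divide_zero has_bochner_integral_mult_left
        has_bochner_integral_mult_right has_bochner_integral_add has_bochner_integral_integrable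
        int[OF \<mu>.real_distribution_axioms])
  finally show ?thesis .
qed

text \<open>One rate with two uses: it shrinks the argument of characteristic functions, and it is
  the factor by which second moments contract.\<close>

definition contr :: real where "contr = max \<bar>\<alpha>\<^sub>0\<bar> \<bar>\<alpha>\<^sub>1\<bar>"

lemma contr: "0 \<le> contr" "contr < 1" "\<bar>\<alpha>\<^sub>0\<bar> \<le> contr" "\<bar>\<alpha>\<^sub>1\<bar> \<le> contr"
  using a0 a1 by (auto simp: contr_def)

text \<open>By \<open>char_bind_Q\<close> the new difference is an average of the two old ones with
  weights of modulus one, multiplied by a Gaussian factor that is at most 1.\<close>

lemma char_bind_Q_dist:
  assumes "real_distribution \<mu>" "real_distribution \<mu>'"
    and "cmod (char \<mu> (\<alpha>\<^sub>0 * t) - char \<mu>' (\<alpha>\<^sub>0 * t)) \<le> e"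
    and "cmod (char \<mu> (\<alpha>\<^sub>1 * t) - char \<mu>' (\<alpha>\<^sub>1 * t)) \<le> e"
  shows "cmod (char (\<mu> \<bind> Q) t - char (\<mu>' \<bind> Q) t) \<le> e"
proof -
  let ?d = "\<lambda>s. char \<mu> s - char \<mu>' s"
  have "char (\<mu> \<bind> Q) t - char (\<mu>' \<bind> Q) t =
     (iexp (t * \<beta>\<^sub>0) * ?d (\<alpha>\<^sub>0 * t) + iexp (t * \<beta>\<^sub>1) * ?d (\<alpha>\<^sub>1 * t)) / 2 * of_real (exp (- (\<sigma> * t)\<^sup>2 / 2))"
    unfolding char_bind_Q[OF assms(1)] char_bind_Q[OF assms(2)]
    by (simp only: diff_divide_distrib[symmetric] left_diff_distrib[symmetric] right_diff_distrib
        diff_add_eq_diff_diff_swap) (simp add: algebra_simps diff_divide_distrib add_divide_distrib)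
  also have "cmod \<dots> = cmod (iexp (t * \<beta>\<^sub>0) * ?d (\<alpha>\<^sub>0 * t) + iexp (t * \<beta>\<^sub>1) * ?d (\<alpha>\<^sub>1 * t)) / 2 * exp (- (\<sigma> * t)\<^sup>2 / 2)"
    by (simp add: norm_mult norm_divide)
  also have "\<dots> \<le> cmod (iexp (t * \<beta>\<^sub>0) * ?d (\<alpha>\<^sub>0 * t) + iexp (t * \<beta>\<^sub>1) * ?d (\<alpha>\<^sub>1 * t)) / 2 * 1"
    by (intro mult_left_mono) auto
  also have "\<dots> \<le> (cmod (?d (\<alpha>\<^sub>0 * t)) + cmod (?d (\<alpha>\<^sub>1 * t))) / 2"
    using norm_triangle_ineq[of "iexp (t * \<beta>\<^sub>0) * ?d (\<alpha>\<^sub>0 * t)" "iexp (t * \<beta>\<^sub>1) * ?d (\<alpha>\<^sub>1 * t)"]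
    by (simp add: norm_mult)
  also have "\<dots> \<le> e" using assms(3,4) by simp
  finally show ?thesis .
qed

text \<open>A bound of the initial distance on \<open>\<bar>s\<bar> \<le> contr ^ n * \<bar>t\<bar>\<close> controls the distance at \<open>t\<close>
  after \<open>n\<close> steps, because each step scales the argument by \<open>\<alpha>\<^sub>0\<close> or \<open>\<alpha>\<^sub>1\<close>.\<close>

lemma char_iterate_dist:
  assumes "\<And>n. real_distribution (\<mu> n)" "\<And>n. real_distribution (\<mu>' n)"
    and step: "\<And>n. \<mu> (Suc n) = \<mu> n \<bind> Q" "\<And>n. \<mu>' (Suc n) = \<mu>' n \<bind> Q"
    and "\<And>s. \<bar>s\<bar> \<le> contr ^ n * \<bar>t\<bar> \<Longrightarrow> cmod (char (\<mu> 0) s - char (\<mu>' 0) s) \<le> e"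
  shows "cmod (char (\<mu> n) t - char (\<mu>' n) t) \<le> e"
  using assms(5)
proof (induction n arbitrary: t)
  case (Suc n)
  have aux: "\<bar>s\<bar> \<le> contr ^ Suc n * \<bar>t\<bar>" if "\<bar>a\<bar> \<le> contr" "\<bar>s\<bar> \<le> contr ^ n * \<bar>a * t\<bar>" for a s
  proof -
    have "contr ^ n * \<bar>a * t\<bar> \<le> contr ^ n * (contr * \<bar>t\<bar>)"
      using that contr unfolding abs_mult by (intro mult_left_mono mult_right_mono) auto
    with that show ?thesis by (simp add: ac_simps)
  qed
  show ?case unfolding step
  proof (rule char_bind_Q_dist[OF assms(1,2)])
    show "cmod (char (\<mu> n) (\<alpha>\<^sub>0 * t) - char (\<mu>' n) (\<alpha>\<^sub>0 * t)) \<le> e"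
      by (intro Suc.IH Suc.prems aux[OF contr(3)])
    show "cmod (char (\<mu> n) (\<alpha>\<^sub>1 * t) - char (\<mu>' n) (\<alpha>\<^sub>1 * t)) \<le> e"
      by (intro Suc.IH Suc.prems aux[OF contr(4)])
  qed
qed simp

text \<open>After \<open>n\<close> steps the distance at \<open>t\<close> is controlled by the
  initial characteristic functions on a neighbourhood of 0 that shrinks like
  \<open>contr ^ n\<close>. Both are continuous there and equal 1 at 0, so mere continuity is enough
  and no moment of the initial laws enters.\<close>

lemma char_iterate_dist_tendsto:
  assumes "\<And>n. real_distribution (\<mu> n)" "\<And>n. real_distribution (\<mu>' n)"
    and step: "\<And>n. \<mu> (Suc n) = \<mu> n \<bind> Q" "\<And>n. \<mu>' (Suc n) = \<mu>' n \<bind> Q"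
  shows "(\<lambda>n. char (\<mu> n) t - char (\<mu>' n) t) \<longlonglongrightarrow> 0"
proof (rule LIMSEQ_I)
  fix e :: real assume "e > 0"
  interpret A: real_distribution "\<mu> 0" by fact
  interpret B: real_distribution "\<mu>' 0" by fact
  have "isCont (\<lambda>s. char (\<mu> 0) s - char (\<mu>' 0) s) 0"
    by (intro continuous_intros A.isCont_char B.isCont_char)
  then obtain d where "d > 0" and d: "\<And>s. \<bar>s\<bar> < d \<Longrightarrow> cmod (char (\<mu> 0) s - char (\<mu>' 0) s) < e / 2"
    unfolding continuous_at_eps_delta using half_gt_zero[OF \<open>e > 0\<close>]
    by (metis A.char_zero B.char_zero cancel_comm_monoid_add_class.diff_cancel diff_zero dist_norm norm_minus_commute
        real_norm_def)
  have "(\<lambda>n. contr ^ n * \<bar>t\<bar>) \<longlonglongrightarrow> 0 * \<bar>t\<bar>"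
    by (rule tendsto_mult[OF LIMSEQ_power_zero tendsto_const]) (use contr in simp)
  then have "\<forall>\<^sub>F n in sequentially. contr ^ n * \<bar>t\<bar> < d"
    using \<open>d > 0\<close> by (intro order_tendstoD(2)) auto
  then obtain N where N: "\<And>n. n \<ge> N \<Longrightarrow> contr ^ n * \<bar>t\<bar> < d"
    by (auto simp: eventually_sequentially)
  show "\<exists>N. \<forall>n\<ge>N. cmod (char (\<mu> n) t - char (\<mu>' n) t - 0) < e"
  proof (intro exI allI impI)
    fix n assume "n \<ge> N"
    have "cmod (char (\<mu> n) t - char (\<mu>' n) t) \<le> e / 2"
    proof (rule char_iterate_dist[where \<mu> = \<mu> and \<mu>' = \<mu>', OF assms])
      fix s assume "\<bar>s\<bar> \<le> contr ^ n * \<bar>t\<bar>"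
      then show "cmod (char (\<mu> 0) s - char (\<mu>' 0) s) \<le> e / 2"
        using N[OF \<open>n \<ge> N\<close>] by (intro less_imp_le d) simp
    qed
    with \<open>e > 0\<close> show "cmod (char (\<mu> n) t - char (\<mu>' n) t - 0) < e" by simp
  qed
qed

section \<open>Uniqueness, existence and moments of the stationary law\<close>

lemma stationary_distribution_iff:
  "stationary_distribution Q \<mu> \<longleftrightarrow> real_distribution \<mu> \<and> \<mu> \<bind> Q = \<mu>"
proof (cases "real_distribution \<mu>")
  case True
  then interpret real_distribution \<mu> .
  have Q: "Q \<in> \<mu> \<rightarrow>\<^sub>M subprob_algebra borel"
    using measurable_prob_algebraD[OF measurable_Q] by (simp cong: measurable_cong_sets)
  have "(\<forall>A\<in>sets borel. (\<integral>\<^sup>+x. emeasure (Q x) A \<partial>\<mu>) = emeasure \<mu> A) \<longleftrightarrow>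
    (\<forall>A\<in>sets borel. emeasure (\<mu> \<bind> Q) A = emeasure \<mu> A)"
    by (intro ball_cong refl) (subst emeasure_bind[OF _ Q], auto)
  also have "\<dots> \<longleftrightarrow> \<mu> \<bind> Q = \<mu>"
    using real_distribution_bind_Q[OF True]
    by (auto simp: real_distribution_iff intro!: measure_eqI)
  finally show ?thesis
    using True by (auto simp: stationary_distribution_def real_distribution_iff)
qed (auto simp: stationary_distribution_def real_distribution_iff)

lemma stationary_unique:
  assumes "stationary_distribution Q \<mu>" "stationary_distribution Q \<mu>'"
  shows "\<mu>' = \<mu>"
proof (rule Levy_uniqueness)
  show "char \<mu>' = char \<mu>"
  proof
    fix t
    \<comment> \<open>A stationary law is its own orbit, so the sequence that tends to zero is
      constant.\<close>
    have "(\<lambda>n::nat. char \<mu>' t - char \<mu> t) \<longlonglongrightarrow> 0"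
      using char_iterate_dist_tendsto[of "\<lambda>_. \<mu>'" "\<lambda>_. \<mu>" t] assms
      by (simp add: stationary_distribution_iff)
    then show "char \<mu>' t = char \<mu> t" by (simp add: LIMSEQ_const_iff)
  qed
qed (use assms in \<open>auto simp: stationary_distribution_iff\<close>)

text \<open>Convexity of the square, applied to
  \<open>a x + b = c (a x / c) + (1 - c) (b / (1 - c))\<close>, followed by
  \<open>a^2 \<le> c^2\<close>.\<close>

lemma affine_square_le:
  fixes a b c x :: real
  assumes "\<bar>a\<bar> \<le> c" "c < 1"
  shows "(a * x + b)\<^sup>2 \<le> c * x\<^sup>2 + b\<^sup>2 / (1 - c)"
proof -
  have c: "0 \<le> c" "0 < 1 - c" using assms by auto
  have a2: "a\<^sup>2 \<le> c\<^sup>2" using assms c by (metis abs_le_square_iff abs_of_nonneg)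
  \<comment> \<open>The convexity defect with the denominators \<open>c\<close> and
    \<open>1 - c\<close> cleared, so that \<open>c = 0\<close> is a special case only when the
    factor \<open>c\<close> is cancelled at the end.\<close>
  have "0 \<le> ((1 - c) * (a * x) - c * b)\<^sup>2" by simp
  then have "c * ((1 - c) * (a * x + b)\<^sup>2) \<le> (1 - c) * (a\<^sup>2 * x\<^sup>2) + c * b\<^sup>2"
    by (simp add: power2_eq_square algebra_simps)
  also have "\<dots> \<le> (1 - c) * (c\<^sup>2 * x\<^sup>2) + c * b\<^sup>2"
    using a2 c by (intro add_mono mult_left_mono mult_right_mono) auto
  also have "\<dots> = c * ((1 - c) * (c * x\<^sup>2) + b\<^sup>2)" by (simp add: power2_eq_square algebra_simps)
  finally have *: "c * ((1 - c) * (a * x + b)\<^sup>2) \<le> c * ((1 - c) * (c * x\<^sup>2) + b\<^sup>2)" .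
  show ?thesis
  proof (cases "c = 0")
    case True with assms show ?thesis by simp
  next
    case False
    with c * have "(1 - c) * (a * x + b)\<^sup>2 \<le> (1 - c) * (c * x\<^sup>2) + b\<^sup>2" by simp
    with c(2) show ?thesis by (simp add: field_simps)
  qed
qed

text \<open>A Foster-Lyapunov drift condition with Lyapunov function \<open>x^2\<close>. It is
  stated for extended nonnegative values, so that it holds whether or not the second moment is
  finite.\<close>

lemma bind_Q_square_le:
  assumes "real_distribution \<mu>"
  shows "(\<integral>\<^sup>+x. ennreal (x\<^sup>2) \<partial>(\<mu> \<bind> Q)) \<le> ennreal contr * (\<integral>\<^sup>+x. ennreal (x\<^sup>2) \<partial>\<mu>)
    + ennreal ((\<beta>\<^sub>0\<^sup>2 + \<beta>\<^sub>1\<^sup>2) / (1 - contr) + \<sigma>\<^sup>2)"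
proof -
  interpret real_distribution \<mu> by fact
  have Q: "Q \<in> \<mu> \<rightarrow>\<^sub>M subprob_algebra borel"
    using measurable_prob_algebraD[OF measurable_Q] by (simp cong: measurable_cong_sets)
  let ?C = "(\<beta>\<^sub>0\<^sup>2 + \<beta>\<^sub>1\<^sup>2) / (1 - contr) + \<sigma>\<^sup>2"
  have C: "0 \<le> ?C" using contr by (intro add_nonneg_nonneg divide_nonneg_nonneg) auto
  have "(\<integral>\<^sup>+x. ennreal (x\<^sup>2) \<partial>(\<mu> \<bind> Q)) = (\<integral>\<^sup>+x. (\<integral>\<^sup>+y. ennreal ((y - 0)\<^sup>2) \<partial>Q x) \<partial>\<mu>)"
    by (subst nn_integral_bind[OF _ Q]) auto
  also have "\<dots> \<le> (\<integral>\<^sup>+x. ennreal contr * ennreal (x\<^sup>2) + ennreal ?C \<partial>\<mu>)"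
  proof (rule nn_integral_mono)
    fix x
    have "(\<alpha>\<^sub>0 * x + \<beta>\<^sub>0)\<^sup>2 \<le> contr * x\<^sup>2 + \<beta>\<^sub>0\<^sup>2 / (1 - contr)" "(\<alpha>\<^sub>1 * x + \<beta>\<^sub>1)\<^sup>2 \<le> contr * x\<^sup>2 + \<beta>\<^sub>1\<^sup>2 / (1 - contr)"
      using contr by (auto intro: affine_square_le)
    moreover have "0 \<le> \<beta>\<^sub>0\<^sup>2 / (1 - contr)" "0 \<le> \<beta>\<^sub>1\<^sup>2 / (1 - contr)" using contr by auto
    ultimately have "((\<alpha>\<^sub>0 * x + \<beta>\<^sub>0)\<^sup>2 + (\<alpha>\<^sub>1 * x + \<beta>\<^sub>1)\<^sup>2) / 2 + \<sigma>\<^sup>2 \<le> contr * x\<^sup>2 + ?C"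
      unfolding add_divide_distrib by linarith
    then have "ennreal (((\<alpha>\<^sub>0 * x + \<beta>\<^sub>0 - 0)\<^sup>2 + (\<alpha>\<^sub>1 * x + \<beta>\<^sub>1 - 0)\<^sup>2) / 2 + \<sigma>\<^sup>2) \<le> ennreal (contr * x\<^sup>2 + ?C)"
      by (intro ennreal_leI) simp
    also have "\<dots> = ennreal contr * ennreal (x\<^sup>2) + ennreal ?C"
      using contr C by (subst ennreal_plus) (auto simp: ennreal_mult)
    finally show "(\<integral>\<^sup>+y. ennreal ((y - 0)\<^sup>2) \<partial>Q x) \<le> ennreal contr * ennreal (x\<^sup>2) + ennreal ?C"
      unfolding nn_integral_square_Q .
  qed
  also have "\<dots> = ennreal contr * (\<integral>\<^sup>+x. ennreal (x\<^sup>2) \<partial>\<mu>) + ennreal ?C"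
    by (subst nn_integral_add) (auto simp: nn_integral_cmult emeasure_space_1 simp del: space_eq_univ)
  finally show ?thesis .
qed

text \<open>A Krylov-Bogolyubov argument without Cesaro averages: the iterates from a point mass are
  tight by the drift condition, and consecutive iterates have asymptotically equal characteristic
  functions, so every subsequential limit is already fixed by the kernel. The second moment is
  carried along because \<open>stationary_moments\<close> asks for its finiteness.\<close>

lemma stationary_exists:
  "\<exists>\<mu>. stationary_distribution Q \<mu> \<and> (\<integral>\<^sup>+x. ennreal (x\<^sup>2) \<partial>\<mu>) < \<infinity>"
proof -
  define \<mu> where "\<mu> n = ((\<lambda>m. m \<bind> Q) ^^ n) (return borel 0)" for n
  have \<mu>Suc: "\<mu> (Suc n) = \<mu> n \<bind> Q" for n by (simp add: \<mu>_def)
  have \<mu>rd: "real_distribution (\<mu> n)" for n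
  proof (induction n)
    case 0 show ?case by (simp add: \<mu>_def real_distribution_iff prob_space_return)
  next
    case (Suc n) then show ?case unfolding \<mu>Suc by (rule real_distribution_bind_Q)
  qed
  \<comment> \<open>\<open>C\<close> is the fixed point of the drift bound
    \<open>m \<mapsto> contr m + K\<close>, hence preserved by each step; the orbit starts below it,
    at second moment 0.\<close>
  define C where "C = ((\<beta>\<^sub>0\<^sup>2 + \<beta>\<^sub>1\<^sup>2) / (1 - contr) + \<sigma>\<^sup>2) / (1 - contr)"
  have C: "0 \<le> C" using contr unfolding C_def
    by (intro divide_nonneg_nonneg add_nonneg_nonneg) auto
  have sq: "(\<integral>\<^sup>+x. ennreal (x\<^sup>2) \<partial>\<mu> n) \<le> ennreal C" for n
  proof (induction n)
    case 0 show ?case by (simp add: \<mu>_def nn_integral_return)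
  next
    case (Suc n)
    have *: "(1 - contr) * C = (\<beta>\<^sub>0\<^sup>2 + \<beta>\<^sub>1\<^sup>2) / (1 - contr) + \<sigma>\<^sup>2"
      using contr by (simp add: C_def)
    have "(\<integral>\<^sup>+x. ennreal (x\<^sup>2) \<partial>\<mu> (Suc n)) \<le> ennreal contr * ennreal C + ennreal ((1 - contr) * C)"
      unfolding \<mu>Suc * by (rule order_trans[OF bind_Q_square_le[OF \<mu>rd]]) (intro add_mono mult_left_mono Suc; simp)
    also have "\<dots> = ennreal (contr * C + (1 - contr) * C)"
      using contr C by (subst ennreal_plus) (auto simp: ennreal_mult)
    finally show ?case by (simp add: algebra_simps)
  qed
  have "tight \<mu>"
    unfolding tight_def
  proof (intro conjI allI impI \<mu>rd)
    fix e :: real assume "e > 0"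
    \<comment> \<open>Markov's inequality for \<open>x^2\<close> bounds the tail by
      \<open>C / R^2\<close>; the summand 1 makes this strictly smaller than \<open>e\<close> and
      \<open>R\<close> strictly positive.\<close>
    define R where "R = sqrt (C / e) + 1"
    have R: "0 < R" "C / e < R\<^sup>2"
    proof -
      have s: "0 \<le> sqrt (C / e)" using C \<open>e > 0\<close> by simp
      then show "0 < R" unfolding R_def by linarith
      have "C / e = (sqrt (C / e))\<^sup>2" using C \<open>e > 0\<close> by simp
      also have "\<dots> < R\<^sup>2" unfolding R_def by (rule power_strict_mono) (use s in auto)
      finally show "C / e < R\<^sup>2" .
    qed
    show "\<exists>a b. a < b \<and> (\<forall>n. 1 - e < measure (\<mu> n) {a<..b})"
    proof (intro exI conjI allI)
      show "- R < R" using R by simp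
      fix n
      interpret real_distribution "\<mu> n" by (rule \<mu>rd)
      have int: "integrable (\<mu> n) (\<lambda>x. x\<^sup>2)"
        using order_le_less_trans[OF sq[of n]] by (intro integrableI_bounded) auto
      have "(\<integral>x. x\<^sup>2 \<partial>\<mu> n) \<le> C"
        using sq[of n] C by (simp add: nn_integral_eq_integral[OF int])
      then have "(\<integral>x. x\<^sup>2 \<partial>\<mu> n) / R\<^sup>2 \<le> C / R\<^sup>2" by (intro divide_right_mono) auto
      then have "prob {x. R\<^sup>2 \<le> x\<^sup>2} \<le> C / R\<^sup>2"
        using integral_Markov_inequality_measure[OF int, of UNIV "R\<^sup>2"] R by simp
      also have "\<dots> < e" using R \<open>e > 0\<close> C by (simp add: field_simps)
      finally have "prob {x. R\<^sup>2 \<le> x\<^sup>2} < e" .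
      moreover have "prob (space (\<mu> n) - {x. R\<^sup>2 \<le> x\<^sup>2}) = 1 - prob {x. R\<^sup>2 \<le> x\<^sup>2}"
        by (rule prob_compl) simp
      moreover have "prob (space (\<mu> n) - {x. R\<^sup>2 \<le> x\<^sup>2}) \<le> prob {- R<..R}"
      proof (rule finite_measure_mono)
        show "space (\<mu> n) - {x. R\<^sup>2 \<le> x\<^sup>2} \<subseteq> {- R<..R}"
          using R(1) by (auto simp: abs_le_square_iff[symmetric] not_le)
      qed simp
      ultimately show "1 - e < prob {- R<..R}" by simp
    qed
  qed
  from tight_imp_convergent_subsubsequence[OF this strict_mono_id]
  obtain r M where r: "strict_mono r" and M: "real_distribution M" "weak_conv_m (\<mu> \<circ> r) M"
    by auto
  interpret M: real_distribution M by fact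
  have conv: "(\<lambda>n. char (\<mu> (r n)) t) \<longlonglongrightarrow> char M t" for t
    using levy_continuity1[of "\<mu> \<circ> r" M t] M \<mu>rd by simp
  have "M \<bind> Q = M"
  proof (rule Levy_uniqueness)
    show "char (M \<bind> Q) = char M"
    proof
      fix t
      \<comment> \<open>The orbit and its shift by one step are two orbits of the same map.\<close>
      have "(\<lambda>n. char (\<mu> n \<bind> Q) t - char (\<mu> n) t) \<longlonglongrightarrow> 0"
        using char_iterate_dist_tendsto[of "\<lambda>n. \<mu> (Suc n)" \<mu> t] \<mu>rd by (simp add: \<mu>Suc real_distribution_bind_Q)
      then have "(\<lambda>n. char (\<mu> (r n) \<bind> Q) t - char (\<mu> (r n)) t) \<longlonglongrightarrow> 0"
        using LIMSEQ_subseq_LIMSEQ[OF _ r] by (fastforce simp: comp_def)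
      moreover have "(\<lambda>n. char (\<mu> (r n) \<bind> Q) t - char (\<mu> (r n)) t) \<longlonglongrightarrow> char (M \<bind> Q) t - char M t"
        unfolding char_bind_Q[OF \<mu>rd] char_bind_Q[OF M(1)]
        by (intro tendsto_intros conv) auto
      ultimately show "char (M \<bind> Q) t = char M t"
        using LIMSEQ_unique by fastforce
    qed
  qed (use M real_distribution_bind_Q in auto)
  moreover have "(\<integral>\<^sup>+x. ennreal (x\<^sup>2) \<partial>M) \<le> ennreal C"
  proof -
    \<comment> \<open>The unbounded \<open>x^2\<close> is no test function for weak convergence. Its
      truncations at \<open>k\<close> are, and monotone convergence in \<open>k\<close> recovers the
      second moment of the limit.\<close>
    have bdd: "(\<integral>\<^sup>+x. ennreal (min (x\<^sup>2) (real k)) \<partial>M) \<le> ennreal C" for k :: nat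
    proof -
      have int: "integrable P (\<lambda>x. min (x\<^sup>2) (real k))" if "real_distribution P" for P
      proof -
        interpret real_distribution P by fact
        show ?thesis by (rule integrable_const_bound[of _ "real k"]) auto
      qed
      have "(\<lambda>n. \<integral>x. min (x\<^sup>2) (real k) \<partial>(\<mu> \<circ> r) n) \<longlonglongrightarrow> (\<integral>x. min (x\<^sup>2) (real k) \<partial>M)"
        by (rule weak_conv_imp_integral_bdd_continuous_conv[where B = "real k", OF _ M])
           (use \<mu>rd in \<open>auto intro!: continuous_intros\<close>)
      moreover have "(\<integral>x. min (x\<^sup>2) (real k) \<partial>(\<mu> \<circ> r) n) \<le> C" for n
      proof -
        have "ennreal (\<integral>x. min (x\<^sup>2) (real k) \<partial>\<mu> (r n)) = (\<integral>\<^sup>+x. ennreal (min (x\<^sup>2) (real k)) \<partial>\<mu> (r n))"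
          by (rule nn_integral_eq_integral[symmetric, OF int[OF \<mu>rd]]) simp
        also have "\<dots> \<le> (\<integral>\<^sup>+x. ennreal (x\<^sup>2) \<partial>\<mu> (r n))" by (intro nn_integral_mono ennreal_leI) simp
        also have "\<dots> \<le> ennreal C" by (rule sq)
        finally show ?thesis using C by simp
      qed
      ultimately have "(\<integral>x. min (x\<^sup>2) (real k) \<partial>M) \<le> C"
        by (intro LIMSEQ_le_const2) auto
      then have "ennreal (\<integral>x. min (x\<^sup>2) (real k) \<partial>M) \<le> ennreal C" by (rule ennreal_leI)
      then show ?thesis
        by (subst nn_integral_eq_integral[OF int[OF M(1)]]) auto
    qed
    have "(\<integral>\<^sup>+x. (SUP k. ennreal (min (x\<^sup>2) (real k))) \<partial>M) = (SUP k. \<integral>\<^sup>+x. ennreal (min (x\<^sup>2) (real k)) \<partial>M)"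
      by (rule nn_integral_monotone_convergence_SUP) (auto simp: incseq_def le_fun_def intro!: ennreal_leI)
    also have "\<dots> \<le> ennreal C" by (intro SUP_least bdd)
    also have "(\<lambda>x. SUP k. ennreal (min (x\<^sup>2) (real k))) = (\<lambda>x. ennreal (x\<^sup>2))"
    proof
      fix x :: real
      obtain k where "x\<^sup>2 \<le> real k" using real_arch_simple by blast
      then have "ennreal (x\<^sup>2) \<le> (SUP k. ennreal (min (x\<^sup>2) (real k)))"
        by (intro SUP_upper2[of k]) auto
      moreover have "(SUP k. ennreal (min (x\<^sup>2) (real k))) \<le> ennreal (x\<^sup>2)"
        by (intro SUP_least ennreal_leI) simp
      ultimately show "(SUP k. ennreal (min (x\<^sup>2) (real k))) = ennreal (x\<^sup>2)" by (rule antisym[rotated])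
    qed
    finally show ?thesis .
  qed
  ultimately show ?thesis
    using M(1) order_le_less_trans[of "\<integral>\<^sup>+x. ennreal (x\<^sup>2) \<partial>M" "ennreal C" \<infinity>]
    by (intro exI[of _ M]) (simp add: stationary_distribution_iff)
qed

lemma stationary_moments:
  assumes st: "stationary_distribution Q \<mu>" and fin: "(\<integral>\<^sup>+x. ennreal (x\<^sup>2) \<partial>\<mu>) < \<infinity>"
  shows "integrable \<mu> (\<lambda>x. x)" "(\<integral>x. x \<partial>\<mu>) = bar_mu1 \<alpha>\<^sub>0 \<beta>\<^sub>0 \<alpha>\<^sub>1 \<beta>\<^sub>1"
    "integrable \<mu> (\<lambda>x. x\<^sup>2)" "(\<integral>x. x\<^sup>2 \<partial>\<mu>) = bar_mu2 \<alpha>\<^sub>0 \<beta>\<^sub>0 \<alpha>\<^sub>1 \<beta>\<^sub>1 \<sigma>"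
proof -
  have rd: "real_distribution \<mu>" and eq: "\<mu> \<bind> Q = \<mu>" using st by (auto simp: stationary_distribution_iff)
  interpret real_distribution \<mu> by (rule rd)
  have Q: "Q \<in> \<mu> \<rightarrow>\<^sub>M subprob_algebra borel"
    using measurable_prob_algebraD[OF measurable_Q] by (simp cong: measurable_cong_sets)
  show int2: "integrable \<mu> (\<lambda>x. x\<^sup>2)"
    using fin by (intro integrableI_bounded) auto
  show int1: "integrable \<mu> (\<lambda>x. x)"
    by (rule square_integrable_imp_integrable[OF _ int2]) simp
  define m1 m2 where "m1 = (\<integral>x. x \<partial>\<mu>)" and "m2 = (\<integral>x. x\<^sup>2 \<partial>\<mu>)"
  have quad: "integrable \<mu> (\<lambda>x. (a * x + b)\<^sup>2)" "(\<integral>x. (a * x + b)\<^sup>2 \<partial>\<mu>) = a\<^sup>2 * m2 + 2 * a * b * m1 + b\<^sup>2" for a b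
  proof -
    have *: "(\<lambda>x. (a * x + b)\<^sup>2) = (\<lambda>x. a\<^sup>2 * x\<^sup>2 + 2 * a * b * x + b\<^sup>2)"
      by (auto simp: fun_eq_iff power2_eq_square algebra_simps)
    show "integrable \<mu> (\<lambda>x. (a * x + b)\<^sup>2)" unfolding * using int1 int2 by simp
    show "(\<integral>x. (a * x + b)\<^sup>2 \<partial>\<mu>) = a\<^sup>2 * m2 + 2 * a * b * m1 + b\<^sup>2"
      unfolding * using int1 int2 by (simp add: m1_def m2_def prob_space[simplified])
  qed
  \<comment> \<open>Stationarity is tested only on the nonnegative functions \<open>(x - c)\<^sup>2\<close>, so that no unbounded signed integrand
    has to be pushed through the kernel; \<open>c = 0\<close> and \<open>c = 1\<close> determine both moments.\<close>
  have key: "m2 - 2 * c * m1 + c\<^sup>2 = ((\<alpha>\<^sub>0\<^sup>2 * m2 + 2 * \<alpha>\<^sub>0 * (\<beta>\<^sub>0 - c) * m1 + (\<beta>\<^sub>0 - c)\<^sup>2)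
      + (\<alpha>\<^sub>1\<^sup>2 * m2 + 2 * \<alpha>\<^sub>1 * (\<beta>\<^sub>1 - c) * m1 + (\<beta>\<^sub>1 - c)\<^sup>2)) / 2 + \<sigma>\<^sup>2" for c
  proof -
    let ?g = "\<lambda>x. ((\<alpha>\<^sub>0 * x + (\<beta>\<^sub>0 - c))\<^sup>2 + (\<alpha>\<^sub>1 * x + (\<beta>\<^sub>1 - c))\<^sup>2) / 2 + \<sigma>\<^sup>2"
    have g: "integrable \<mu> ?g" by (intro Bochner_Integration.integrable_add integrable_divide quad) auto
    have "ennreal (\<integral>x. (1 * x + (- c))\<^sup>2 \<partial>\<mu>) = (\<integral>\<^sup>+x. ennreal ((x - c)\<^sup>2) \<partial>(\<mu> \<bind> Q))"
      unfolding eq by (subst nn_integral_eq_integral[symmetric, OF quad(1)]) auto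
    also have "\<dots> = (\<integral>\<^sup>+x. (\<integral>\<^sup>+y. ennreal ((y - c)\<^sup>2) \<partial>Q x) \<partial>\<mu>)"
      by (subst nn_integral_bind[OF _ Q]) auto
    also have "\<dots> = (\<integral>\<^sup>+x. ennreal (?g x) \<partial>\<mu>)"
      by (simp add: nn_integral_square_Q add_diff_eq)
    also have "\<dots> = ennreal (\<integral>x. ?g x \<partial>\<mu>)"
      by (rule nn_integral_eq_integral[OF g]) simp
    finally have "(\<integral>x. (1 * x + (- c))\<^sup>2 \<partial>\<mu>) = (\<integral>x. ?g x \<partial>\<mu>)"
      by (subst (asm) ennreal_inj) (auto intro!: integral_nonneg_AE)
    also have "(\<integral>x. ?g x \<partial>\<mu>) = ((\<integral>x. (\<alpha>\<^sub>0 * x + (\<beta>\<^sub>0 - c))\<^sup>2 \<partial>\<mu>) + (\<integral>x. (\<alpha>\<^sub>1 * x + (\<beta>\<^sub>1 - c))\<^sup>2 \<partial>\<mu>)) / 2 + \<sigma>\<^sup>2"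
      using quad(1)[of \<alpha>\<^sub>0 "\<beta>\<^sub>0 - c"] quad(1)[of \<alpha>\<^sub>1 "\<beta>\<^sub>1 - c"] by (simp add: prob_space[simplified])
    finally show ?thesis unfolding quad by simp
  qed
  \<comment> \<open>Subtracting the instances \<open>c = 0\<close> and \<open>c = 1\<close> cancels
    \<open>m2\<close> and the noise variance and leaves a linear equation for
    \<open>m1\<close>.\<close>
  have m: "2 * m1 * (1 - (\<alpha>\<^sub>0 + \<alpha>\<^sub>1) / 2) = \<beta>\<^sub>0 + \<beta>\<^sub>1"
    using key[of 0] key[of 1] by (simp add: power2_eq_square field_simps)
  have n1: "1 - (\<alpha>\<^sub>0 + \<alpha>\<^sub>1) / 2 \<noteq> 0" using a0 a1 by auto
  have m1: "m1 = bar_mu1 \<alpha>\<^sub>0 \<beta>\<^sub>0 \<alpha>\<^sub>1 \<beta>\<^sub>1"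
  proof -
    have "m1 = (m1 * (1 - (\<alpha>\<^sub>0 + \<alpha>\<^sub>1) / 2)) / (1 - (\<alpha>\<^sub>0 + \<alpha>\<^sub>1) / 2)"
      using n1 by simp
    also have "m1 * (1 - (\<alpha>\<^sub>0 + \<alpha>\<^sub>1) / 2) = (\<beta>\<^sub>0 + \<beta>\<^sub>1) / 2" using m by simp
    finally show ?thesis unfolding bar_mu1_def .
  qed
  then show "(\<integral>x. x \<partial>\<mu>) = bar_mu1 \<alpha>\<^sub>0 \<beta>\<^sub>0 \<alpha>\<^sub>1 \<beta>\<^sub>1" by (simp add: m1_def)
  have "\<alpha>\<^sub>0\<^sup>2 < 1" "\<alpha>\<^sub>1\<^sup>2 < 1" using a0 a1 by (auto simp: abs_square_less_1)
  then have n2: "1 - (\<alpha>\<^sub>0\<^sup>2 + \<alpha>\<^sub>1\<^sup>2) / 2 \<noteq> 0" by auto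
  have "m2 * (1 - (\<alpha>\<^sub>0\<^sup>2 + \<alpha>\<^sub>1\<^sup>2) / 2) = 2 * ((\<alpha>\<^sub>0 * \<beta>\<^sub>0 + \<alpha>\<^sub>1 * \<beta>\<^sub>1) / 2) * m1 + (\<beta>\<^sub>0\<^sup>2 + \<beta>\<^sub>1\<^sup>2) / 2 + \<sigma>\<^sup>2"
    using key[of 0] by (simp add: field_simps)
  then have "m2 = bar_mu2 \<alpha>\<^sub>0 \<beta>\<^sub>0 \<alpha>\<^sub>1 \<beta>\<^sub>1 \<sigma>"
  proof -
    have "m2 = (m2 * (1 - (\<alpha>\<^sub>0\<^sup>2 + \<alpha>\<^sub>1\<^sup>2) / 2)) / (1 - (\<alpha>\<^sub>0\<^sup>2 + \<alpha>\<^sub>1\<^sup>2) / 2)"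
      using n2 by simp
    also have "m2 * (1 - (\<alpha>\<^sub>0\<^sup>2 + \<alpha>\<^sub>1\<^sup>2) / 2) = 2 * ((\<alpha>\<^sub>0 * \<beta>\<^sub>0 + \<alpha>\<^sub>1 * \<beta>\<^sub>1) / 2) * m1 + (\<beta>\<^sub>0\<^sup>2 + \<beta>\<^sub>1\<^sup>2) / 2 + \<sigma>\<^sup>2"
      by fact
    finally show ?thesis unfolding bar_mu2_def m1 bar_mu1_def by simp
  qed
  then show "(\<integral>x. x\<^sup>2 \<partial>\<mu>) = bar_mu2 \<alpha>\<^sub>0 \<beta>\<^sub>0 \<alpha>\<^sub>1 \<beta>\<^sub>1 \<sigma>" by (simp add: m2_def)
qed

end

section \<open>Levy's continuity theorem in Euclidean space\<close>

lemma lborel_integral_prod_Basis: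
  fixes f :: "'b::euclidean_space \<Rightarrow> real \<Rightarrow> 'c::{real_normed_field,banach,second_countable_topology}"
  assumes f: "\<And>b. b \<in> Basis \<Longrightarrow> integrable lborel (f b)"
  shows "has_bochner_integral lborel (\<lambda>z::'b. \<Prod>b\<in>Basis. f b (z \<bullet> b)) (\<Prod>b\<in>Basis. (\<integral>x. f b x \<partial>lborel))"
proof -
  interpret product_sigma_finite "\<lambda>_::'b. lborel :: real measure"
    by (simp add: product_sigma_finite_def sigma_finite_lborel)
  have [measurable]: "\<And>b. b \<in> Basis \<Longrightarrow> f b \<in> borel_measurable borel"
    using borel_measurable_integrable[OF f] by simp
  have comp: "(\<Prod>b\<in>Basis. f b ((\<Sum>c\<in>Basis. x c *\<^sub>R c) \<bullet> b)) = (\<Prod>b\<in>Basis. f b (x b))" for x :: "'b \<Rightarrow> real"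
    by (intro prod.cong refl) simp
  have meas: "(\<lambda>z::'b. \<Prod>b\<in>Basis. f b (z \<bullet> b)) \<in> borel_measurable borel" by measurable
  have meas2: "(\<lambda>x::'b \<Rightarrow> real. \<Sum>c\<in>Basis. x c *\<^sub>R c) \<in> (\<Pi>\<^sub>M b\<in>Basis. lborel) \<rightarrow>\<^sub>M borel" by measurable
  show ?thesis
    unfolding has_bochner_integral_iff
  proof
    show "integrable lborel (\<lambda>z::'b. \<Prod>b\<in>Basis. f b (z \<bullet> b))"
      by (subst lborel_eq, subst integrable_distr_eq[OF meas2 meas])
         (use product_integrable_prod[OF finite_Basis f] in \<open>simp add: comp\<close>)
    show "integral\<^sup>L lborel (\<lambda>z::'b. \<Prod>b\<in>Basis. f b (z \<bullet> b)) = (\<Prod>b\<in>Basis. (\<integral>x. f b x \<partial>lborel))"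
      by (subst lborel_eq, subst integral_distr[OF meas2 meas])
         (use product_integral_prod[OF finite_Basis f] in \<open>simp add: comp\<close>)
  qed
qed

lemma sum_inner_Basis_square: "(\<Sum>b\<in>Basis. (z \<bullet> b)\<^sup>2) = (norm z)\<^sup>2" for z :: "'b::euclidean_space"
  unfolding power2_norm_eq_inner by (subst (2) euclidean_inner) (simp add: power2_eq_square)

text \<open>The product form lets integrals factor over coordinates; \<open>gauss_density_eq\<close>
  supplies the radial form needed for linear changes of variables.\<close>

definition gauss_density :: "'b::euclidean_space \<Rightarrow> real" where
  "gauss_density z = (\<Prod>b\<in>Basis. std_normal_density (z \<bullet> b))"

definition std_gaussian :: "'b::euclidean_space measure" where
  "std_gaussian = density lborel (\<lambda>z. ennreal (gauss_density z))"

lemma sets_std_gaussian [simp, measurable_cong]: "sets std_gaussian = sets borel"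
  by (simp add: std_gaussian_def)

lemma space_std_gaussian [simp]: "space std_gaussian = UNIV"
  by (simp add: std_gaussian_def)

lemma gauss_density_measurable [measurable]: "gauss_density \<in> borel_measurable borel"
  unfolding gauss_density_def[abs_def] by measurable

lemma gauss_density_nonneg [simp]: "0 \<le> gauss_density z"
  unfolding gauss_density_def by (intro prod_nonneg) simp

lemma gauss_density_eq:
  "gauss_density z = exp (- (norm z)\<^sup>2 / 2) / sqrt ((2 * pi) ^ DIM('b))" for z :: "'b::euclidean_space"
proof -
  have "gauss_density z = (\<Prod>b\<in>Basis. exp (- (z \<bullet> b)\<^sup>2 / 2)) / (\<Prod>b\<in>(Basis::'b set). sqrt (2 * pi))"
    unfolding gauss_density_def std_normal_density_def by (simp add: prod_dividef)
  also have "(\<Prod>b\<in>Basis. exp (- (z \<bullet> b)\<^sup>2 / 2)) = exp (- (\<Sum>b\<in>Basis. (z \<bullet> b)\<^sup>2) / 2)"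
    by (simp add: exp_sum[symmetric] sum_negf sum_divide_distrib)
  also have "(\<Sum>b\<in>Basis. (z \<bullet> b)\<^sup>2) = (norm z)\<^sup>2" by (rule sum_inner_Basis_square)
  also have "(\<Prod>b\<in>(Basis::'b set). sqrt (2 * pi)) = sqrt ((2 * pi) ^ DIM('b))"
    unfolding prod_constant by (rule real_sqrt_power[symmetric])
  finally show ?thesis .
qed

lemma gauss_density_integral: "has_bochner_integral lborel (gauss_density :: 'b::euclidean_space \<Rightarrow> real) 1"
  unfolding gauss_density_def[abs_def]
  using lborel_integral_prod_Basis[of "\<lambda>_::'b. std_normal_density"] by simp

lemma prob_space_std_gaussian: "prob_space (std_gaussian :: 'b::euclidean_space measure)"
proof
  have "(\<integral>\<^sup>+z. ennreal (gauss_density z) \<partial>(lborel::'b measure)) = 1"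
    using gauss_density_integral by (subst nn_integral_eq_integral) (auto simp: has_bochner_integral_iff)
  then show "emeasure (std_gaussian::'b measure) (space std_gaussian) = 1"
    by (simp add: std_gaussian_def emeasure_density)
qed

lemma gauss_density_fourier:
  fixes w :: "'b::euclidean_space"
  shows "has_bochner_integral lborel (\<lambda>z. of_real (gauss_density z) * iexp (w \<bullet> z))
     (of_real (exp (- (norm w)\<^sup>2 / 2)))"
proof -
  have std: "has_bochner_integral lborel (\<lambda>x. of_real (std_normal_density x) * iexp (t * x))
      (of_real (exp (- t\<^sup>2 / 2)) :: complex)" for t :: real
    using has_bochner_integral_normal_iexp[of 1 0 t] by (simp add: scaleR_conv_of_real)
  have "has_bochner_integral lborel
     (\<lambda>z. \<Prod>b\<in>Basis. of_real (std_normal_density (z \<bullet> b)) * iexp ((w \<bullet> b) * (z \<bullet> b)))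
     (\<Prod>b\<in>Basis. (of_real (exp (- (w \<bullet> b)\<^sup>2 / 2)) :: complex))"
    using lborel_integral_prod_Basis[of "\<lambda>b x. of_real (std_normal_density x) * iexp ((w \<bullet> b) * x)"] std
    unfolding has_bochner_integral_iff by fastforce
  moreover have "(\<Prod>b\<in>Basis. (of_real (exp (- (w \<bullet> b)\<^sup>2 / 2)) :: complex)) = of_real (exp (- (norm w)\<^sup>2 / 2))"
    unfolding sum_inner_Basis_square[symmetric]
    by (simp add: of_real_prod[symmetric] exp_sum[symmetric] sum_negf sum_divide_distrib[symmetric]
        del: of_real_prod)
  moreover have "(\<Prod>b\<in>Basis. of_real (std_normal_density (z \<bullet> b)) * iexp ((w \<bullet> b) * (z \<bullet> b))) =
      of_real (gauss_density z) * iexp (w \<bullet> z)" for z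
  proof -
    have "(\<Prod>b\<in>Basis. iexp ((w \<bullet> b) * (z \<bullet> b))) = iexp (\<Sum>b\<in>Basis. (w \<bullet> b) * (z \<bullet> b))"
      by (simp add: exp_sum sum_distrib_left)
    then show ?thesis
      by (simp add: prod.distrib gauss_density_def euclidean_inner[of w z])
  qed
  ultimately show ?thesis by simp
qed

text \<open>The convolution of \<open>f\<close> with a centred Gaussian of standard deviation
  \<delta>, written as an expectation over the unscaled Gaussian.\<close>

definition gauss_smooth :: "('b::euclidean_space \<Rightarrow> real) \<Rightarrow> real \<Rightarrow> 'b \<Rightarrow> real" where
  "gauss_smooth f \<delta> x = (\<integral>z. f (x + \<delta> *\<^sub>R z) \<partial>std_gaussian)"

definition fourier :: "'b::euclidean_space measure \<Rightarrow> 'b \<Rightarrow> complex" where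
  "fourier P u = (\<integral>x. iexp (u \<bullet> x) \<partial>P)"

lemma norm_iexp [simp]: "norm (iexp t) = 1" by simp

lemma cmod_fourier_le_1:
  assumes "prob_space P" "sets P = sets borel"
  shows "cmod (fourier P u) \<le> 1"
proof -
  interpret prob_space P by fact
  have "cmod (fourier P u) \<le> (\<integral>x. cmod (iexp (u \<bullet> x)) \<partial>P)"
    unfolding fourier_def by (rule integral_norm_bound)
  then show ?thesis by (simp add: prob_space)
qed

text \<open>The Gaussian density is its own Fourier transform up to a constant. Writing the smoothing kernel as such
  a transform and using Fubini, the law \<open>P\<close> enters only through its characteristic function.\<close>

lemma gauss_smooth_fourier:
  fixes f :: "'b::euclidean_space \<Rightarrow> real"
  assumes f: "integrable lborel f" and \<delta>: "\<delta> > 0"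
    and P: "prob_space P" "sets P = sets borel"
  shows "(\<integral>x. gauss_smooth f \<delta> x \<partial>P) * (sqrt ((2 * pi) ^ DIM('b)) * \<delta> ^ DIM('b)) =
     (\<integral>p. of_real (f (fst p)) * of_real (gauss_density (snd p)) * iexp ((1 / \<delta>) * (fst p \<bullet> snd p))
         * fourier P (- (1 / \<delta>) *\<^sub>R snd p) \<partial>(lborel \<Otimes>\<^sub>M lborel))"
proof -
  interpret P: prob_space P by (rule P)
  note P(2)[measurable_cong]
  have [measurable]: "f \<in> borel_measurable borel" using borel_measurable_integrable[OF f] by simp
  let ?c = "sqrt ((2 * pi) ^ DIM('b))"
  have c: "?c > 0" by simp
  define G where "G p = complex_of_real (f (fst p)) * of_real (gauss_density (snd p)) * iexp ((1 / \<delta>) * (fst p \<bullet> snd p))"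
    for p :: "'b \<times> 'b"
  have Gm [measurable]: "G \<in> borel_measurable (borel \<Otimes>\<^sub>M borel)"
    unfolding G_def[abs_def] by measurable
  have normG: "norm (G p) = norm (f (fst p)) * gauss_density (snd p)" for p
    by (simp add: G_def norm_mult)
  have Gint: "integrable (lborel \<Otimes>\<^sub>M lborel) G"
  proof (rule lborel_pair.Fubini_integrable)
    have "integrable lborel (\<lambda>x. norm (f x) * (\<integral>y. gauss_density (y::'b) \<partial>lborel))"
      using f by simp
    then show "integrable lborel (\<lambda>x. \<integral>y. norm (G (x, y)) \<partial>lborel)"
      unfolding normG by simp
    have "integrable lborel (\<lambda>y. G (x, y))" for x
    proof (rule Bochner_Integration.integrable_bound)
      show "integrable lborel (\<lambda>y. norm (f x) * gauss_density (y::'b))"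
        using gauss_density_integral[where 'b = 'b] by (simp add: has_bochner_integral_iff)
      show "AE y in lborel. norm (G (x, y)) \<le> norm (norm (f x) * gauss_density y)"
        by (simp add: normG)
    qed measurable
    then show "AE x in lborel. integrable lborel (\<lambda>y. G (x, y))" by simp
  qed simp
  \<comment> \<open>For a single point \<open>x\<close>: the substitution
    \<open>y = x + \<delta> z\<close> moves the Gaussian weight to
    \<open>(y - x) / \<delta>\<close>, with Jacobian \<open>\<delta> ^ DIM('b)\<close>, and the
    weight is then replaced by its own Fourier integral. \<open>?c\<close> is the constant of this
    self-duality.\<close>
  have pt: "complex_of_real (gauss_smooth f \<delta> x * (?c * \<delta> ^ DIM('b))) =
      (\<integral>p. G p * iexp (- (1 / \<delta>) * (snd p \<bullet> x)) \<partial>(lborel \<Otimes>\<^sub>M lborel))" for x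
  proof -
    let ?g = "\<lambda>y. f y * gauss_density ((1 / \<delta>) *\<^sub>R (y - x))"
    have "(\<integral>y. ?g y \<partial>lborel) = (\<integral>y. ?g y \<partial>(density (distr lborel borel (\<lambda>z. x + \<delta> *\<^sub>R z)) (\<lambda>_. ennreal (\<bar>\<delta>\<bar> ^ DIM('b)))))"
      using \<delta> lborel_affine[of \<delta> x] by simp
    also have "\<dots> = (\<integral>z. \<delta> ^ DIM('b) * (f (x + \<delta> *\<^sub>R z) * gauss_density z) \<partial>lborel)"
      using \<delta> by (subst integral_density) (auto simp: integral_distr)
    also have "\<dots> = \<delta> ^ DIM('b) * gauss_smooth f \<delta> x"
      unfolding gauss_smooth_def std_gaussian_def by (subst integral_density) (auto simp: mult.commute)
    finally have 1: "gauss_smooth f \<delta> x * \<delta> ^ DIM('b) = (\<integral>y. ?g y \<partial>lborel)" by simp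
    have 2: "of_real (?c * gauss_density w) = (\<integral>z. of_real (gauss_density z) * iexp (w \<bullet> z) \<partial>lborel)" for w :: 'b
      using gauss_density_fourier[of w] c by (simp add: has_bochner_integral_iff gauss_density_eq[of w])
    have "of_real (gauss_smooth f \<delta> x * (?c * \<delta> ^ DIM('b))) = (\<integral>y. complex_of_real (?c * ?g y) \<partial>lborel)"
    proof -
      have "gauss_smooth f \<delta> x * (?c * \<delta> ^ DIM('b)) = (\<integral>y. ?c * ?g y \<partial>lborel)" using 1 by simp
      then show ?thesis by (simp only: integral_complex_of_real)
    qed
    also have "\<dots> = (\<integral>y. \<integral>z. G (y, z) * iexp (- (1 / \<delta>) * (z \<bullet> x)) \<partial>lborel \<partial>lborel)"
    proof (rule Bochner_Integration.integral_cong[OF refl])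
      fix y
      have "complex_of_real (?c * ?g y) = of_real (f y) * (\<integral>z. of_real (gauss_density z) * iexp (((1 / \<delta>) *\<^sub>R (y - x)) \<bullet> z) \<partial>lborel)"
        unfolding 2[symmetric] by simp
      also have "\<dots> = (\<integral>z. of_real (f y) * (of_real (gauss_density z) * iexp (((1 / \<delta>) *\<^sub>R (y - x)) \<bullet> z)) \<partial>lborel)"
        using gauss_density_fourier by (intro integral_mult_right_zero[symmetric])
      also have "\<dots> = (\<integral>z. G (y, z) * iexp (- (1 / \<delta>) * (z \<bullet> x)) \<partial>lborel)"
        by (rule Bochner_Integration.integral_cong[OF refl])
           (simp add: G_def exp_add[symmetric] inner_diff_left inner_commute[of x] algebra_simps diff_divide_distrib)
      finally show "complex_of_real (?c * ?g y) = (\<integral>z. G (y, z) * iexp (- (1 / \<delta>) * (z \<bullet> x)) \<partial>lborel)" .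
    qed
    also have "\<dots> = (\<integral>p. G p * iexp (- (1 / \<delta>) * (snd p \<bullet> x)) \<partial>(lborel \<Otimes>\<^sub>M lborel))"
    proof -
      have "integrable (lborel \<Otimes>\<^sub>M lborel) (\<lambda>p. G p * iexp (- (1 / \<delta>) * (snd p \<bullet> x)))"
        by (rule Bochner_Integration.integrable_bound[OF Gint]) (auto simp: norm_mult)
      from lborel_pair.integral_fst'[OF this] show ?thesis by simp
    qed
    finally show ?thesis .
  qed
  interpret PL: pair_sigma_finite P "lborel \<Otimes>\<^sub>M lborel :: ('b \<times> 'b) measure"
    by (simp add: pair_sigma_finite_def P.sigma_finite_measure_axioms lborel_prod sigma_finite_lborel)
  \<comment> \<open>The modulus of the integrand does not depend on \<open>x\<close>, so its
    integral over the pair variable is a constant, which is integrable for the probability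
    \<open>P\<close>.\<close>
  have int3: "integrable (P \<Otimes>\<^sub>M (lborel \<Otimes>\<^sub>M lborel)) (\<lambda>(x, p). G p * iexp (- (1 / \<delta>) * (snd p \<bullet> x)))"
  proof (rule PL.Fubini_integrable)
    show "integrable P (\<lambda>x. \<integral>p. norm ((\<lambda>(x, p). G p * iexp (- (1 / \<delta>) * (snd p \<bullet> x))) (x, p)) \<partial>(lborel \<Otimes>\<^sub>M lborel))"
      by (simp add: norm_mult)
    have "integrable (lborel \<Otimes>\<^sub>M lborel) (\<lambda>p. G p * iexp (- (1 / \<delta>) * (snd p \<bullet> x)))" for x
      by (rule Bochner_Integration.integrable_bound[OF Gint]) (auto simp: norm_mult)
    then show "AE x in P. integrable (lborel \<Otimes>\<^sub>M lborel) (\<lambda>p. (\<lambda>(x, p). G p * iexp (- (1 / \<delta>) * (snd p \<bullet> x))) (x, p))"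
      by simp
  qed measurable
  have "complex_of_real ((\<integral>x. gauss_smooth f \<delta> x \<partial>P) * (?c * \<delta> ^ DIM('b)))
      = (\<integral>x. complex_of_real (gauss_smooth f \<delta> x * (?c * \<delta> ^ DIM('b))) \<partial>P)"
    by (simp only: integral_mult_left_zero[symmetric] integral_complex_of_real)
  also have "\<dots> = (\<integral>x. (\<integral>p. G p * iexp (- (1 / \<delta>) * (snd p \<bullet> x)) \<partial>(lborel \<Otimes>\<^sub>M lborel)) \<partial>P)"
    unfolding pt ..
  also have "\<dots> = (\<integral>p. (\<integral>x. G p * iexp (- (1 / \<delta>) * (snd p \<bullet> x)) \<partial>P) \<partial>(lborel \<Otimes>\<^sub>M lborel))"
    by (rule PL.Fubini_integral[symmetric, OF int3])
  also have "\<dots> = (\<integral>p. G p * fourier P (- (1 / \<delta>) *\<^sub>R snd p) \<partial>(lborel \<Otimes>\<^sub>M lborel))"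
    unfolding fourier_def by simp
  finally show ?thesis unfolding G_def by simp
qed

text \<open>In \<open>gauss_smooth_fourier\<close> the law enters only through a characteristic
  function of modulus at most 1, so pointwise convergence suffices by dominated convergence with
  majorant \<open>\<bar>f\<bar>\<close> times the Gaussian density.\<close>

lemma gauss_smooth_tendsto:
  fixes f :: "'b::euclidean_space \<Rightarrow> real"
  assumes f: "integrable lborel f" and \<delta>: "\<delta> > 0"
    and P: "\<And>n::nat. prob_space (P n)" "\<And>n. sets (P n) = sets borel"
    and L: "prob_space L" "sets L = sets borel"
    and conv: "\<And>u. (\<lambda>n. fourier (P n) u) \<longlonglongrightarrow> fourier L u"
  shows "(\<lambda>n. \<integral>x. gauss_smooth f \<delta> x \<partial>P n) \<longlonglongrightarrow> (\<integral>x. gauss_smooth f \<delta> x \<partial>L)"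
proof -
  have [measurable]: "f \<in> borel_measurable borel" using borel_measurable_integrable[OF f] by simp
  define C where "C = sqrt ((2 * pi) ^ DIM('b)) * \<delta> ^ DIM('b)"
  have C: "C > 0" using \<delta> by (simp add: C_def)
  let ?G = "\<lambda>p. complex_of_real (f (fst p)) * of_real (gauss_density (snd p)) * iexp ((1 / \<delta>) * (fst p \<bullet> snd p))"
  let ?w = "\<lambda>p::'b\<times>'b. norm (f (fst p)) * gauss_density (snd p)"
  have fm: "fourier Q \<in> borel_measurable borel" if "prob_space Q" "sets Q = sets borel" for Q :: "'b measure"
  proof -
    interpret Q: prob_space Q by fact
    note that(2)[measurable_cong]
    show ?thesis unfolding fourier_def[abs_def] by measurable
  qed
  note [measurable] = fm[OF P] fm[OF L]
  have wint: "integrable (lborel \<Otimes>\<^sub>M lborel) ?w"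
  proof (rule lborel_pair.Fubini_integrable)
    show "integrable lborel (\<lambda>x. \<integral>y. norm (?w (x, y)) \<partial>lborel)"
      using f by (simp add: abs_mult)
    show "AE x in lborel. integrable lborel (\<lambda>y. ?w (x, y))"
      using gauss_density_integral[where 'b = 'b] by (simp add: has_bochner_integral_iff)
  qed measurable
  have "(\<lambda>n. \<integral>p. ?G p * fourier (P n) (- (1 / \<delta>) *\<^sub>R snd p) \<partial>(lborel \<Otimes>\<^sub>M lborel))
     \<longlonglongrightarrow> (\<integral>p. ?G p * fourier L (- (1 / \<delta>) *\<^sub>R snd p) \<partial>(lborel \<Otimes>\<^sub>M lborel))"
  proof (rule integral_dominated_convergence[where w = ?w])
    show "AE p in lborel \<Otimes>\<^sub>M lborel. (\<lambda>n. ?G p * fourier (P n) (- (1 / \<delta>) *\<^sub>R snd p))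
        \<longlonglongrightarrow> ?G p * fourier L (- (1 / \<delta>) *\<^sub>R snd p)"
      by (intro always_eventually allI tendsto_mult tendsto_const conv)
    show "AE p in lborel \<Otimes>\<^sub>M lborel. norm (?G p * fourier (P n) (- (1 / \<delta>) *\<^sub>R snd p)) \<le> ?w p" for n
      using cmod_fourier_le_1[OF P] by (intro always_eventually allI) (auto simp: norm_mult intro!: mult_left_le)
  qed (use wint in measurable)
  then have "(\<lambda>n. complex_of_real ((\<integral>x. gauss_smooth f \<delta> x \<partial>P n) * C)) \<longlonglongrightarrow> of_real ((\<integral>x. gauss_smooth f \<delta> x \<partial>L) * C)"
    unfolding gauss_smooth_fourier[OF f \<delta> P, symmetric] gauss_smooth_fourier[OF f \<delta> L, symmetric] C_def .
  then have "(\<lambda>n. (\<integral>x. gauss_smooth f \<delta> x \<partial>P n) * C) \<longlonglongrightarrow> (\<integral>x. gauss_smooth f \<delta> x \<partial>L) * C"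
    by (simp only: tendsto_of_real_iff)
  then have "(\<lambda>n. (\<integral>x. gauss_smooth f \<delta> x \<partial>P n) * C / C) \<longlonglongrightarrow> (\<integral>x. gauss_smooth f \<delta> x \<partial>L) * C / C"
    by (intro tendsto_divide tendsto_const) (use C in auto)
  then show ?thesis using C by simp
qed

section \<open>From smoothed test functions to bounded continuous ones\<close>

lemma prob_space_norm_tail:
  fixes P :: "'b::euclidean_space measure"
  assumes P: "prob_space P" "sets P = sets borel" and "e > 0"
  shows "\<exists>R>0. measure P {x. norm x > R} < e"
proof -
  interpret prob_space P by (rule P)
  note P(2)[measurable_cong]
  have "(\<lambda>n. prob {x. norm x > real n}) \<longlonglongrightarrow> prob (\<Inter>n. {x. norm x > real n})"
    by (rule finite_Lim_measure_decseq) (auto simp: decseq_def)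
  also have "(\<Inter>n. {x::'b. norm x > real n}) = {}"
  proof -
    have "\<exists>n. \<not> norm x > real n" for x :: 'b
      using reals_Archimedean2[of "norm x"] order_less_asym by blast
    then show ?thesis by blast
  qed
  finally have "(\<lambda>n. prob {x. norm x > real n}) \<longlonglongrightarrow> 0" by simp
  then have "\<forall>\<^sub>F n in sequentially. prob {x. norm x > real n} < e"
    using \<open>e > 0\<close> by (rule order_tendstoD(2))
  then obtain N where N: "\<And>n. n \<ge> N \<Longrightarrow> prob {x. norm x > real n} < e"
    by (auto simp: eventually_sequentially)
  show ?thesis by (rule exI[of _ "real (Suc N)"]) (use N[of "Suc N"] in simp)
qed

lemma gauss_smooth_uniform:
  fixes f :: "'b::euclidean_space \<Rightarrow> real"
  assumes uc: "uniformly_continuous_on UNIV f" and B: "\<And>x. \<bar>f x\<bar> \<le> B" and e: "e > 0"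
  shows "\<exists>\<delta>>0. \<forall>x. \<bar>gauss_smooth f \<delta> x - f x\<bar> \<le> e"
proof -
  interpret prob_space "std_gaussian :: 'b measure" by (rule prob_space_std_gaussian)
  have cf: "continuous_on UNIV f" using uc by (rule uniformly_continuous_imp_continuous)
  have [measurable]: "f \<in> borel_measurable borel" by (rule borel_measurable_continuous_onI) (rule cf)
  have B0: "0 \<le> B" using B[of 0] by linarith
  \<comment> \<open>On the Gaussian tail the increment of \<open>f\<close> is at most
    \<open>2 * B\<close>, so this tail contributes at most \<open>e / 2\<close>; the summand 1
    avoids a division by zero when \<open>B = 0\<close>.\<close>
  obtain R where R: "R > 0" "prob {z. norm z > R} < e / (2 * (2 * B + 1))"
    using prob_space_norm_tail[OF prob_space_std_gaussian sets_std_gaussian, of "e / (2 * (2 * B + 1))"] e B0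
    by auto
  obtain \<eta> where \<eta>: "\<eta> > 0" "\<And>x y. dist y x < \<eta> \<Longrightarrow> dist (f y) (f x) < e / 2"
    using uc e unfolding uniformly_continuous_on_def by (meson UNIV_I half_gt_zero)
  \<comment> \<open>For \<open>norm z \<le> R\<close> the displacement is at most
    \<open>\<delta> R = \<eta> / 2\<close>, inside the modulus of continuity.\<close>
  define \<delta> where "\<delta> = \<eta> / (2 * R)"
  have \<delta>: "\<delta> > 0" using \<eta> R by (simp add: \<delta>_def)
  have "\<bar>gauss_smooth f \<delta> x - f x\<bar> \<le> e" for x
  proof -
    have int: "integrable std_gaussian (\<lambda>z. f (x + \<delta> *\<^sub>R z))"
      by (rule integrable_const_bound[of _ B]) (use B in auto)
    have "gauss_smooth f \<delta> x - f x = (\<integral>z. f (x + \<delta> *\<^sub>R z) - f x \<partial>std_gaussian)"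
      unfolding gauss_smooth_def using int prob_space by simp
    also have "\<bar>\<dots>\<bar> \<le> (\<integral>z. \<bar>f (x + \<delta> *\<^sub>R z) - f x\<bar> \<partial>std_gaussian)"
      by (rule integral_abs_bound)
    also have "\<dots> \<le> (\<integral>z. e / 2 + 2 * B * indicator {z::'b. norm z > R} z \<partial>std_gaussian)"
    proof (rule Bochner_Integration.integral_mono)
      fix z :: 'b
      show "\<bar>f (x + \<delta> *\<^sub>R z) - f x\<bar> \<le> e / 2 + 2 * B * indicator {z. norm z > R} z"
      proof (cases "norm z > R")
        case True
        have "\<bar>f (x + \<delta> *\<^sub>R z) - f x\<bar> \<le> 2 * B" using B[of x] B[of "x + \<delta> *\<^sub>R z"] by linarith
        with True e show ?thesis by simp
      next
        case False
        have "\<delta> * norm z \<le> \<delta> * R" using False \<delta> by simp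
        also have "\<dots> < \<eta>" using R \<eta> by (simp add: \<delta>_def)
        finally have "dist (f (x + \<delta> *\<^sub>R z)) (f x) < e / 2"
          using \<delta> by (intro \<eta>(2)) (simp add: dist_norm)
        with False show ?thesis by (simp add: dist_real_def)
      qed
      show "integrable std_gaussian (\<lambda>z. e / 2 + 2 * B * indicator {z::'b. norm z > R} z)"
        by (rule integrable_const_bound[of _ "e / 2 + 2 * B"]) (use e B0 in \<open>auto simp: indicator_def\<close>)
    qed (use int in auto)
    also have "\<dots> = e / 2 + 2 * B * prob {z. norm z > R}"
    proof -
      have "integrable std_gaussian (indicator {z::'b. norm z > R} :: _ \<Rightarrow> real)"
        by (rule integrable_const_bound[of _ 1]) (auto simp: indicator_def)
      then show ?thesis using prob_space by simp
    qed
    also have "\<dots> \<le> e / 2 + (2 * B + 1) * (e / (2 * (2 * B + 1)))"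
      using R B0 by (intro add_left_mono mult_mono) auto
    also have "\<dots> = e" using B0 by (simp add: field_simps)
    finally show ?thesis .
  qed
  with \<delta> show ?thesis by blast
qed

lemma compact_support_uniformly_continuous:
  fixes f :: "'b::euclidean_space \<Rightarrow> real"
  assumes cf: "continuous_on UNIV f" and supp: "\<And>x. norm x > R \<Longrightarrow> f x = 0"
  shows "uniformly_continuous_on UNIV f"
proof -
  have "uniformly_continuous_on (cball 0 (R + 1)) f"
    by (rule compact_uniformly_continuous) (use cf in \<open>auto intro: continuous_on_subset\<close>)
  then have uc: "\<exists>d>0. \<forall>x\<in>cball (0::'b) (R + 1). \<forall>y\<in>cball 0 (R + 1). dist y x < d \<longrightarrow> dist (f y) (f x) < e"
    if "e > 0" for e using that unfolding uniformly_continuous_on_def by blast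
  show ?thesis
    unfolding uniformly_continuous_on_def
  proof (intro allI impI)
    fix e :: real assume "e > 0"
    then obtain d where d: "d > 0" "\<And>x y :: 'b. x \<in> cball 0 (R + 1) \<Longrightarrow> y \<in> cball 0 (R + 1) \<Longrightarrow> dist y x < d \<Longrightarrow> dist (f y) (f x) < e"
      using uc by metis
    show "\<exists>d>0. \<forall>x\<in>UNIV. \<forall>y\<in>UNIV. dist y x < d \<longrightarrow> dist (f y) (f x) < e"
    \<comment> \<open>Points at distance below 1 either both lie in the ball of radius
      \<open>R + 1\<close>, where compactness gives \<open>d\<close>, or both lie outside the ball
      of radius \<open>R\<close>, where \<open>f\<close> vanishes.\<close>
    proof (intro exI[of _ "min d 1"] conjI ballI impI)
      fix x y :: 'b assume xy: "dist y x < min d 1"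
      show "dist (f y) (f x) < e"
      proof (cases "norm x \<le> R + 1 \<and> norm y \<le> R + 1")
        case True then show ?thesis using d(2)[of x y] xy by simp
      next
        case False
        have "norm x > R" "norm y > R"
          using False xy norm_triangle_ineq2[of x y] norm_triangle_ineq2[of y x]
          by (auto simp: dist_norm norm_minus_commute)
        then show ?thesis using supp \<open>e > 0\<close> by simp
      qed
    qed (use d in auto)
  qed
qed

text \<open>Compact support is used twice: it makes \<open>f\<close> Lebesgue integrable, as the
  Fourier formula requires, and uniformly continuous, so that smoothing changes its integral by at
  most \<open>e / 4\<close> under every probability law at once.\<close>

lemma levy_continuity_compact_support:
  fixes f :: "'b::euclidean_space \<Rightarrow> real"
  assumes P: "\<And>n::nat. prob_space (P n)" "\<And>n. sets (P n) = sets borel"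
    and L: "prob_space L" "sets L = sets borel"
    and conv: "\<And>u. (\<lambda>n. fourier (P n) u) \<longlonglongrightarrow> fourier L u"
    and cf: "continuous_on UNIV f" and supp: "\<And>x. norm x > R \<Longrightarrow> f x = 0" and B: "\<And>x. \<bar>f x\<bar> \<le> B"
  shows "(\<lambda>n. \<integral>x. f x \<partial>P n) \<longlonglongrightarrow> (\<integral>x. f x \<partial>L)"
proof (rule LIMSEQ_I)
  fix e :: real assume e: "e > 0"
  have fm [measurable]: "f \<in> borel_measurable borel" by (rule borel_measurable_continuous_onI) (rule cf)
  have uc: "uniformly_continuous_on UNIV f" using cf supp by (rule compact_support_uniformly_continuous)
  obtain \<delta> where \<delta>: "\<delta> > 0" "\<And>x. \<bar>gauss_smooth f \<delta> x - f x\<bar> \<le> e / 4"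
    using gauss_smooth_uniform[OF uc B, of "e / 4"] e by auto
  have fint: "integrable lborel f"
  proof -
    have "integrable lborel (\<lambda>x. indicator (cball 0 R) x *\<^sub>R f x)"
      by (rule borel_integrable_compact) (use cf in \<open>auto intro: continuous_on_subset\<close>)
    also have "(\<lambda>x. indicator (cball 0 R) x *\<^sub>R f x) = f"
      using supp by (auto simp: fun_eq_iff indicator_def not_le)
    finally show ?thesis .
  qed
  have gm [measurable]: "gauss_smooth f \<delta> \<in> borel_measurable borel"
  proof -
    interpret prob_space "std_gaussian :: 'b measure" by (rule prob_space_std_gaussian)
    show ?thesis unfolding gauss_smooth_def[abs_def] by measurable
  qed
  have approx: "\<bar>(\<integral>x. gauss_smooth f \<delta> x \<partial>Q) - (\<integral>x. f x \<partial>Q)\<bar> \<le> e / 4"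
    if Q: "prob_space Q" "sets Q = sets borel" for Q
  proof -
    interpret Q: prob_space Q by fact
    note Q(2)[measurable_cong]
    have i1: "integrable Q f" by (rule Q.integrable_const_bound[of _ B]) (use B in auto)
    have i2: "integrable Q (\<lambda>x. gauss_smooth f \<delta> x - f x)"
      by (rule Q.integrable_const_bound[of _ "e / 4"]) (use \<delta> in auto)
    have i3: "integrable Q (gauss_smooth f \<delta>)" using Bochner_Integration.integrable_add[OF i1 i2] by simp
    have "\<bar>(\<integral>x. gauss_smooth f \<delta> x \<partial>Q) - (\<integral>x. f x \<partial>Q)\<bar> = \<bar>\<integral>x. gauss_smooth f \<delta> x - f x \<partial>Q\<bar>"
      using i1 i3 by simp
    also have "\<dots> \<le> (\<integral>x. \<bar>gauss_smooth f \<delta> x - f x\<bar> \<partial>Q)" by (rule integral_abs_bound)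
    also have "\<dots> \<le> (\<integral>x. e / 4 \<partial>Q)" using i2 \<delta> by (intro Bochner_Integration.integral_mono) auto
    finally show ?thesis by (simp add: Q.prob_space)
  qed
  obtain N where N: "\<And>n. n \<ge> N \<Longrightarrow> norm ((\<integral>x. gauss_smooth f \<delta> x \<partial>P n) - (\<integral>x. gauss_smooth f \<delta> x \<partial>L)) < e / 4"
    using LIMSEQ_D[OF gauss_smooth_tendsto[OF fint \<delta>(1) P L conv], of "e / 4"] e by auto
  show "\<exists>N. \<forall>n\<ge>N. norm ((\<integral>x. f x \<partial>P n) - (\<integral>x. f x \<partial>L)) < e"
  proof (intro exI allI impI)
    fix n assume "n \<ge> N"
    from N[OF this] approx[OF P, of n] approx[OF L] e
    show "norm ((\<integral>x. f x \<partial>P n) - (\<integral>x. f x \<partial>L)) < e" by (simp add: abs_if split: if_splits)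
  qed
qed

text \<open>The limit is given as a probability law, so tightness of the sequence need not be read
  off the characteristic functions: testing with a compactly supported cutoff transfers the tail
  bound of \<open>L\<close> to all late \<open>P n\<close>.\<close>

theorem levy_continuity_euclidean:
  fixes f :: "'b::euclidean_space \<Rightarrow> real"
  assumes P: "\<And>n::nat. prob_space (P n)" "\<And>n. sets (P n) = sets borel"
    and L: "prob_space L" "sets L = sets borel"
    and conv: "\<And>u. (\<lambda>n. fourier (P n) u) \<longlonglongrightarrow> fourier L u"
    and cf: "continuous_on UNIV f" and bdd: "bounded (range f)"
  shows "(\<lambda>n. \<integral>x. f x \<partial>P n) \<longlonglongrightarrow> (\<integral>x. f x \<partial>L)"
proof (rule LIMSEQ_I)
  fix e :: real assume e: "e > 0"
  have fm [measurable]: "f \<in> borel_measurable borel" by (rule borel_measurable_continuous_onI) (rule cf)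
  obtain B where B: "B > 0" "\<And>x. \<bar>f x\<bar> \<le> B"
    using bdd by (auto simp: bounded_pos)
  obtain R where R: "R > 0" "measure L {x. norm x > R} < e / (8 * B)"
    using prob_space_norm_tail[OF L, of "e / (8 * B)"] e B by auto
  \<comment> \<open>A continuous cutoff. The mass it loses, one minus its integral, bounds the error
    of replacing \<open>f\<close> by \<open>f * \<psi>\<close> and, unlike the probability of a tail
    set, converges along \<open>P n\<close>.\<close>
  define \<psi> where "\<psi> x = max 0 (min 1 (R + 1 - norm x))" for x :: 'b
  have \<psi>: "0 \<le> \<psi> x" "\<psi> x \<le> 1" "norm x \<le> R \<Longrightarrow> \<psi> x = 1" "norm x > R + 1 \<Longrightarrow> \<psi> x = 0" for x
    by (auto simp: \<psi>_def)
  have c\<psi>: "continuous_on UNIV \<psi>" unfolding \<psi>_def[abs_def] by (intro continuous_intros)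
  have [measurable]: "\<psi> \<in> borel_measurable borel" by (rule borel_measurable_continuous_onI) (rule c\<psi>)
  have c1: "(\<lambda>n. \<integral>x. \<psi> x \<partial>P n) \<longlonglongrightarrow> (\<integral>x. \<psi> x \<partial>L)"
    by (rule levy_continuity_compact_support[OF P L conv c\<psi>, where R = "R + 1" and B = 1])
       (simp_all add: \<psi>(1,2,4))
  have bd: "\<bar>f x * \<psi> x\<bar> \<le> B" for x
    using mult_mono[OF B(2) \<psi>(2), of x x] \<psi>(1)[of x] B(1) by (simp add: abs_mult)
  have c2: "(\<lambda>n. \<integral>x. f x * \<psi> x \<partial>P n) \<longlonglongrightarrow> (\<integral>x. f x * \<psi> x \<partial>L)"
  proof (rule levy_continuity_compact_support[OF P L conv, where R = "R + 1" and B = B])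
    show "continuous_on UNIV (\<lambda>x. f x * \<psi> x)" by (intro continuous_intros cf c\<psi>)
    show "\<bar>f x * \<psi> x\<bar> \<le> B" for x by (rule bd)
  qed (simp add: \<psi>(4))
  have approx: "\<bar>(\<integral>x. f x \<partial>Q) - (\<integral>x. f x * \<psi> x \<partial>Q)\<bar> \<le> B * (1 - (\<integral>x. \<psi> x \<partial>Q))"
    "measure Q {x. norm x > R} \<ge> 1 - (\<integral>x. \<psi> x \<partial>Q)"
    if Q: "prob_space Q" "sets Q = sets borel" for Q
  proof -
    interpret Q: prob_space Q by fact
    note Q(2)[measurable_cong]
    have sp: "space Q = UNIV" using sets_eq_imp_space_eq[OF Q(2)] by simp
    have i1: "integrable Q f" by (rule Q.integrable_const_bound[of _ B]) (simp_all add: B(2))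
    have i2: "integrable Q \<psi>" by (rule Q.integrable_const_bound[of _ 1]) (simp_all add: \<psi>(1,2))
    have i3: "integrable Q (\<lambda>x. f x * \<psi> x)"
      by (rule Q.integrable_const_bound[of _ B]) (simp_all add: bd)
    have "\<bar>(\<integral>x. f x \<partial>Q) - (\<integral>x. f x * \<psi> x \<partial>Q)\<bar> = \<bar>\<integral>x. f x - f x * \<psi> x \<partial>Q\<bar>"
      using i1 i3 by simp
    also have "\<dots> \<le> (\<integral>x. \<bar>f x - f x * \<psi> x\<bar> \<partial>Q)" by (rule integral_abs_bound)
    also have "\<dots> \<le> (\<integral>x. B * (1 - \<psi> x) \<partial>Q)"
    proof (rule Bochner_Integration.integral_mono)
      fix x
      have "\<bar>f x - f x * \<psi> x\<bar> = \<bar>f x\<bar> * (1 - \<psi> x)"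
      proof -
        have "f x - f x * \<psi> x = f x * (1 - \<psi> x)" by (simp add: algebra_simps)
        then show ?thesis using \<psi>(2)[of x] by (simp add: abs_mult)
      qed
      also have "\<dots> \<le> B * (1 - \<psi> x)" using B(2) \<psi>(2)[of x] by (intro mult_right_mono) auto
      finally show "\<bar>f x - f x * \<psi> x\<bar> \<le> B * (1 - \<psi> x)" .
    qed (use i1 i2 i3 in auto)
    also have "\<dots> = B * (1 - (\<integral>x. \<psi> x \<partial>Q))" using i2 by (simp add: Q.prob_space)
    finally show "\<bar>(\<integral>x. f x \<partial>Q) - (\<integral>x. f x * \<psi> x \<partial>Q)\<bar> \<le> B * (1 - (\<integral>x. \<psi> x \<partial>Q))" .
    have "1 - (\<integral>x. \<psi> x \<partial>Q) = (\<integral>x. 1 - \<psi> x \<partial>Q)" using i2 by (simp add: Q.prob_space)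
    also have "\<dots> \<le> (\<integral>x. indicator {x. norm x > R} x \<partial>Q)"
    proof (rule Bochner_Integration.integral_mono)
      fix x show "1 - \<psi> x \<le> indicator {x. norm x > R} x"
        using \<psi>(1)[of x] \<psi>(3)[of x] by (cases "norm x \<le> R") auto
      show "integrable Q (indicator {x. norm x > R} :: _ \<Rightarrow> real)"
        by (rule Q.integrable_const_bound[of _ 1]) (auto simp: indicator_def)
    qed (use i2 in auto)
    also have "\<dots> = measure Q {x. norm x > R}" by (simp add: sp)
    finally show "measure Q {x. norm x > R} \<ge> 1 - (\<integral>x. \<psi> x \<partial>Q)" .
  qed
  have L1: "B * (1 - (\<integral>x. \<psi> x \<partial>L)) \<le> e / 8"
  proof -
    have "B * (1 - (\<integral>x. \<psi> x \<partial>L)) \<le> B * (e / (8 * B))"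
      using approx(2)[OF L] R B(1) by (intro mult_left_mono) auto
    then show ?thesis using B(1) by simp
  qed
  obtain N1 where N1: "\<And>n. n \<ge> N1 \<Longrightarrow> norm ((\<integral>x. \<psi> x \<partial>P n) - (\<integral>x. \<psi> x \<partial>L)) < e / (8 * B)"
    using LIMSEQ_D[OF c1, of "e / (8 * B)"] e B(1) by auto
  obtain N2 where N2: "\<And>n. n \<ge> N2 \<Longrightarrow> norm ((\<integral>x. f x * \<psi> x \<partial>P n) - (\<integral>x. f x * \<psi> x \<partial>L)) < e / 4"
    using LIMSEQ_D[OF c2, of "e / 4"] e by auto
  show "\<exists>N. \<forall>n\<ge>N. norm ((\<integral>x. f x \<partial>P n) - (\<integral>x. f x \<partial>L)) < e"
  proof (intro exI allI impI)
    fix n assume n: "n \<ge> max N1 N2"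
    have "B * (1 - (\<integral>x. \<psi> x \<partial>P n)) \<le> B * ((1 - (\<integral>x. \<psi> x \<partial>L)) + e / (8 * B))"
      using N1[of n] n B(1) by (intro mult_left_mono) auto
    also have "\<dots> \<le> e / 8 + e / 8"
      using L1 B(1) unfolding distrib_left by (intro add_mono) auto
    finally have "\<bar>(\<integral>x. f x \<partial>P n) - (\<integral>x. f x * \<psi> x \<partial>P n)\<bar> \<le> e / 4"
      using approx(1)[OF P, of n] by linarith
    moreover have "\<bar>(\<integral>x. f x \<partial>L) - (\<integral>x. f x * \<psi> x \<partial>L)\<bar> \<le> e / 8"
      using approx(1)[OF L] L1 by linarith
    moreover have "\<bar>(\<integral>x. f x * \<psi> x \<partial>P n) - (\<integral>x. f x * \<psi> x \<partial>L)\<bar> < e / 4"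
      using N2[of n] n by simp
    ultimately show "norm ((\<integral>x. f x \<partial>P n) - (\<integral>x. f x \<partial>L)) < e"
      using e unfolding real_norm_def by linarith
  qed
qed

section \<open>Linear images of the standard Gaussian law\<close>

lemma vector_4 [simp]:
  "(vector [x, y, z, w] :: 'a::zero^4) $ 1 = x"
  "(vector [x, y, z, w] :: 'a::zero^4) $ 2 = y"
  "(vector [x, y, z, w] :: 'a::zero^4) $ 3 = z"
  "(vector [x, y, z, w] :: 'a::zero^4) $ 4 = w"
  unfolding vector_def by simp_all

lemma matrix_inv_mult:
  fixes A :: "real^'n^'n"
  assumes "invertible A"
  shows "A ** matrix_inv A = mat 1" "matrix_inv A ** A = mat 1"
  using someI_ex[OF assms[unfolded invertible_def]] by (auto simp: matrix_inv_def)

text \<open>It suffices to compare both measures on boxes, where the preimage under \<open>A\<close>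
  is the image under the inverse and its volume is known. Equality of measures, rather than a
  formula for integrals, lets densities be transported by rewriting.\<close>

lemma lborel_linear:
  fixes A :: "real^('n::{finite,wellorder})^('n::{finite,wellorder})"
  assumes "invertible A"
  shows "lborel = density (distr lborel borel (\<lambda>z. A *v z)) (\<lambda>_. ennreal \<bar>det A\<bar>)"
proof (rule lborel_eqI)
  let ?B = "matrix_inv A"
  have inv: "A ** ?B = mat 1" "?B ** A = mat 1" using matrix_inv_mult[OF assms] by auto
  have lin: "(\<lambda>z. A *v z) \<in> borel_measurable borel"
    by (intro borel_measurable_continuous_onI linear_continuous_on matrix_vector_mul_bounded_linear)
  fix l u :: "real^('n::{finite,wellorder})" assume le: "\<And>b. b \<in> Basis \<Longrightarrow> l \<bullet> b \<le> u \<bullet> b"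
  have vim: "(\<lambda>z. A *v z) -` box l u = (\<lambda>x. ?B *v x) ` box l u"
  proof safe
    fix z assume "A *v z \<in> box l u"
    moreover have "z = ?B *v (A *v z)" by (simp add: matrix_vector_mul_assoc inv)
    ultimately show "z \<in> (\<lambda>x. ?B *v x) ` box l u" by blast
  next
    fix x assume "x \<in> box l u"
    then show "?B *v x \<in> (\<lambda>z. A *v z) -` box l u" by (simp add: matrix_vector_mul_assoc inv)
  qed
  have detB: "\<bar>det A\<bar> * \<bar>det ?B\<bar> = 1"
    using inv(1) by (metis abs_1 abs_mult det_I det_mul)
  have bx: "box l u \<in> lmeasurable" by simp
  have im: "(\<lambda>x. ?B *v x) ` box l u \<in> lmeasurable" 
    by (rule measurable_linear_image[OF _ bx]) simp
  have "measure lebesgue ((\<lambda>x. ?B *v x) ` box l u) = \<bar>det ?B\<bar> * measure lebesgue (box l u)"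
    using measure_linear_image[OF _ bx, of "\<lambda>x. ?B *v x"] by simp
  then have em: "emeasure lebesgue ((\<lambda>x. ?B *v x) ` box l u) = ennreal (\<bar>det ?B\<bar> * measure lebesgue (box l u))"
    using emeasure_eq_measure2[OF im] by simp
  have vm: "(\<lambda>z. A *v z) -` box l u \<in> sets borel" using measurable_sets[OF lin, of "box l u"] by simp
  have "emeasure (density (distr lborel borel (\<lambda>z. A *v z)) (\<lambda>_. ennreal \<bar>det A\<bar>)) (box l u)
     = ennreal \<bar>det A\<bar> * emeasure lborel ((\<lambda>z. A *v z) -` box l u)"
    using lin by (simp add: emeasure_density nn_integral_cmult emeasure_distr)
  also have "emeasure lborel ((\<lambda>z. A *v z) -` box l u) = ennreal (\<bar>det ?B\<bar> * measure lebesgue (box l u))"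
    using em vm unfolding vim by simp
  also have "ennreal \<bar>det A\<bar> * \<dots> = ennreal ((\<bar>det A\<bar> * \<bar>det ?B\<bar>) * measure lebesgue (box l u))"
    by (simp add: ennreal_mult' mult.assoc)
  also have "\<dots> = ennreal (\<Prod>b\<in>Basis. (u - l) \<bullet> b)"
    unfolding detB using le by (simp add: measure_lborel_box_eq)
  finally show "emeasure (density (distr lborel borel (\<lambda>z. A *v z)) (\<lambda>_. ennreal \<bar>det A\<bar>)) (box l u)
     = (\<Prod>b\<in>Basis. (u - l) \<bullet> b)" .
qed simp

lemma measurable_matrix_vector_mult [measurable]:
  "(\<lambda>z. A *v z) \<in> borel_measurable borel" for A :: "real^'n^'m"
  by (intro borel_measurable_continuous_onI linear_continuous_on matrix_vector_mul_bounded_linear)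

text \<open>Under \<open>x = A z\<close> the quadratic form of the inverse of \<open>A A^T\<close>
  becomes the squared norm of \<open>z\<close>, and the Jacobian \<open>\<bar>det A\<bar>\<close>
  cancels the square root of \<open>det S\<close>. All later work on normal laws happens on the
  standard Gaussian.\<close>

lemma multivariate_normal_factor:
  fixes A S :: "real^('n::{finite,wellorder})^('n::{finite,wellorder})"
  assumes A: "invertible A" and S: "S = A ** transpose A"
  shows "multivariate_normal 0 S = distr std_gaussian borel (\<lambda>z. A *v z)"
proof (rule measure_eqI)
  show "sets (multivariate_normal 0 S) = sets (distr std_gaussian borel (\<lambda>z. A *v z))"
    by (simp add: multivariate_normal_def)
  fix E assume "E \<in> sets (multivariate_normal 0 S)"
  then have [measurable]: "E \<in> sets borel" by (simp add: multivariate_normal_def)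
  have iS: "invertible S" unfolding S using A by (intro invertible_mult transpose_invertible)
  have detA: "det A \<noteq> 0" using A by (simp add: invertible_det_nz)
  let ?h = "\<lambda>x. exp (- (x \<bullet> (matrix_inv S *v x)) / 2) / sqrt ((2 * pi) ^ CARD('n) * det S)"
  have [measurable]: "?h \<in> borel_measurable borel" by measurable
  have h: "\<bar>det A\<bar> * ?h (A *v z) = gauss_density z" for z
  proof -
    \<comment> \<open>\<open>w\<close> solves \<open>S w = A z\<close>; cancelling \<open>A\<close>
      gives \<open>A^T w = z\<close>, so the inverse of \<open>S\<close> is never computed.\<close>
    define w where "w = matrix_inv S *v (A *v z)"
    have "S *v w = A *v z"
      using matrix_inv_mult[OF iS] by (simp add: w_def matrix_vector_mul_assoc matrix_mul_assoc)
    then have "A *v (transpose A *v w) = A *v z"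
      by (simp only: S matrix_vector_mul_assoc)
    then have "matrix_inv A *v (A *v (transpose A *v w)) = matrix_inv A *v (A *v z)" by simp
    then have z: "transpose A *v w = z"
      by (simp add: matrix_vector_mul_assoc matrix_mul_assoc matrix_inv_mult[OF A])
    have "(A *v z) \<bullet> w = z \<bullet> (transpose A *v w)"
      by (metis dot_lmul_matrix inner_commute transpose_matrix_vector)
    then have "(A *v z) \<bullet> w = (norm z)\<^sup>2" unfolding z by (simp add: power2_norm_eq_inner)
    moreover have "sqrt ((2 * pi) ^ CARD('n) * det S) = sqrt ((2 * pi) ^ CARD('n)) * \<bar>det A\<bar>"
      by (simp add: S det_mul real_sqrt_mult power2_eq_square[symmetric])
    ultimately show ?thesis
      using detA by (simp add: gauss_density_eq w_def[symmetric])
  qed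
  have "emeasure (multivariate_normal 0 S) E = (\<integral>\<^sup>+x. ennreal (?h x) * indicator E x \<partial>lborel)"
    unfolding multivariate_normal_def by (simp add: emeasure_density)
  also have "\<dots> = (\<integral>\<^sup>+z. ennreal \<bar>det A\<bar> * (ennreal (?h (A *v z)) * indicator E (A *v z)) \<partial>lborel)"
    by (subst lborel_linear[OF A]) (simp add: nn_integral_density nn_integral_distr)
  also have "\<dots> = (\<integral>\<^sup>+z. ennreal (gauss_density z) * indicator E (A *v z) \<partial>lborel)"
    by (intro nn_integral_cong) (simp only: mult.assoc[symmetric] ennreal_mult'[symmetric] abs_ge_zero h)
  also have "\<dots> = (\<integral>\<^sup>+z. ennreal (gauss_density z) * indicator ((\<lambda>z. A *v z) -` E) z \<partial>lborel)"
    by (simp add: indicator_def)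
  also have "\<dots> = emeasure (distr std_gaussian borel (\<lambda>z. A *v z)) E"
  proof -
    have "(\<lambda>z. A *v z) -` E \<in> sets borel"
      using measurable_sets[OF measurable_matrix_vector_mult, of E A] by simp
    then show ?thesis
      by (subst emeasure_distr) (simp_all add: std_gaussian_def emeasure_density)
  qed
  finally show "emeasure (multivariate_normal 0 S) E = emeasure (distr std_gaussian borel (\<lambda>z. A *v z)) E" .
qed

lemma fourier_std_gaussian: "fourier std_gaussian u = of_real (exp (- (norm u)\<^sup>2 / 2))"
  for u :: "'b::euclidean_space"
  using gauss_density_fourier[of u] unfolding fourier_def std_gaussian_def
  by (subst integral_density) (auto simp: has_bochner_integral_iff scaleR_conv_of_real)

lemma fourier_distr_linear:
  "fourier (distr std_gaussian borel (\<lambda>z. A *v z)) u = of_real (exp (- (norm (transpose A *v u))\<^sup>2 / 2))"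
  for A :: "real^'n^'m"
proof -
  have "u \<bullet> (A *v z) = (transpose A *v u) \<bullet> z" for z
    by (metis dot_lmul_matrix transpose_matrix_vector)
  then show ?thesis
    unfolding fourier_std_gaussian[symmetric] by (simp add: fourier_def integral_distr)
qed

lemma norm_vec2: "(norm (x::real^2))\<^sup>2 = (x$1)\<^sup>2 + (x$2)\<^sup>2"
  unfolding power2_norm_eq_inner by (simp add: inner_vec_def sum_2 power2_eq_square)

lemma norm_vec4: "(norm (x::real^4))\<^sup>2 = (x$1)\<^sup>2 + (x$2)\<^sup>2 + (x$3)\<^sup>2 + (x$4)\<^sup>2"
  unfolding power2_norm_eq_inner by (simp add: inner_vec_def sum_4 power2_eq_square)

text \<open>The Cholesky factor of the noise covariance.\<close>

definition noise_factor :: "real \<Rightarrow> real \<Rightarrow> real^2^2" where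
  "noise_factor \<sigma> \<rho> = vector [vector [\<sigma>, 0], vector [\<sigma> * \<rho>, \<sigma> * sqrt (1 - \<rho>\<^sup>2)]]"

lemma noise_factor:
  assumes "\<sigma> > 0" "\<bar>\<rho>\<bar> < 1"
  shows "invertible (noise_factor \<sigma> \<rho>)"
    and "\<sigma>\<^sup>2 *\<^sub>R vector [vector [1, \<rho>], vector [\<rho>, 1]] = noise_factor \<sigma> \<rho> ** transpose (noise_factor \<sigma> \<rho>)"
proof -
  have r: "\<rho>\<^sup>2 < 1" using assms(2) by (simp add: abs_square_less_1)
  show "invertible (noise_factor \<sigma> \<rho>)"
    using assms r by (simp add: invertible_det_nz det_2 noise_factor_def)
  show "\<sigma>\<^sup>2 *\<^sub>R vector [vector [1, \<rho>], vector [\<rho>, 1]] = noise_factor \<sigma> \<rho> ** transpose (noise_factor \<sigma> \<rho>)"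
    using r by (simp add: vec_eq_iff forall_2 matrix_matrix_mult_def sum_2 transpose_def noise_factor_def
        power2_eq_square algebra_simps)
qed

lemma noise_law_factor:
  assumes "\<sigma> > 0" "\<bar>\<rho>\<bar> < 1"
  shows "multivariate_normal 0 (\<sigma>\<^sup>2 *\<^sub>R vector [vector [1, \<rho>], vector [\<rho>, 1]])
     = distr std_gaussian borel (\<lambda>z. noise_factor \<sigma> \<rho> *v z)"
  using noise_factor[OF assms] by (intro multivariate_normal_factor)

lemma fourier_noise_law:
  fixes u :: "real^2"
  assumes "\<sigma> > 0" "\<bar>\<rho>\<bar> < 1"
  shows "fourier (multivariate_normal 0 (\<sigma>\<^sup>2 *\<^sub>R vector [vector [1, \<rho>], vector [\<rho>, 1]])) u
     = of_real (exp (- (\<sigma>\<^sup>2 * ((u$1)\<^sup>2 + 2 * \<rho> * (u$1) * (u$2) + (u$2)\<^sup>2)) / 2))"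
proof -
  have r: "\<rho>\<^sup>2 < 1" using assms(2) by (simp add: abs_square_less_1)
  have "(norm (transpose (noise_factor \<sigma> \<rho>) *v u))\<^sup>2 = (\<sigma> * (u$1) + \<sigma> * \<rho> * (u$2))\<^sup>2 + \<sigma>\<^sup>2 * (sqrt (1 - \<rho>\<^sup>2))\<^sup>2 * (u$2)\<^sup>2"
    by (simp add: norm_vec2 matrix_vector_mult_def sum_2 transpose_def noise_factor_def power_mult_distrib)
  also have "\<dots> = \<sigma>\<^sup>2 * ((u$1)\<^sup>2 + 2 * \<rho> * (u$1) * (u$2) + (u$2)\<^sup>2)"
    using r by (simp add: power2_eq_square algebra_simps)
  finally show ?thesis
    unfolding noise_law_factor[OF assms] fourier_distr_linear by simp
qed

text \<open>A square root of the asymptotic covariance matrix: the Kronecker product of \<open>noise_factor \<sigma> \<rho>\<close> and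
  the matrix with rows \<open>(0, 1 / sqrt D)\<close> and \<open>(1, - m / sqrt D)\<close>.\<close>

definition limit_factor :: "real \<Rightarrow> real \<Rightarrow> real \<Rightarrow> real \<Rightarrow> real^4^4" where
  "limit_factor \<sigma> \<rho> m D = \<sigma> *\<^sub>R vector
     [vector [0, 1 / sqrt D, 0, 0],
      vector [1, - m / sqrt D, 0, 0],
      vector [0, \<rho> / sqrt D, 0, sqrt (1 - \<rho>\<^sup>2) / sqrt D],
      vector [\<rho>, - \<rho> * m / sqrt D, sqrt (1 - \<rho>\<^sup>2), - sqrt (1 - \<rho>\<^sup>2) * m / sqrt D]]"

lemma limit_factor_mult:
  "limit_factor \<sigma> \<rho> m D *v z = vector
     [\<sigma> * (z$2) / sqrt D,
      \<sigma> * (z$1 - m * (z$2) / sqrt D),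
      \<sigma> * (\<rho> * (z$2) + sqrt (1 - \<rho>\<^sup>2) * (z$4)) / sqrt D,
      \<sigma> * ((\<rho> * (z$1) + sqrt (1 - \<rho>\<^sup>2) * (z$3)) - m * (\<rho> * (z$2) + sqrt (1 - \<rho>\<^sup>2) * (z$4)) / sqrt D)]"
  by (simp add: vec_eq_iff forall_4 matrix_vector_mult_def sum_4 limit_factor_def algebra_simps
      add_divide_distrib diff_divide_distrib)

lemma limit_factor:
  assumes "\<sigma> > 0" "\<bar>\<rho>\<bar> < 1" and D: "m2 - m\<^sup>2 > 0"
  shows "multivariate_normal 0 (asymptotic_covariance \<sigma> \<rho> (asymptotic_K m m2))
    = distr std_gaussian borel (\<lambda>z. limit_factor \<sigma> \<rho> m (m2 - m\<^sup>2) *v z)"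
proof (rule multivariate_normal_factor)
  have r: "\<rho>\<^sup>2 < 1" using assms(2) by (simp add: abs_square_less_1)
  define D where "D = m2 - m\<^sup>2"
  have D0: "D > 0" and m2: "m2 = D + m\<^sup>2" using D by (auto simp: D_def)
  define s where "s = sqrt (1 - \<rho>\<^sup>2)"
  have s: "s > 0" "s * s = 1 - \<rho>\<^sup>2" using r by (auto simp: s_def)
  define d where "d = sqrt D"
  have d: "d > 0" "d * d = D" using D0 by (auto simp: d_def)
  \<comment> \<open>Invertibility via a trivial kernel: the coordinates vanish one by one in the
    order 2, 1, 4, 3, which avoids expanding a 4 by 4 determinant.\<close>
  have "\<exists>B. B ** limit_factor \<sigma> \<rho> m D = mat 1"
    unfolding matrix_left_invertible_ker
  proof (intro allI impI)
    fix z :: "real^4" assume "limit_factor \<sigma> \<rho> m D *v z = 0"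
    then have e: "\<sigma> * (z$2) / d = 0" "\<sigma> * (z$1 - m * (z$2) / d) = 0"
        "\<sigma> * (\<rho> * (z$2) + s * (z$4)) / d = 0" 
        "\<sigma> * ((\<rho> * (z$1) + s * (z$3)) - m * (\<rho> * (z$2) + s * (z$4)) / d) = 0"
      unfolding limit_factor_mult vec_eq_iff forall_4 s_def[symmetric] d_def[symmetric] by auto
    from e(1) have z2: "z$2 = 0" using assms d by simp
    with e(2) have z1: "z$1 = 0" using assms by simp
    from e(3) z2 have z4: "z$4 = 0" using assms d s by simp
    from e(4) z1 z2 z4 have z3: "z$3 = 0" using assms s by simp
    show "z = 0" by (simp add: vec_eq_iff forall_4 z1 z2 z3 z4)
  qed
  then show "invertible (limit_factor \<sigma> \<rho> m (m2 - m\<^sup>2))"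
    unfolding D_def by (simp add: invertible_left_inverse)
  \<comment> \<open>The square roots are abstracted to \<open>s\<close> and \<open>d\<close>, of
    which only \<open>s * s\<close> and \<open>d * d\<close> matter, so each entry becomes a
    rational identity.\<close>
  show "asymptotic_covariance \<sigma> \<rho> (asymptotic_K m m2) =
     limit_factor \<sigma> \<rho> m (m2 - m\<^sup>2) ** transpose (limit_factor \<sigma> \<rho> m (m2 - m\<^sup>2))"
    unfolding D_def[symmetric] asymptotic_covariance_def block_matrix_def asymptotic_K_def limit_factor_def
      s_def[symmetric] d_def[symmetric]
    unfolding m2
    using d(1) D0
    by (simp add: vec_eq_iff forall_4 matrix_matrix_mult_def sum_4 transpose_def, simp add: d(2)[symmetric] field_simps power2_eq_square,
        simp add: s(2) power2_eq_square algebra_simps)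
qed

section \<open>The noise filtration\<close>

lemma measurable_vec_nth [measurable]: "(\<lambda>x::real^'n. x $ i) \<in> borel_measurable borel"
  by (intro borel_measurable_continuous_onI continuous_intros)

lemma sq_integrable_mult:
  fixes f g :: "'a \<Rightarrow> real"
  assumes [measurable]: "f \<in> borel_measurable M" "g \<in> borel_measurable M"
    and f: "integrable M (\<lambda>x. (f x)\<^sup>2)" and g: "integrable M (\<lambda>x. (g x)\<^sup>2)"
  shows "integrable M (\<lambda>x. f x * g x)"
proof (rule Bochner_Integration.integrable_bound)
  show "integrable M (\<lambda>x. (f x)\<^sup>2 + (g x)\<^sup>2)" using f g by simp
  show "AE x in M. norm (f x * g x) \<le> norm ((f x)\<^sup>2 + (g x)\<^sup>2)"
  proof (intro always_eventually allI)
    fix x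
    have "0 \<le> (\<bar>f x\<bar> - \<bar>g x\<bar>)\<^sup>2" by simp
    then have "2 * (\<bar>f x\<bar> * \<bar>g x\<bar>) \<le> (f x)\<^sup>2 + (g x)\<^sup>2" by (simp add: power2_diff)
    then show "norm (f x * g x) \<le> norm ((f x)\<^sup>2 + (g x)\<^sup>2)"
      by (simp add: abs_mult) (smt (verit) mult_nonneg_nonneg abs_ge_zero)
  qed
qed measurable

context bar_model
begin

lemma params: "bar_params \<alpha>\<^sub>0 \<alpha>\<^sub>1 \<sigma>"
  using alpha_range sigma_pos by unfold_locales auto

sublocale bar_params \<alpha>\<^sub>0 \<beta>\<^sub>0 \<alpha>\<^sub>1 \<beta>\<^sub>1 \<sigma>
  by (rule params)

abbreviation noise :: "nat \<Rightarrow> 'a \<Rightarrow> real^2" where "noise \<equiv> noise_pair \<epsilon>"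

lemma noise_measurable [measurable]: "n \<ge> 1 \<Longrightarrow> noise n \<in> borel_measurable M"
  using noise_indep by (auto simp: indep_vars_def2)

text \<open>The ancestor is treated as innovation number \<open>0\<close>, padded to a vector so that the whole family is
  independent in the sense of \<open>indep_vars\<close>.\<close>

definition innovation :: "nat \<Rightarrow> 'a \<Rightarrow> real^2" where
  "innovation n \<omega> = (if n = 0 then X 1 \<omega> *\<^sub>R vector [1, 0] else noise n \<omega>)"

lemma innovation_measurable: "innovation n \<in> borel_measurable M"
  using ancestor_measurable noise_measurable[of n]
  by (cases "n = 0") (auto simp: innovation_def[abs_def])

text \<open>Index 0 is split off: the event for the other indices lies in the \<sigma>-algebra of
  the whole noise sequence, hence is independent of the ancestor, and it factors further by
  independence of the noise pairs.\<close>

lemma indep_innovation: "indep_vars (\<lambda>_. borel) innovation UNIV"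
  unfolding indep_vars_def2
proof (intro conjI ballI innovation_measurable indep_setsI)
  show "{innovation i -` A \<inter> space M |A. A \<in> sets borel} \<subseteq> events" for i
    using measurable_sets[OF innovation_measurable] by auto
  fix A J assume J: "J \<noteq> {}" "J \<subseteq> (UNIV :: nat set)" "finite J"
    and A: "\<forall>j\<in>J. A j \<in> {innovation j -` B \<inter> space M |B. B \<in> sets borel}"
  define J' where "J' = J - {0}"
  have J': "finite J'" "J' \<subseteq> {1..}" using J by (auto simp: J'_def Suc_le_eq)
  have A': "\<forall>j\<in>J'. A j \<in> {noise j -` B \<inter> space M |B. B \<in> sets borel}"
    using A J' unfolding J'_def by (fastforce simp: innovation_def[abs_def])
  have indJ: "prob (\<Inter>j\<in>J'. A j) = (\<Prod>j\<in>J'. prob (A j))" if "J' \<noteq> {}"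
    using noise_indep A' J' that unfolding indep_vars_def2 by (intro indep_setsD[of _ "{1..}"]) auto
  show "prob (\<Inter>j\<in>J. A j) = (\<Prod>j\<in>J. prob (A j))"
  proof (cases "0 \<in> J")
    case False
    then have "J' = J" by (auto simp: J'_def)
    with indJ J show ?thesis by auto
  next
    case True
    show ?thesis
    proof (cases "J' = {}")
      case True
      with \<open>0 \<in> J\<close> have "J = {0}" by (auto simp: J'_def)
      then show ?thesis by simp
    next
      case False
      let ?f = "\<lambda>\<omega>. \<lambda>n\<in>{1..}. noise n \<omega>"
      let ?U = "vimage_algebra (space M) (X 1) borel"
      let ?V = "vimage_algebra (space M) ?f (\<Pi>\<^sub>M n\<in>{1..}. borel)"
      obtain B where B: "B \<in> sets borel" "A 0 = innovation 0 -` B \<inter> space M"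
        using A True by auto
      have m0: "(\<lambda>\<omega>. X 1 \<omega> *\<^sub>R (vector [1, 0] :: real^2)) \<in> borel_measurable ?U"
        using measurable_vimage_algebra1[of "X 1" "space M" borel] by measurable
      have "(\<lambda>\<omega>. X 1 \<omega> *\<^sub>R (vector [1, 0] :: real^2)) -` B \<inter> space ?U \<in> sets ?U"
        by (rule measurable_sets[OF m0 B(1)])
      then have A0: "A 0 \<in> sets ?U"
        unfolding B(2) innovation_def by simp
      have mf: "?f \<in> ?V \<rightarrow>\<^sub>M (\<Pi>\<^sub>M n\<in>{1..}. borel)"
        by (rule measurable_vimage_algebra1) (auto simp: space_PiM)
      have "A j \<in> sets ?V" if jJ: "j \<in> J'" for j
      proof -
        obtain B where B: "B \<in> sets borel" "A j = noise j -` B \<inter> space M"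
          using A'[rule_format, OF jJ] by blast
        have j: "j \<in> {1..}" using jJ J' by auto
        have "(\<lambda>\<omega>. ?f \<omega> j) \<in> borel_measurable ?V"
          by (rule measurable_compose[OF mf measurable_component_singleton[OF j]])
        then have "(\<lambda>\<omega>. ?f \<omega> j) -` B \<inter> space ?V \<in> sets ?V"
          using B(1) by (rule measurable_sets)
        with j show ?thesis unfolding B(2) by simp
      qed
      then have AJ: "(\<Inter>j\<in>J'. A j) \<in> sets ?V"
        using J' False by (intro sets.finite_INT) auto
      have "J = insert 0 J'" "0 \<notin> J'" using True by (auto simp: J'_def)
      then have "prob (\<Inter>j\<in>J. A j) = prob (A 0 \<inter> (\<Inter>j\<in>J'. A j))" by simp
      also have "\<dots> = prob (A 0) * prob (\<Inter>j\<in>J'. A j)"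
        by (rule indep_setD[OF noise_indep_ancestor A0 AJ])
      also have "\<dots> = (\<Prod>j\<in>J. prob (A j))"
        unfolding indJ[OF False] \<open>J = insert 0 J'\<close> using \<open>0 \<notin> J'\<close> J'(1) by simp
      finally show ?thesis .
    qed
  qed
qed

text \<open>Only the space and the \<sigma>-algebra of this measure are used. The index is strict:
  \<open>past i\<close> stops before noise pair \<open>i\<close>, so a weight attached to pair
  \<open>i\<close> is predictable when it is measurable for \<open>past i\<close>.\<close>

definition past :: "nat \<Rightarrow> 'a measure" where
  "past i = vimage_algebra (space M) (\<lambda>\<omega>. \<lambda>j\<in>{..<i}. innovation j \<omega>) (\<Pi>\<^sub>M j\<in>{..<i}. borel)"

lemma space_past [simp]: "space (past i) = space M"
  by (simp add: past_def)

lemma innovation_past: "j < i \<Longrightarrow> innovation j \<in> borel_measurable (past i)"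
proof -
  assume j: "j < i"
  have "(\<lambda>\<omega>. \<lambda>j\<in>{..<i}. innovation j \<omega>) \<in> past i \<rightarrow>\<^sub>M (\<Pi>\<^sub>M j\<in>{..<i}. borel)"
    unfolding past_def by (rule measurable_vimage_algebra1) (auto simp: space_PiM)
  from measurable_compose[OF this measurable_component_singleton[of j]] j
  show ?thesis by simp
qed

lemma sets_past_subset: "sets (past i) \<subseteq> events"
  unfolding past_def
  by (rule sets_image_in_sets) (auto intro!: measurable_restrict innovation_measurable)

lemma sets_past_mono: "i \<le> k \<Longrightarrow> sets (past i) \<subseteq> sets (past k)"
  unfolding past_def[of i]
  by (rule sets_image_in_sets) (auto intro!: measurable_restrict innovation_past)

lemma measurable_past_mono: "f \<in> past i \<rightarrow>\<^sub>M N \<Longrightarrow> i \<le> k \<Longrightarrow> f \<in> past k \<rightarrow>\<^sub>M N"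
  using sets_past_mono[of i k] unfolding measurable_def by auto

lemma measurable_past: "f \<in> past i \<rightarrow>\<^sub>M N \<Longrightarrow> f \<in> M \<rightarrow>\<^sub>M N"
  using sets_past_subset[of i] unfolding measurable_def by auto

lemma noise_past: "1 \<le> j \<Longrightarrow> j < i \<Longrightarrow> noise j \<in> borel_measurable (past i)"
  using innovation_past[of j i] by (simp add: innovation_def[abs_def])

definition component :: "nat \<Rightarrow> 2" where "component j = (if even j then 1 else 2)"

lemma eps_noise: "j \<ge> 2 \<Longrightarrow> \<epsilon> j \<omega> = noise (j div 2) \<omega> $ component j"
  by (cases "even j") (auto simp: component_def noise_pair_def elim!: evenE oddE)

text \<open>Only the parity of the first argument counts, so \<open>drift 0\<close> and
  \<open>drift 1\<close> are the mean maps of the left and the right daughter.\<close>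

definition drift :: "nat \<Rightarrow> real \<Rightarrow> real" where
  "drift j x = (if even j then \<alpha>\<^sub>0 * x + \<beta>\<^sub>0 else \<alpha>\<^sub>1 * x + \<beta>\<^sub>1)"

lemma drift_measurable [measurable]: "drift j \<in> borel_measurable borel"
  unfolding drift_def[abs_def] by measurable

lemma X_step: "j \<ge> 2 \<Longrightarrow> \<omega> \<in> space M \<Longrightarrow> X j \<omega> = drift j (X (j div 2) \<omega>) + \<epsilon> j \<omega>"
  using left_daughter[of "j div 2" \<omega>] right_daughter[of "j div 2" \<omega>]
  by (cases "even j") (auto simp: drift_def elim!: evenE oddE)

lemma eps_past: "2 \<le> j \<Longrightarrow> j div 2 < i \<Longrightarrow> \<epsilon> j \<in> borel_measurable (past i)"
proof -
  assume j: "2 \<le> j" "j div 2 < i"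
  have [measurable]: "noise (j div 2) \<in> borel_measurable (past i)"
    using j by (intro noise_past) auto
  have "(\<lambda>\<omega>. noise (j div 2) \<omega> $ component j) \<in> borel_measurable (past i)" by measurable
  then show ?thesis using eps_noise[OF j(1)] by (simp cong: measurable_cong)
qed

lemma X_past: "1 \<le> j \<Longrightarrow> j \<le> i \<Longrightarrow> X j \<in> borel_measurable (past i)"
proof (induction j rule: less_induct)
  case (less j)
  show ?case
  proof (cases "j = 1")
    case True
    have [measurable]: "innovation 0 \<in> borel_measurable (past i)"
      using less True by (intro innovation_past) auto
    have "(\<lambda>\<omega>. innovation 0 \<omega> $ 1) \<in> borel_measurable (past i)" by measurable
    then show ?thesis unfolding True by (simp add: innovation_def[abs_def])
  next
    case False
    with less have j: "j \<ge> 2" by auto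
    have [measurable]: "X (j div 2) \<in> borel_measurable (past i)"
      by (rule less.IH) (use j less.prems in auto)
    have [measurable]: "\<epsilon> j \<in> borel_measurable (past i)"
      by (rule eps_past) (use j less.prems in auto)
    have "(\<lambda>\<omega>. drift j (X (j div 2) \<omega>) + \<epsilon> j \<omega>) \<in> borel_measurable (past i)" by measurable
    then show ?thesis
      by (rule measurable_cong[THEN iffD1, rotated]) (simp add: X_step[OF j])
  qed
qed

lemma X_measurable [measurable]: "1 \<le> j \<Longrightarrow> X j \<in> borel_measurable M"
  using X_past[of j j] by (auto intro: measurable_past)

section \<open>Conditioning on the past by integrating out one noise pair\<close>

abbreviation noise_law :: "(real^2) measure" where
  "noise_law \<equiv> multivariate_normal 0 (\<sigma>\<^sup>2 *\<^sub>R vector [vector [1, \<rho>], vector [\<rho>, 1]])"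

lemma prob_space_noise_law: "prob_space noise_law"
  unfolding noise_law[of 1, simplified, symmetric] by (rule prob_space_distr) simp

lemma sets_noise_law [simp, measurable_cong]: "sets noise_law = sets borel"
  by (simp add: multivariate_normal_def)

lemma id_past [measurable]: "(\<lambda>\<omega>. \<omega>) \<in> M \<rightarrow>\<^sub>M past i"
  using sets_past_subset[of i] sets.sets_into_space
  by (auto simp: measurable_def)

text \<open>Independence of the past and the current noise pair, cast as a product law: conditional
  expectations given the past become inner integrals in Fubini's theorem.\<close>

lemma joint_law:
  assumes i: "i \<ge> 1"
  shows "distr M (past i) (\<lambda>\<omega>. \<omega>) \<Otimes>\<^sub>M noise_law = distr M (past i \<Otimes>\<^sub>M borel) (\<lambda>\<omega>. (\<omega>, noise i \<omega>))"
proof (rule pair_measure_eqI)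
  have [measurable]: "noise i \<in> borel_measurable M" using i by simp
  interpret D: prob_space "distr M (past i) (\<lambda>\<omega>. \<omega>)" by (rule prob_space_distr) measurable
  interpret N: prob_space noise_law by (rule prob_space_noise_law)
  show "sigma_finite_measure (distr M (past i) (\<lambda>\<omega>. \<omega>))" by unfold_locales
  show "sigma_finite_measure noise_law" by unfold_locales
  show "sets (distr M (past i) (\<lambda>\<omega>. \<omega>) \<Otimes>\<^sub>M noise_law) = sets (distr M (past i \<Otimes>\<^sub>M borel) (\<lambda>\<omega>. (\<omega>, noise i \<omega>)))"
    by (simp cong: sets_pair_measure_cong)
  fix A B assume "A \<in> sets (distr M (past i) (\<lambda>\<omega>. \<omega>))" "B \<in> sets noise_law"
  then have A: "A \<in> sets (past i)" and B: "B \<in> sets borel" by simp_all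
  note [measurable] = A B
  let ?R = "\<lambda>\<omega>. \<lambda>j\<in>{..<i}. innovation j \<omega>"
  let ?S = "\<lambda>\<omega>. \<lambda>j\<in>{i}. innovation j \<omega>"
  \<comment> \<open>Disjoint blocks \<open>{..<i}\<close> and \<open>{i}\<close> of the independent
    innovations.\<close>
  have ind: "indep_var (\<Pi>\<^sub>M j\<in>{..<i}. borel) ?R (\<Pi>\<^sub>M j\<in>{i}. borel) ?S"
    by (rule indep_var_restrict[OF indep_innovation]) auto
  obtain A' where A': "A' \<in> sets (\<Pi>\<^sub>M j\<in>{..<i}. borel :: (real^2) measure)" "A = ?R -` A' \<inter> space M"
    using A unfolding past_def by (subst (asm) sets_vimage_algebra2) (auto simp: space_PiM)
  have cm: "(\<lambda>f. f i) \<in> (\<Pi>\<^sub>M j\<in>{i}. borel :: (real^2) measure) \<rightarrow>\<^sub>M borel"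
    by (rule measurable_component_singleton) simp
  define B' where "B' = (\<lambda>f. f i) -` B \<inter> space (\<Pi>\<^sub>M j\<in>{i}. borel :: (real^2) measure)"
  have B'm: "B' \<in> sets (\<Pi>\<^sub>M j\<in>{i}. borel)" unfolding B'_def using cm B by (rule measurable_sets)
  have SB: "?S -` B' \<inter> space M = noise i -` B \<inter> space M"
    using i by (auto simp: B'_def space_PiM innovation_def)
  have "prob ((\<lambda>x. (?R x, ?S x)) -` (A' \<times> B') \<inter> space M) = prob (?R -` A' \<inter> space M) * prob (?S -` B' \<inter> space M)"
    by (rule indep_varD[OF ind A'(1) B'm])
  moreover have "(\<lambda>x. (?R x, ?S x)) -` (A' \<times> B') \<inter> space M = A \<inter> (?S -` B' \<inter> space M)"
    by (auto simp: A'(2))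
  ultimately have p: "prob (A \<inter> (noise i -` B \<inter> space M)) = prob A * prob (noise i -` B \<inter> space M)"
    unfolding SB A'(2)[symmetric] by simp
  have AM: "A \<in> events" using A sets_past_subset by blast
  have "emeasure (distr M (past i) (\<lambda>\<omega>. \<omega>)) A = prob A"
    using sets.sets_into_space[OF AM] by (simp add: emeasure_distr A emeasure_eq_measure Int_absorb2)
  moreover have "emeasure noise_law B = prob (noise i -` B \<inter> space M)"
    unfolding noise_law[OF i, symmetric] by (simp add: emeasure_distr emeasure_eq_measure)
  moreover have "emeasure (distr M (past i \<Otimes>\<^sub>M borel) (\<lambda>\<omega>. (\<omega>, noise i \<omega>))) (A \<times> B) = prob (A \<inter> (noise i -` B \<inter> space M))"
    using sets.sets_into_space[OF AM]
    by (subst emeasure_distr) (auto simp: emeasure_eq_measure intro!: arg_cong[where f = prob])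
  ultimately show "emeasure (distr M (past i) (\<lambda>\<omega>. \<omega>)) A * emeasure noise_law B =
       emeasure (distr M (past i \<Otimes>\<^sub>M borel) (\<lambda>\<omega>. (\<omega>, noise i \<omega>))) (A \<times> B)"
    by (simp add: p ennreal_mult')
qed

text \<open>The freezing rule for conditional expectations: with the past held fixed, the current
  noise pair is averaged under its own law.\<close>

lemma expectation_noise:
  fixes H :: "'a \<times> (real^2) \<Rightarrow> 'c::{banach, second_countable_topology}"
  assumes i: "i \<ge> 1" and H [measurable]: "H \<in> borel_measurable (past i \<Otimes>\<^sub>M borel)"
    and int: "integrable M (\<lambda>\<omega>. H (\<omega>, noise i \<omega>))"
  shows "(\<integral>\<omega>. H (\<omega>, noise i \<omega>) \<partial>M) = (\<integral>\<omega>. (\<integral>y. H (\<omega>, y) \<partial>noise_law) \<partial>M)"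
proof -
  have [measurable]: "noise i \<in> borel_measurable M" using i by simp
  interpret D: prob_space "distr M (past i) (\<lambda>\<omega>. \<omega>)" by (rule prob_space_distr) measurable
  interpret N: prob_space noise_law by (rule prob_space_noise_law)
  interpret P: pair_sigma_finite "distr M (past i) (\<lambda>\<omega>. \<omega>)" noise_law by unfold_locales
  have "(\<integral>\<omega>. H (\<omega>, noise i \<omega>) \<partial>M) = (\<integral>p. H p \<partial>(distr M (past i) (\<lambda>\<omega>. \<omega>) \<Otimes>\<^sub>M noise_law))"
    unfolding joint_law[OF i] by (subst integral_distr) auto
  also have "\<dots> = (\<integral>\<omega>. (\<integral>y. H (\<omega>, y) \<partial>noise_law) \<partial>distr M (past i) (\<lambda>\<omega>. \<omega>))"
    by (rule P.integral_fst'[symmetric]) (use int in \<open>simp add: joint_law[OF i] integrable_distr_eq\<close>)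
  also have "\<dots> = (\<integral>\<omega>. (\<integral>y. H (\<omega>, y) \<partial>noise_law) \<partial>M)"
    by (subst integral_distr) auto
  finally show ?thesis .
qed

text \<open>On the product law a product of integrable factors in separate variables is integrable.
  This makes cross terms of martingale increments vanish when \<open>g\<close> is centred.\<close>

lemma past_noise_mult:
  fixes c :: "'a \<Rightarrow> real" and g :: "real^2 \<Rightarrow> real"
  assumes i: "i \<ge> 1" and c [measurable]: "c \<in> borel_measurable (past i)" and ci: "integrable M c"
    and g [measurable]: "g \<in> borel_measurable borel" and gi: "integrable noise_law g"
  shows "integrable M (\<lambda>\<omega>. c \<omega> * g (noise i \<omega>))"
    and "(\<integral>\<omega>. c \<omega> * g (noise i \<omega>) \<partial>M) = (\<integral>\<omega>. c \<omega> \<partial>M) * (\<integral>y. g y \<partial>noise_law)"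
proof -
  have [measurable]: "noise i \<in> borel_measurable M" using i by simp
  interpret D: prob_space "distr M (past i) (\<lambda>\<omega>. \<omega>)" by (rule prob_space_distr) measurable
  interpret N: prob_space noise_law by (rule prob_space_noise_law)
  interpret P: pair_sigma_finite "distr M (past i) (\<lambda>\<omega>. \<omega>)" noise_law by unfold_locales
  let ?H = "\<lambda>p. c (fst p) * g (snd p)"
  have "integrable (distr M (past i) (\<lambda>\<omega>. \<omega>) \<Otimes>\<^sub>M noise_law) ?H"
  proof (rule P.Fubini_integrable)
    show "integrable (distr M (past i) (\<lambda>\<omega>. \<omega>)) (\<lambda>\<omega>. \<integral>y. norm (?H (\<omega>, y)) \<partial>noise_law)"
      using ci by (simp add: abs_mult integrable_distr_eq)
  qed (use gi in \<open>auto simp: measurable_cong_sets[OF sets_pair_measure_cong[OF sets_distr sets_noise_law] refl]\<close>)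
  then show int: "integrable M (\<lambda>\<omega>. c \<omega> * g (noise i \<omega>))"
    unfolding joint_law[OF i] by (subst (asm) integrable_distr_eq) auto
  show "(\<integral>\<omega>. c \<omega> * g (noise i \<omega>) \<partial>M) = (\<integral>\<omega>. c \<omega> \<partial>M) * (\<integral>y. g y \<partial>noise_law)"
    using expectation_noise[OF i, of ?H] int by simp
qed

lemma integrable_noise_law_iff:
  "i \<ge> 1 \<Longrightarrow> g \<in> borel_measurable borel \<Longrightarrow> integrable noise_law g \<longleftrightarrow> integrable M (\<lambda>\<omega>. g (noise i \<omega>))"
  for g :: "real^2 \<Rightarrow> 'c::{banach, second_countable_topology}"
  unfolding noise_law[of i, symmetric] by (simp add: integrable_distr_eq)

lemma integral_noise_law:
  "i \<ge> 1 \<Longrightarrow> g \<in> borel_measurable borel \<Longrightarrow> (\<integral>y. g y \<partial>noise_law) = (\<integral>\<omega>. g (noise i \<omega>) \<partial>M)"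
  for g :: "real^2 \<Rightarrow> 'c::{banach, second_countable_topology}"
  unfolding noise_law[of i, symmetric] by (simp add: integral_distr)

text \<open>Evaluating the bivariate characteristic function on a coordinate axis removes the
  correlation term. The moments of each noise component then follow from those of the standard
  normal law.\<close>

lemma noise_component_law:
  "distr noise_law borel (\<lambda>y. y $ k) = distr std_normal_distribution borel (\<lambda>x. \<sigma> * x)"
proof (rule Levy_uniqueness)
  interpret N: prob_space noise_law by (rule prob_space_noise_law)
  interpret S: real_distribution std_normal_distribution by (rule real_dist_normal_dist)
  show "real_distribution (distr noise_law borel (\<lambda>y. y $ k))" by simp
  show "real_distribution (distr std_normal_distribution borel (\<lambda>x. \<sigma> * x))"
    by (rule S.real_distribution_distr) simp
  show "char (distr noise_law borel (\<lambda>y. y $ k)) = char (distr std_normal_distribution borel (\<lambda>x. \<sigma> * x))"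
  proof
    fix t :: real
    have "char (distr noise_law borel (\<lambda>y. y $ k)) t = fourier noise_law (axis k t)"
      unfolding char_def fourier_def
      by (simp add: integral_distr inner_axis' )
    also have "\<dots> = of_real (exp (- (\<sigma>\<^sup>2 * ((axis k t $ 1)\<^sup>2 + 2 * \<rho> * (axis k t $ 1) * (axis k t $ 2) + (axis k t $ 2)\<^sup>2)) / 2))"
      by (rule fourier_noise_law) (use sigma_pos rho_range in auto)
    also have "((axis k t $ 1)\<^sup>2 + 2 * \<rho> * (axis k t $ 1) * (axis k t $ 2) + (axis k t $ 2)\<^sup>2) = t\<^sup>2"
      using exhaust_2[of k] by (auto simp: axis_def)
    also have "of_real (exp (- (\<sigma>\<^sup>2 * t\<^sup>2) / 2)) = char std_normal_distribution (\<sigma> * t)"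
      by (simp add: char_std_normal_distribution power_mult_distrib)
    also have "\<dots> = char (distr std_normal_distribution borel (\<lambda>x. \<sigma> * x)) t"
      unfolding char_def by (subst integral_distr) (simp_all add: ac_simps)
    finally show "char (distr noise_law borel (\<lambda>y. y $ k)) t = char (distr std_normal_distribution borel (\<lambda>x. \<sigma> * x)) t" .
  qed
qed

lemma noise_moments:
  shows "integrable noise_law (\<lambda>y. (y $ k) ^ n)"
    and "(\<integral>y. y $ k \<partial>noise_law) = 0"
    and "(\<integral>y. (y $ k)\<^sup>2 \<partial>noise_law) = \<sigma>\<^sup>2"
proof -
  have tr: "(\<integral>y. g (y $ k) \<partial>noise_law) = (\<integral>x. g (\<sigma> * x) \<partial>std_normal_distribution)"
      "integrable noise_law (\<lambda>y. g (y $ k)) \<longleftrightarrow> integrable std_normal_distribution (\<lambda>x. g (\<sigma> * x))"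
    if [measurable]: "g \<in> borel_measurable borel" for g :: "real \<Rightarrow> real"
  proof -
    have "(\<integral>y. g (y $ k) \<partial>noise_law) = (\<integral>x. g x \<partial>distr noise_law borel (\<lambda>y. y $ k))"
      by (simp add: integral_distr)
    also have "\<dots> = (\<integral>x. g (\<sigma> * x) \<partial>std_normal_distribution)"
      unfolding noise_component_law by (simp add: integral_distr)
    finally show "(\<integral>y. g (y $ k) \<partial>noise_law) = (\<integral>x. g (\<sigma> * x) \<partial>std_normal_distribution)" .
    have "integrable noise_law (\<lambda>y. g (y $ k)) \<longleftrightarrow> integrable (distr noise_law borel (\<lambda>y. y $ k)) g"
      by (simp add: integrable_distr_eq)
    also have "\<dots> \<longleftrightarrow> integrable std_normal_distribution (\<lambda>x. g (\<sigma> * x))"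
      unfolding noise_component_law by (simp add: integrable_distr_eq)
    finally show "integrable noise_law (\<lambda>y. g (y $ k)) \<longleftrightarrow> integrable std_normal_distribution (\<lambda>x. g (\<sigma> * x))" .
  qed
  show "integrable noise_law (\<lambda>y. (y $ k) ^ n)"
    using integrable_std_normal_distribution_moment[of n]
    by (subst tr(2)) (simp_all only: power_mult_distrib integrable_mult_right, simp)
  show "(\<integral>y. y $ k \<partial>noise_law) = 0"
    using integral_std_normal_distribution_moment_odd[of 1]
    by (subst tr(1)[of "\<lambda>x. x"]) simp_all
  show "(\<integral>y. (y $ k)\<^sup>2 \<partial>noise_law) = \<sigma>\<^sup>2"
    using std_normal_distribution_even_moments(1)[of 1]
    by (subst tr(1)[of "\<lambda>x. x\<^sup>2"]) (simp_all only: power_mult_distrib integral_mult_right_zero, simp_all add: fact_numeral)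
qed

end

section \<open>Martingale averages and the law of large numbers on the tree\<close>

text \<open>Once the forcing term is small, the recursion is dominated by one with a small fixed
  point, which attracts at the geometric rate \<open>q\<close>.\<close>

lemma contraction_tendsto_zero:
  fixes a b :: "nat \<Rightarrow> real"
  assumes a: "\<And>n. 0 \<le> a n" and q: "0 \<le> q" "q < 1"
    and step: "\<And>n. a (Suc n) \<le> q * a n + b n" and b: "b \<longlonglongrightarrow> 0"
  shows "a \<longlonglongrightarrow> 0"
proof (rule LIMSEQ_I)
  fix e :: real assume e: "e > 0"
  \<comment> \<open>The threshold makes \<open>e / 2\<close> the fixed point of
    \<open>x \<mapsto> q x + e / 2 (1 - q)\<close>.\<close>
  then have "\<forall>\<^sub>F n in sequentially. b n < e / 2 * (1 - q)"
    using q by (intro order_tendstoD(2)[OF b]) auto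
  then obtain N where N: "\<And>n. n \<ge> N \<Longrightarrow> b n < e / 2 * (1 - q)"
    by (auto simp: eventually_sequentially)
  have *: "a (N + k) \<le> q ^ k * a N + e / 2" for k
  proof (induction k)
    case 0 then show ?case using e by simp
  next
    case (Suc k)
    have "a (N + Suc k) \<le> q * a (N + k) + b (N + k)" using step by simp
    also have "\<dots> \<le> q * (q ^ k * a N + e / 2) + e / 2 * (1 - q)"
      using N[of "N + k"] Suc q by (intro add_mono mult_left_mono) auto
    also have "\<dots> = q ^ Suc k * a N + e / 2" by (simp add: field_simps)
    finally show ?case .
  qed
  have "(\<lambda>k. q ^ k * a N) \<longlonglongrightarrow> 0 * a N"
    by (rule tendsto_mult[OF LIMSEQ_power_zero tendsto_const]) (use q in simp)
  then have "\<forall>\<^sub>F k in sequentially. q ^ k * a N < e / 2"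
    using e by (intro order_tendstoD(2)) auto
  then obtain K where K: "\<And>k. k \<ge> K \<Longrightarrow> q ^ k * a N < e / 2"
    by (auto simp: eventually_sequentially)
  show "\<exists>n0. \<forall>n\<ge>n0. norm (a n - 0) < e"
  proof (intro exI allI impI)
    fix n assume "n \<ge> N + K"
    then obtain k where k: "n = N + k" "k \<ge> K" using le_Suc_ex by (metis add_le_cancel_left le_add1 le_trans)
    show "norm (a n - 0) < e" using *[of k] K[OF k(2)] a[of n] k by simp
  qed
qed

section \<open>Tree sizes and the split of a tree sum into root and daughter pairs\<close>

lemma sum_daughters:
  fixes h :: "nat \<Rightarrow> 'b::comm_monoid_add"
  shows "(\<Sum>j = 1..2 * n + 1. h j) = h 1 + (\<Sum>i = 1..n. h (2 * i) + h (2 * i + 1))"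
  by (induction n) (simp_all add: add.assoc)

lemma card_tree_upto: "card (tree_upto r) = 2 ^ (r + 1) - 1"
  by (simp add: tree_upto_def)

lemma tree_upto_eq: "tree_upto r = {1..card (tree_upto r)}"
  unfolding card_tree_upto by (simp add: tree_upto_def)

lemma card_tree_upto_Suc: "card (tree_upto (Suc r)) = 2 * card (tree_upto r) + 1"
proof -
  have "(1::nat) \<le> 2 ^ (r + 1)" by simp
  moreover have "(2::nat) ^ (Suc r + 1) = 2 * 2 ^ (r + 1)" by simp
  ultimately show ?thesis unfolding card_tree_upto by linarith
qed

lemma card_tree_upto_ge: "card (tree_upto r) \<ge> r + 1"
proof (induction r)
  case 0 show ?case by (simp add: card_tree_upto)
next
  case (Suc r) then show ?case unfolding card_tree_upto_Suc by linarith
qed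

lemma card_tree_upto_pos: "real (card (tree_upto r)) > 0"
  using card_tree_upto_ge[of r] by simp

lemma filterlim_card_tree_upto: "filterlim (\<lambda>r. real (card (tree_upto r))) at_top sequentially"
proof (rule filterlim_at_top_mono[OF filterlim_real_sequentially])
  have "real r \<le> real (card (tree_upto r))" for r using card_tree_upto_ge[of r] by linarith
  then show "\<forall>\<^sub>F r in sequentially. real r \<le> real (card (tree_upto r))" by (intro always_eventually allI)
qed

lemma tree_sum_daughters:
  fixes h :: "nat \<Rightarrow> 'b::comm_monoid_add"
  shows "(\<Sum>j\<in>tree_upto (Suc r). h j) = h 1 + (\<Sum>i\<in>tree_upto r. h (2 * i) + h (2 * i + 1))"
proof -
  have "tree_upto (Suc r) = {1..2 * card (tree_upto r) + 1}"
    using tree_upto_eq[of "Suc r"] by (simp only: card_tree_upto_Suc)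
  then show ?thesis
    using sum_daughters[of h "card (tree_upto r)"] by (simp only: tree_upto_eq[symmetric])
qed

context bar_model
begin

text \<open>Orthogonality of increments: the partial sum times the next weight is measurable for the
  past, and the next noise factor is centred. The three claims share one induction because the
  vanishing of the cross term rests on measurability and square integrability of the partial
  sum.\<close>

lemma martingale_square:
  fixes c :: "nat \<Rightarrow> 'a \<Rightarrow> real" and g :: "nat \<Rightarrow> real^2 \<Rightarrow> real"
  assumes c: "\<And>i. i \<ge> 1 \<Longrightarrow> c i \<in> borel_measurable (past i)" "\<And>i. i \<ge> 1 \<Longrightarrow> integrable M (\<lambda>\<omega>. (c i \<omega>)\<^sup>2)"
    and g: "\<And>i. g i \<in> borel_measurable borel" "\<And>i. integrable noise_law (\<lambda>y. (g i y)\<^sup>2)"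
      "\<And>i. (\<integral>y. g i y \<partial>noise_law) = 0"
  shows "(\<lambda>\<omega>. \<Sum>i = 1..n. c i \<omega> * g i (noise i \<omega>)) \<in> borel_measurable (past (Suc n))"
    and "integrable M (\<lambda>\<omega>. (\<Sum>i = 1..n. c i \<omega> * g i (noise i \<omega>))\<^sup>2)"
    and "(\<integral>\<omega>. (\<Sum>i = 1..n. c i \<omega> * g i (noise i \<omega>))\<^sup>2 \<partial>M) =
      (\<Sum>i = 1..n. (\<integral>\<omega>. (c i \<omega>)\<^sup>2 \<partial>M) * (\<integral>y. (g i y)\<^sup>2 \<partial>noise_law))"
proof (induction n)
  case 0
  { case 1 show ?case by simp }
  { case 2 show ?case by simp }
  { case 3 show ?case by simp }
next
  case (Suc n)
  interpret N: prob_space noise_law by (rule prob_space_noise_law)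
  define S where "S \<omega> = (\<Sum>i = 1..n. c i \<omega> * g i (noise i \<omega>))" for \<omega>
  note [measurable] = g(1)
  have split: "(\<Sum>i = 1..Suc n. c i \<omega> * g i (noise i \<omega>)) = S \<omega> + c (Suc n) \<omega> * g (Suc n) (noise (Suc n) \<omega>)" for \<omega>
    by (simp add: S_def)
  have IH: "S \<in> borel_measurable (past (Suc n))" "integrable M (\<lambda>\<omega>. (S \<omega>)\<^sup>2)"
     "(\<integral>\<omega>. (S \<omega>)\<^sup>2 \<partial>M) = (\<Sum>i = 1..n. (\<integral>\<omega>. (c i \<omega>)\<^sup>2 \<partial>M) * (\<integral>y. (g i y)\<^sup>2 \<partial>noise_law))"
    using Suc unfolding S_def[abs_def] by auto
  have [measurable]: "S \<in> borel_measurable M" using IH(1) by (rule measurable_past)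
  have cm [measurable]: "c (Suc n) \<in> borel_measurable M" using c(1)[of "Suc n"] by (auto intro: measurable_past)
  { case 1
    have 1: "S \<in> borel_measurable (past (Suc (Suc n)))" using IH(1) by (rule measurable_past_mono) simp
    have 2: "c (Suc n) \<in> borel_measurable (past (Suc (Suc n)))"
      by (rule measurable_past_mono[OF c(1)]) auto
    have 3: "noise (Suc n) \<in> borel_measurable (past (Suc (Suc n)))" by (rule noise_past) auto
    note [measurable] = 1 2 3
    show ?case unfolding split by measurable }
  have gi: "integrable noise_law (g (Suc n))"
    by (rule N.square_integrable_imp_integrable) (use g in auto)
  have Sc: "integrable M (\<lambda>\<omega>. S \<omega> * c (Suc n) \<omega>)"
    by (rule sq_integrable_mult) (use IH c in auto)
  have cr: "integrable M (\<lambda>\<omega>. (S \<omega> * c (Suc n) \<omega>) * g (Suc n) (noise (Suc n) \<omega>))"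
      "(\<integral>\<omega>. (S \<omega> * c (Suc n) \<omega>) * g (Suc n) (noise (Suc n) \<omega>) \<partial>M) = 0"
    using past_noise_mult[of "Suc n" "\<lambda>\<omega>. S \<omega> * c (Suc n) \<omega>" "g (Suc n)"] Sc IH(1) c(1)[of "Suc n"] g gi by auto
  have sq: "integrable M (\<lambda>\<omega>. (c (Suc n) \<omega>)\<^sup>2 * (g (Suc n) (noise (Suc n) \<omega>))\<^sup>2)"
      "(\<integral>\<omega>. (c (Suc n) \<omega>)\<^sup>2 * (g (Suc n) (noise (Suc n) \<omega>))\<^sup>2 \<partial>M) =
        (\<integral>\<omega>. (c (Suc n) \<omega>)\<^sup>2 \<partial>M) * (\<integral>y. (g (Suc n) y)\<^sup>2 \<partial>noise_law)"
    using past_noise_mult[of "Suc n" "\<lambda>\<omega>. (c (Suc n) \<omega>)\<^sup>2" "\<lambda>y. (g (Suc n) y)\<^sup>2"] c[of "Suc n"] g by auto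
  have expand: "(S \<omega> + c (Suc n) \<omega> * g (Suc n) (noise (Suc n) \<omega>))\<^sup>2 = (S \<omega>)\<^sup>2 +
      2 * ((S \<omega> * c (Suc n) \<omega>) * g (Suc n) (noise (Suc n) \<omega>)) + (c (Suc n) \<omega>)\<^sup>2 * (g (Suc n) (noise (Suc n) \<omega>))\<^sup>2" for \<omega>
    by (simp add: power2_eq_square algebra_simps)
  { case 2 show ?case unfolding split expand using IH cr sq by auto }
  { case 3 show ?case unfolding split expand using IH cr sq by simp }
qed

text \<open>The arithmetic-geometric inequality with a free scale \<open>a\<close> takes the place
  of Cauchy-Schwarz; choosing \<open>a\<close> of the order of the \<open>L^2\<close> norm loses
  only a constant.\<close>

lemma expectation_abs_le:
  fixes Z :: "'a \<Rightarrow> real"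
  assumes [measurable]: "Z \<in> borel_measurable M" and Z: "integrable M (\<lambda>\<omega>. (Z \<omega>)\<^sup>2)" and a: "a > 0"
  shows "integrable M Z" and "(\<integral>\<omega>. \<bar>Z \<omega>\<bar> \<partial>M) \<le> (a + (\<integral>\<omega>. (Z \<omega>)\<^sup>2 \<partial>M) / a) / 2"
proof -
  show Zi: "integrable M Z" by (rule square_integrable_imp_integrable[OF _ Z]) simp
  have "(\<integral>\<omega>. \<bar>Z \<omega>\<bar> \<partial>M) \<le> (\<integral>\<omega>. (a + (Z \<omega>)\<^sup>2 / a) / 2 \<partial>M)"
  proof (rule Bochner_Integration.integral_mono)
    fix \<omega>
    have "0 \<le> (a - \<bar>Z \<omega>\<bar>)\<^sup>2" by simp
    then have "2 * a * \<bar>Z \<omega>\<bar> \<le> a\<^sup>2 + (Z \<omega>)\<^sup>2" by (simp add: power2_diff)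
    with a show "\<bar>Z \<omega>\<bar> \<le> (a + (Z \<omega>)\<^sup>2 / a) / 2" by (simp add: field_simps power2_eq_square)
  qed (use Zi Z in auto)
  also have "\<dots> = (a + (\<integral>\<omega>. (Z \<omega>)\<^sup>2 \<partial>M) / a) / 2" using Z by (simp add: prob_space)
  finally show "(\<integral>\<omega>. \<bar>Z \<omega>\<bar> \<partial>M) \<le> (a + (\<integral>\<omega>. (Z \<omega>)\<^sup>2 \<partial>M) / a) / 2" .
qed

text \<open>By orthogonality the second moment of the sum grows at most linearly in the tree size
  \<open>N\<close>. With the scale \<open>a = sqrt N\<close> its \<open>L^1\<close> norm is of order
  \<open>sqrt N\<close>, which division by \<open>N\<close> sends to zero.\<close>

lemma martingale_mean_tendsto:
  fixes c :: "nat \<Rightarrow> 'a \<Rightarrow> real" and g :: "nat \<Rightarrow> real^2 \<Rightarrow> real"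
  assumes c: "\<And>i. i \<ge> 1 \<Longrightarrow> c i \<in> borel_measurable (past i)" "\<And>i. i \<ge> 1 \<Longrightarrow> integrable M (\<lambda>\<omega>. (c i \<omega>)\<^sup>2)"
    and g: "\<And>i. g i \<in> borel_measurable borel" "\<And>i. integrable noise_law (\<lambda>y. (g i y)\<^sup>2)"
      "\<And>i. (\<integral>y. g i y \<partial>noise_law) = 0"
    and C: "\<And>i. i \<ge> 1 \<Longrightarrow> (\<integral>\<omega>. (c i \<omega>)\<^sup>2 \<partial>M) \<le> C" and V: "\<And>i. (\<integral>y. (g i y)\<^sup>2 \<partial>noise_law) \<le> V"
  shows "integrable M (\<lambda>\<omega>. \<Sum>i\<in>tree_upto r. c i \<omega> * g i (noise i \<omega>))"
    and "(\<lambda>r. (\<integral>\<omega>. \<bar>\<Sum>i\<in>tree_upto r. c i \<omega> * g i (noise i \<omega>)\<bar> \<partial>M) / real (card (tree_upto r))) \<longlonglongrightarrow> 0"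
proof -
  let ?S = "\<lambda>r \<omega>. \<Sum>i\<in>tree_upto r. c i \<omega> * g i (noise i \<omega>)"
  let ?N = "\<lambda>r. real (card (tree_upto r))"
  have m: "?S r \<in> borel_measurable M" and i: "integrable M (\<lambda>\<omega>. (?S r \<omega>)\<^sup>2)"
    and e: "(\<integral>\<omega>. (?S r \<omega>)\<^sup>2 \<partial>M) = (\<Sum>i\<in>tree_upto r. (\<integral>\<omega>. (c i \<omega>)\<^sup>2 \<partial>M) * (\<integral>y. (g i y)\<^sup>2 \<partial>noise_law))" for r
    using martingale_square[of c g "card (tree_upto r)", OF c g] measurable_past
    unfolding tree_upto_eq[symmetric] by blast+
  have e2: "(\<integral>\<omega>. (?S r \<omega>)\<^sup>2 \<partial>M) \<le> ?N r * (C * V)" for r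
    unfolding e
  proof (rule sum_bounded_above[of "tree_upto r" _ "C * V", simplified])
    fix i assume "i \<in> tree_upto r"
    then have "i \<ge> 1" by (simp add: tree_upto_def)
    moreover have "0 \<le> (\<integral>\<omega>. (c i \<omega>)\<^sup>2 \<partial>M)" "0 \<le> (\<integral>y. (g i y)\<^sup>2 \<partial>noise_law)" by simp_all
    ultimately show "(\<integral>\<omega>. (c i \<omega>)\<^sup>2 \<partial>M) * (\<integral>y. (g i y)\<^sup>2 \<partial>noise_law) \<le> C * V"
      using C[of i] V[of i] by (intro mult_mono) linarith+
  qed
  show "integrable M (?S r)" by (rule expectation_abs_le(1)[OF m i, of 1]) simp
  have bound: "(\<integral>\<omega>. \<bar>?S r \<omega>\<bar> \<partial>M) / ?N r \<le> (1 + C * V) / 2 / sqrt (?N r)" for r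
  proof -
    have s: "sqrt (?N r) > 0" "sqrt (?N r) * sqrt (?N r) = ?N r" using card_tree_upto_pos[of r] by simp_all
    have "(\<integral>\<omega>. \<bar>?S r \<omega>\<bar> \<partial>M) \<le> (sqrt (?N r) + (\<integral>\<omega>. (?S r \<omega>)\<^sup>2 \<partial>M) / sqrt (?N r)) / 2"
      by (rule expectation_abs_le(2)[OF m i]) (rule s)
    also have "\<dots> \<le> (sqrt (?N r) + (?N r * (C * V)) / sqrt (?N r)) / 2"
      using e2[of r] s by (intro divide_right_mono add_left_mono) auto
    also have "(?N r * (C * V)) / sqrt (?N r) = sqrt (?N r) * (C * V)"
      using s by (simp add: field_simps)
    finally have "(\<integral>\<omega>. \<bar>?S r \<omega>\<bar> \<partial>M) / ?N r \<le> ((sqrt (?N r) + sqrt (?N r) * (C * V)) / 2) / ?N r"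
      using s by (intro divide_right_mono) auto
    also have "\<dots> = (1 + C * V) / 2 / sqrt (?N r)"
    proof -
      have "((sqrt (?N r) + sqrt (?N r) * (C * V)) / 2) / (sqrt (?N r) * sqrt (?N r)) = (1 + C * V) / 2 / sqrt (?N r)"
        using s(1) by (simp add: field_simps)
      then show ?thesis unfolding s(2) .
    qed
    finally show ?thesis .
  qed
  show "(\<lambda>r. (\<integral>\<omega>. \<bar>?S r \<omega>\<bar> \<partial>M) / ?N r) \<longlonglongrightarrow> 0"
  proof (rule tendsto_sandwich[OF _ _ tendsto_const])
    show "(\<lambda>r. (1 + C * V) / 2 / sqrt (?N r)) \<longlonglongrightarrow> 0"
      by (rule tendsto_divide_0[OF tendsto_const])
         (rule filterlim_at_top_imp_at_infinity, rule filterlim_compose[OF sqrt_at_top filterlim_card_tree_upto])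
    show "\<forall>\<^sub>F r in sequentially. 0 \<le> (\<integral>\<omega>. \<bar>?S r \<omega>\<bar> \<partial>M) / ?N r"
      by (intro always_eventually allI divide_nonneg_nonneg integral_nonneg_AE) auto
    show "\<forall>\<^sub>F r in sequentially. (\<integral>\<omega>. \<bar>?S r \<omega>\<bar> \<partial>M) / ?N r \<le> (1 + C * V) / 2 / sqrt (?N r)"
      using bound by (intro always_eventually allI)
  qed
qed

section \<open>Second moments bounded uniformly along the tree\<close>

lemma drift_square_le: "(drift j x)\<^sup>2 \<le> contr * x\<^sup>2 + (\<beta>\<^sub>0\<^sup>2 + \<beta>\<^sub>1\<^sup>2) / (1 - contr)"
proof -
  have "(\<alpha>\<^sub>0 * x + \<beta>\<^sub>0)\<^sup>2 \<le> contr * x\<^sup>2 + \<beta>\<^sub>0\<^sup>2 / (1 - contr)" "(\<alpha>\<^sub>1 * x + \<beta>\<^sub>1)\<^sup>2 \<le> contr * x\<^sup>2 + \<beta>\<^sub>1\<^sup>2 / (1 - contr)"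
    using contr by (auto intro: affine_square_le)
  moreover have "0 \<le> \<beta>\<^sub>0\<^sup>2 / (1 - contr)" "0 \<le> \<beta>\<^sub>1\<^sup>2 / (1 - contr)" using contr by auto
  ultimately show ?thesis unfolding drift_def add_divide_distrib by auto
qed

lemma drift_square:
  assumes [measurable]: "Y \<in> borel_measurable M" and Y: "integrable M (\<lambda>\<omega>. (Y \<omega>)\<^sup>2)"
  shows "integrable M (\<lambda>\<omega>. (drift j (Y \<omega>))\<^sup>2)"
    and "(\<integral>\<omega>. (drift j (Y \<omega>))\<^sup>2 \<partial>M) \<le> contr * (\<integral>\<omega>. (Y \<omega>)\<^sup>2 \<partial>M) + (\<beta>\<^sub>0\<^sup>2 + \<beta>\<^sub>1\<^sup>2) / (1 - contr)"
proof -
  let ?g = "\<lambda>\<omega>. contr * (Y \<omega>)\<^sup>2 + (\<beta>\<^sub>0\<^sup>2 + \<beta>\<^sub>1\<^sup>2) / (1 - contr)"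
  have g: "integrable M ?g" using Y by simp
  show d: "integrable M (\<lambda>\<omega>. (drift j (Y \<omega>))\<^sup>2)"
  proof (rule Bochner_Integration.integrable_bound[OF g])
    show "AE \<omega> in M. norm ((drift j (Y \<omega>))\<^sup>2) \<le> norm (?g \<omega>)"
      using order_trans[OF drift_square_le[of j] abs_ge_self] by (intro always_eventually allI) simp
  qed measurable
  have "(\<integral>\<omega>. (drift j (Y \<omega>))\<^sup>2 \<partial>M) \<le> (\<integral>\<omega>. ?g \<omega> \<partial>M)"
    by (rule Bochner_Integration.integral_mono[OF d g]) (rule drift_square_le)
  also have "\<dots> = contr * (\<integral>\<omega>. (Y \<omega>)\<^sup>2 \<partial>M) + (\<beta>\<^sub>0\<^sup>2 + \<beta>\<^sub>1\<^sup>2) / (1 - contr)"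
    using Y by (simp add: prob_space)
  finally show "(\<integral>\<omega>. (drift j (Y \<omega>))\<^sup>2 \<partial>M) \<le> contr * (\<integral>\<omega>. (Y \<omega>)\<^sup>2 \<partial>M) + (\<beta>\<^sub>0\<^sup>2 + \<beta>\<^sub>1\<^sup>2) / (1 - contr)" .
qed

text \<open>The second entry is the fixed point of the one-step bound, so any value at or above it
  is preserved from parent to daughter; the maximum also covers the ancestor.\<close>

definition second_moment_bound :: real where
  "second_moment_bound = max (\<integral>\<omega>. (X 1 \<omega>)\<^sup>2 \<partial>M) (((\<beta>\<^sub>0\<^sup>2 + \<beta>\<^sub>1\<^sup>2) / (1 - contr) + \<sigma>\<^sup>2) / (1 - contr))"

lemma X_square:
  assumes X1: "integrable M (\<lambda>\<omega>. (X 1 \<omega>)\<^sup>2)" and j: "j \<ge> 1"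
  shows "integrable M (\<lambda>\<omega>. (X j \<omega>)\<^sup>2) \<and> (\<integral>\<omega>. (X j \<omega>)\<^sup>2 \<partial>M) \<le> second_moment_bound"
  using j
proof (induction j rule: less_induct)
  case (less j)
  show ?case
  proof (cases "j = 1")
    case True with X1 show ?thesis by (simp add: second_moment_bound_def)
  next
    case False
    with less.prems have j: "j \<ge> 2" by simp
    let ?p = "j div 2"
    let ?K = "(\<beta>\<^sub>0\<^sup>2 + \<beta>\<^sub>1\<^sup>2) / (1 - contr)"
    have p: "?p \<ge> 1" "?p < j" using j by auto
    from less.IH[OF p(2,1)] have IH: "integrable M (\<lambda>\<omega>. (X ?p \<omega>)\<^sup>2)" "(\<integral>\<omega>. (X ?p \<omega>)\<^sup>2 \<partial>M) \<le> second_moment_bound" by auto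
    interpret N: prob_space noise_law by (rule prob_space_noise_law)
    have Xm: "X ?p \<in> borel_measurable (past ?p)" by (rule X_past) (use p in auto)
    have [measurable]: "X ?p \<in> borel_measurable M" using p by simp
    have d2: "integrable M (\<lambda>\<omega>. (drift j (X ?p \<omega>))\<^sup>2)"
      by (rule drift_square(1)[OF _ IH(1)]) measurable
    have d1: "integrable M (\<lambda>\<omega>. drift j (X ?p \<omega>))"
      by (rule square_integrable_imp_integrable[OF _ d2]) measurable
    have dm: "(\<lambda>\<omega>. drift j (X ?p \<omega>)) \<in> borel_measurable (past ?p)"
      using Xm by measurable
    have y1: "integrable noise_law (\<lambda>y. y $ k)" for k using noise_moments(1)[of k 1] by simp
    have cr: "integrable M (\<lambda>\<omega>. drift j (X ?p \<omega>) * noise ?p \<omega> $ component j)"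
       "(\<integral>\<omega>. drift j (X ?p \<omega>) * noise ?p \<omega> $ component j \<partial>M) = 0"
      using past_noise_mult[OF p(1) dm d1 _ y1[of "component j"]] noise_moments(2) by auto
    have e2: "integrable M (\<lambda>\<omega>. (noise ?p \<omega> $ component j)\<^sup>2)" "(\<integral>\<omega>. (noise ?p \<omega> $ component j)\<^sup>2 \<partial>M) = \<sigma>\<^sup>2"
      using noise_moments(1)[of "component j" 2] noise_moments(3)[of "component j"]
        integrable_noise_law_iff[OF p(1), of "\<lambda>y. (y $ component j)\<^sup>2"]
        integral_noise_law[OF p(1), of "\<lambda>y. (y $ component j)\<^sup>2"] by auto
    let ?f = "\<lambda>\<omega>. (drift j (X ?p \<omega>))\<^sup>2 + 2 * (drift j (X ?p \<omega>) * noise ?p \<omega> $ component j) + (noise ?p \<omega> $ component j)\<^sup>2"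
    have eq: "(X j \<omega>)\<^sup>2 = ?f \<omega>" if "\<omega> \<in> space M" for \<omega>
      using X_step[OF j that] eps_noise[OF j, of \<omega>] by (simp add: power2_eq_square algebra_simps)
    have fi: "integrable M ?f" using d2 cr e2 by simp
    have "integrable M (\<lambda>\<omega>. (X j \<omega>)\<^sup>2)"
      by (rule Bochner_Integration.integrable_cong[THEN iffD2, OF refl _ fi]) (rule eq)
    moreover have "(\<integral>\<omega>. (X j \<omega>)\<^sup>2 \<partial>M) \<le> second_moment_bound"
    proof -
      have "(\<integral>\<omega>. (X j \<omega>)\<^sup>2 \<partial>M) = (\<integral>\<omega>. ?f \<omega> \<partial>M)"
        by (rule Bochner_Integration.integral_cong) (auto simp: eq)
      also have "\<dots> = (\<integral>\<omega>. (drift j (X ?p \<omega>))\<^sup>2 \<partial>M) + \<sigma>\<^sup>2" using d2 cr e2 by simp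
      also have "(\<integral>\<omega>. (drift j (X ?p \<omega>))\<^sup>2 \<partial>M) \<le> contr * (\<integral>\<omega>. (X ?p \<omega>)\<^sup>2 \<partial>M) + ?K"
        by (rule drift_square(2)[OF _ IH(1)]) measurable
      also have "\<dots> \<le> contr * second_moment_bound + ?K" using IH contr by (intro add_right_mono mult_left_mono) auto
      finally have 1: "(\<integral>\<omega>. (X j \<omega>)\<^sup>2 \<partial>M) \<le> contr * second_moment_bound + (?K + \<sigma>\<^sup>2)" by simp
      have "(?K + \<sigma>\<^sup>2) / (1 - contr) \<le> second_moment_bound" by (simp add: second_moment_bound_def)
      then have "?K + \<sigma>\<^sup>2 \<le> (1 - contr) * second_moment_bound" using contr by (simp add: divide_le_eq mult.commute)
      with 1 show ?thesis by (simp add: algebra_simps)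
    qed
    ultimately show ?thesis by blast
  qed
qed

end

locale bar_model_sq = bar_model +
  assumes X1_square: "integrable M (\<lambda>\<omega>. (X 1 \<omega>)\<^sup>2)"
begin

abbreviation \<mu>1 :: real where "\<mu>1 \<equiv> bar_mu1 \<alpha>\<^sub>0 \<beta>\<^sub>0 \<alpha>\<^sub>1 \<beta>\<^sub>1"
abbreviation \<mu>2 :: real where "\<mu>2 \<equiv> bar_mu2 \<alpha>\<^sub>0 \<beta>\<^sub>0 \<alpha>\<^sub>1 \<beta>\<^sub>1 \<sigma>"

abbreviation tsize :: "nat \<Rightarrow> real" where "tsize r \<equiv> real (card (tree_upto r))"
abbreviation mean1 :: "nat \<Rightarrow> 'a \<Rightarrow> real" where "mean1 r \<omega> \<equiv> tree_mean r (\<lambda>i. X i \<omega>)"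
abbreviation mean2 :: "nat \<Rightarrow> 'a \<Rightarrow> real" where "mean2 r \<omega> \<equiv> tree_mean r (\<lambda>i. (X i \<omega>)\<^sup>2)"

text \<open>From here on the closed forms act only through this equation and
  \<open>\<mu>2_fixpoint\<close>. Centring the recursions for tree averages at these values cancels
  their constant terms.\<close>

lemma \<mu>1_fixpoint: "\<mu>1 = (\<alpha>\<^sub>0 + \<alpha>\<^sub>1) / 2 * \<mu>1 + (\<beta>\<^sub>0 + \<beta>\<^sub>1) / 2"
proof -
  have "1 - (\<alpha>\<^sub>0 + \<alpha>\<^sub>1) / 2 \<noteq> 0" using a0 a1 by auto
  then have "\<mu>1 * (1 - (\<alpha>\<^sub>0 + \<alpha>\<^sub>1) / 2) = (\<beta>\<^sub>0 + \<beta>\<^sub>1) / 2"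
    unfolding bar_mu1_def by (rule nonzero_eq_divide_eq[THEN iffD1, OF _ refl])
  then show ?thesis by (simp add: field_simps)
qed

lemma \<mu>2_fixpoint:
  "\<mu>2 = (\<alpha>\<^sub>0\<^sup>2 + \<alpha>\<^sub>1\<^sup>2) / 2 * \<mu>2 + (\<alpha>\<^sub>0 * \<beta>\<^sub>0 + \<alpha>\<^sub>1 * \<beta>\<^sub>1) * \<mu>1 + (\<beta>\<^sub>0\<^sup>2 + \<beta>\<^sub>1\<^sup>2) / 2 + \<sigma>\<^sup>2"
proof -
  have "\<alpha>\<^sub>0\<^sup>2 < 1" "\<alpha>\<^sub>1\<^sup>2 < 1" using a0 a1 by (auto simp: abs_square_less_1)
  then have "1 - (\<alpha>\<^sub>0\<^sup>2 + \<alpha>\<^sub>1\<^sup>2) / 2 \<noteq> 0" by auto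
  then have "\<mu>2 * (1 - (\<alpha>\<^sub>0\<^sup>2 + \<alpha>\<^sub>1\<^sup>2) / 2) = 2 * ((\<alpha>\<^sub>0 * \<beta>\<^sub>0 + \<alpha>\<^sub>1 * \<beta>\<^sub>1) / 2) * ((\<beta>\<^sub>0 + \<beta>\<^sub>1) / 2) / (1 - (\<alpha>\<^sub>0 + \<alpha>\<^sub>1) / 2)
        + (\<beta>\<^sub>0\<^sup>2 + \<beta>\<^sub>1\<^sup>2) / 2 + \<sigma>\<^sup>2"
    unfolding bar_mu2_def by (rule nonzero_eq_divide_eq[THEN iffD1, OF _ refl])
  also have "\<dots> = (\<alpha>\<^sub>0 * \<beta>\<^sub>0 + \<alpha>\<^sub>1 * \<beta>\<^sub>1) * \<mu>1 + (\<beta>\<^sub>0\<^sup>2 + \<beta>\<^sub>1\<^sup>2) / 2 + \<sigma>\<^sup>2"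
  proof -
    have "2 * (x / 2) * y / z = x * (y / z)" for x y z :: real by simp
    then show ?thesis unfolding bar_mu1_def by (simp only:)
  qed
  finally show ?thesis by (simp add: algebra_simps)
qed

lemma X_sq: "j \<ge> 1 \<Longrightarrow> integrable M (\<lambda>\<omega>. (X j \<omega>)\<^sup>2)" "j \<ge> 1 \<Longrightarrow> (\<integral>\<omega>. (X j \<omega>)\<^sup>2 \<partial>M) \<le> second_moment_bound"
  using X_square[OF X1_square] by auto

lemma X_int: "j \<ge> 1 \<Longrightarrow> integrable M (X j)"
  by (rule square_integrable_imp_integrable[OF _ X_sq(1)]) auto

lemma tsize_pos [simp]: "tsize r > 0" by (rule card_tree_upto_pos)

lemma tree_mean_mult: "tsize r * tree_mean r h = (\<Sum>i\<in>tree_upto r. h i)"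
  using tsize_pos[of r] unfolding tree_mean_def by (simp del: tsize_pos)

lemma tree_upto_ge: "i \<in> tree_upto r \<Longrightarrow> 1 \<le> i" by (simp add: tree_upto_def)

lemma mean1_measurable [measurable]: "mean1 r \<in> borel_measurable M"
  unfolding tree_mean_def by (intro borel_measurable_divide borel_measurable_sum borel_measurable_const X_measurable tree_upto_ge)

lemma mean2_measurable [measurable]: "mean2 r \<in> borel_measurable M"
  unfolding tree_mean_def by (intro borel_measurable_divide borel_measurable_sum borel_measurable_const borel_measurable_power X_measurable tree_upto_ge)

lemma mean1_int: "integrable M (mean1 r)"
  unfolding tree_mean_def by (intro integrable_divide Bochner_Integration.integrable_sum X_int tree_upto_ge)

lemma mean2_int: "integrable M (mean2 r)"
  unfolding tree_mean_def by (intro integrable_divide Bochner_Integration.integrable_sum X_sq tree_upto_ge)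

lemma tsize_Suc: "tsize (Suc r) = 2 * tsize r + 1"
  by (simp add: card_tree_upto_Suc)

lemma const_over_tsize: "(\<lambda>r. c / tsize r) \<longlonglongrightarrow> 0"
  by (rule tendsto_divide_0[OF tendsto_const])
     (rule filterlim_at_top_imp_at_infinity, rule filterlim_card_tree_upto)

text \<open>The larger tree has \<open>2 N + 1\<close> vertices, the recursion speaks of
  \<open>2 N\<close>. Dropping the extra \<open>\<bar>y\<bar>\<close> on the left costs nothing, and
  the factor 1/2 on the error is given away.\<close>

lemma mean_step_bound:
  assumes "tsize (Suc r) * y = 2 * tsize r * x + z"
  shows "\<bar>y\<bar> \<le> \<bar>x\<bar> + \<bar>z\<bar> / tsize r"
proof -
  have "tsize (Suc r) * \<bar>y\<bar> = \<bar>2 * tsize r * x + z\<bar>" unfolding assms[symmetric] by (simp add: abs_mult)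
  also have "\<dots> \<le> 2 * tsize r * \<bar>x\<bar> + \<bar>z\<bar>" by (rule order_trans[OF abs_triangle_ineq]) (simp add: abs_mult)
  finally have 1: "(2 * tsize r + 1) * \<bar>y\<bar> \<le> 2 * tsize r * \<bar>x\<bar> + \<bar>z\<bar>" unfolding tsize_Suc .
  have "0 \<le> tsize r * \<bar>y\<bar>" by simp
  with 1 have "tsize r * \<bar>y\<bar> \<le> tsize r * \<bar>x\<bar> + \<bar>z\<bar>"
    using abs_ge_zero[of y] abs_ge_zero[of z] by (simp only: distrib_right mult_1_left mult.assoc)
  then have "tsize r * \<bar>y\<bar> / tsize r \<le> (tsize r * \<bar>x\<bar> + \<bar>z\<bar>) / tsize r"
    by (intro divide_right_mono) auto
  then show ?thesis using tsize_pos[of r] by (simp add: add_divide_distrib del: tsize_pos)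
qed

text \<open>This and the next two are the martingales left over when the recursions for
  \<open>X\<close> and \<open>X^2\<close> are summed: the noise itself, the noise times the mean of
  its daughter, and the centred squares of the noise.\<close>

definition noise_sum :: "2 \<Rightarrow> nat \<Rightarrow> 'a \<Rightarrow> real" where
  "noise_sum k r \<omega> = (\<Sum>i\<in>tree_upto r. noise i \<omega> $ k)"

definition cross_sum :: "nat \<Rightarrow> 2 \<Rightarrow> nat \<Rightarrow> 'a \<Rightarrow> real" where
  "cross_sum e k r \<omega> = (\<Sum>i\<in>tree_upto r. drift e (X i \<omega>) * noise i \<omega> $ k)"

definition square_sum :: "2 \<Rightarrow> nat \<Rightarrow> 'a \<Rightarrow> real" where
  "square_sum k r \<omega> = (\<Sum>i\<in>tree_upto r. (noise i \<omega> $ k)\<^sup>2 - \<sigma>\<^sup>2)"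

lemma noise_sum:
  "integrable M (noise_sum k r)" "(\<lambda>r. (\<integral>\<omega>. \<bar>noise_sum k r \<omega>\<bar> \<partial>M) / tsize r) \<longlonglongrightarrow> 0"
  using martingale_mean_tendsto[of "\<lambda>_ _. 1" "\<lambda>_ y. y $ k" 1 "\<sigma>\<^sup>2"] noise_moments(1)[of k 2] noise_moments(2,3)[of k]
  by (simp_all add: noise_sum_def[abs_def] prob_space)

lemma cross_sum:
  "integrable M (cross_sum e k r)" "(\<lambda>r. (\<integral>\<omega>. \<bar>cross_sum e k r \<omega>\<bar> \<partial>M) / tsize r) \<longlonglongrightarrow> 0"
proof -
  let ?K = "(\<beta>\<^sub>0\<^sup>2 + \<beta>\<^sub>1\<^sup>2) / (1 - contr)"
  have m: "(\<lambda>\<omega>. drift e (X i \<omega>)) \<in> borel_measurable (past i)" if "i \<ge> 1" for i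
    using X_past[OF that order_refl] by measurable
  have i2: "integrable M (\<lambda>\<omega>. (drift e (X i \<omega>))\<^sup>2)" if "i \<ge> 1" for i
    by (rule drift_square(1)[OF X_measurable[OF that] X_sq(1)[OF that]])
  have b: "(\<integral>\<omega>. (drift e (X i \<omega>))\<^sup>2 \<partial>M) \<le> contr * second_moment_bound + ?K" if "i \<ge> 1" for i
  proof -
    have "(\<integral>\<omega>. (drift e (X i \<omega>))\<^sup>2 \<partial>M) \<le> contr * (\<integral>\<omega>. (X i \<omega>)\<^sup>2 \<partial>M) + ?K"
      by (rule drift_square(2)[OF X_measurable[OF that] X_sq(1)[OF that]])
    also have "\<dots> \<le> contr * second_moment_bound + ?K"
      using X_sq(2)[OF that] contr by (intro add_right_mono mult_left_mono) auto
    finally show ?thesis .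
  qed
  show "integrable M (cross_sum e k r)" "(\<lambda>r. (\<integral>\<omega>. \<bar>cross_sum e k r \<omega>\<bar> \<partial>M) / tsize r) \<longlonglongrightarrow> 0"
    using martingale_mean_tendsto[of "\<lambda>i \<omega>. drift e (X i \<omega>)" "\<lambda>_ y. y $ k" _ "\<sigma>\<^sup>2", OF m i2 _ _ _ b]
      noise_moments(1)[of k 2] noise_moments(2,3)[of k]
    by (simp_all add: cross_sum_def[abs_def])
qed

text \<open>Here the increments are squares, so their variance calls for the fourth moment of the
  noise.\<close>

lemma square_sum:
  "integrable M (square_sum k r)" "(\<lambda>r. (\<integral>\<omega>. \<bar>square_sum k r \<omega>\<bar> \<partial>M) / tsize r) \<longlonglongrightarrow> 0"
proof -
  interpret N: prob_space noise_law by (rule prob_space_noise_law)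
  have "(\<lambda>y::real^2. ((y $ k)\<^sup>2 - \<sigma>\<^sup>2)\<^sup>2) = (\<lambda>y. (y $ k) ^ 4 - 2 * \<sigma>\<^sup>2 * (y $ k)\<^sup>2 + \<sigma>\<^sup>2 * \<sigma>\<^sup>2)"
    by (auto simp: fun_eq_iff power2_eq_square power4_eq_xxxx algebra_simps)
  then have "integrable noise_law (\<lambda>y. ((y $ k)\<^sup>2 - \<sigma>\<^sup>2)\<^sup>2)"
    using noise_moments(1)[of k 4] noise_moments(1)[of k 2] by simp
  moreover have "(\<integral>y. (y $ k)\<^sup>2 - \<sigma>\<^sup>2 \<partial>noise_law) = 0"
    using noise_moments(1)[of k 2] noise_moments(3)[of k] by (simp add: N.prob_space)
  ultimately show "integrable M (square_sum k r)" "(\<lambda>r. (\<integral>\<omega>. \<bar>square_sum k r \<omega>\<bar> \<partial>M) / tsize r) \<longlonglongrightarrow> 0"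
    using martingale_mean_tendsto[of "\<lambda>_ _. 1" "\<lambda>_ y. (y $ k)\<^sup>2 - \<sigma>\<^sup>2" 1 "\<integral>y. ((y $ k)\<^sup>2 - \<sigma>\<^sup>2)\<^sup>2 \<partial>noise_law"]
    by (simp_all add: square_sum_def[abs_def] prob_space)
qed

lemma daughters:
  assumes "i \<ge> 1" "\<omega> \<in> space M"
  shows "X (2 * i) \<omega> = drift 0 (X i \<omega>) + noise i \<omega> $ 1" "X (2 * i + 1) \<omega> = drift 1 (X i \<omega>) + noise i \<omega> $ 2"
  using left_daughter[OF assms] right_daughter[OF assms] by (auto simp: drift_def noise_pair_def)

text \<open>Every vertex of the larger tree except the root is a daughter of exactly one vertex of
  the smaller tree. The root accounts for \<open>X 1 \<omega> - \<mu>1\<close>; the constants of the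
  recursion cancel by \<open>\<mu>1_fixpoint\<close>.\<close>

lemma mean1_step:
  assumes \<omega>: "\<omega> \<in> space M"
  shows "tsize (Suc r) * (mean1 (Suc r) \<omega> - \<mu>1) = 2 * tsize r * ((\<alpha>\<^sub>0 + \<alpha>\<^sub>1) / 2 * (mean1 r \<omega> - \<mu>1))
     + (X 1 \<omega> - \<mu>1 + noise_sum 1 r \<omega> + noise_sum 2 r \<omega>)"
proof -
  have "tsize (Suc r) * mean1 (Suc r) \<omega> = X 1 \<omega> + (\<Sum>i\<in>tree_upto r. X (2 * i) \<omega> + X (2 * i + 1) \<omega>)"
    unfolding tree_mean_mult by (rule tree_sum_daughters)
  also have "(\<Sum>i\<in>tree_upto r. X (2 * i) \<omega> + X (2 * i + 1) \<omega>) =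
      (\<Sum>i\<in>tree_upto r. (\<alpha>\<^sub>0 + \<alpha>\<^sub>1) * X i \<omega> + (\<beta>\<^sub>0 + \<beta>\<^sub>1) + (noise i \<omega> $ 1 + noise i \<omega> $ 2))"
  proof (rule sum.cong[OF refl])
    fix i assume "i \<in> tree_upto r"
    from daughters[OF tree_upto_ge[OF this] \<omega>]
    show "X (2 * i) \<omega> + X (2 * i + 1) \<omega> = (\<alpha>\<^sub>0 + \<alpha>\<^sub>1) * X i \<omega> + (\<beta>\<^sub>0 + \<beta>\<^sub>1) + (noise i \<omega> $ 1 + noise i \<omega> $ 2)"
      by (simp only:) (simp add: drift_def algebra_simps)
  qed
  also have "\<dots> = (\<alpha>\<^sub>0 + \<alpha>\<^sub>1) * (tsize r * mean1 r \<omega>) + tsize r * (\<beta>\<^sub>0 + \<beta>\<^sub>1) + (noise_sum 1 r \<omega> + noise_sum 2 r \<omega>)"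
    unfolding tree_mean_mult noise_sum_def by (simp add: sum.distrib sum_distrib_left)
  finally have 1: "tsize (Suc r) * mean1 (Suc r) \<omega> = X 1 \<omega> + ((\<alpha>\<^sub>0 + \<alpha>\<^sub>1) * (tsize r * mean1 r \<omega>) + tsize r * (\<beta>\<^sub>0 + \<beta>\<^sub>1) + (noise_sum 1 r \<omega> + noise_sum 2 r \<omega>))" .
  have 2: "tsize (Suc r) * \<mu>1 = \<mu>1 + tsize r * ((\<alpha>\<^sub>0 + \<alpha>\<^sub>1) * \<mu>1 + (\<beta>\<^sub>0 + \<beta>\<^sub>1))"
    unfolding tsize_Suc using arg_cong[OF \<mu>1_fixpoint, of "\<lambda>x. 2 * tsize r * x"] by (simp add: field_simps)
  show ?thesis unfolding right_diff_distrib 1 2 by (simp add: field_simps)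
qed

text \<open>Squaring the recursion couples the second average to the first through the mixed term
  \<open>2 \<alpha> \<beta> X\<close>. The noise squares are compensated by
  \<open>\<sigma>\<^sup>2\<close>, which \<open>\<mu>2_fixpoint\<close> absorbs.\<close>

lemma mean2_step:
  assumes \<omega>: "\<omega> \<in> space M"
  shows "tsize (Suc r) * (mean2 (Suc r) \<omega> - \<mu>2) = 2 * tsize r * ((\<alpha>\<^sub>0\<^sup>2 + \<alpha>\<^sub>1\<^sup>2) / 2 * (mean2 r \<omega> - \<mu>2)
       + (\<alpha>\<^sub>0 * \<beta>\<^sub>0 + \<alpha>\<^sub>1 * \<beta>\<^sub>1) * (mean1 r \<omega> - \<mu>1))
     + ((X 1 \<omega>)\<^sup>2 - \<mu>2 + 2 * cross_sum 0 1 r \<omega> + 2 * cross_sum 1 2 r \<omega> + square_sum 1 r \<omega> + square_sum 2 r \<omega>)"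
proof -
  have "tsize (Suc r) * mean2 (Suc r) \<omega> = (X 1 \<omega>)\<^sup>2 + (\<Sum>i\<in>tree_upto r. (X (2 * i) \<omega>)\<^sup>2 + (X (2 * i + 1) \<omega>)\<^sup>2)"
    unfolding tree_mean_mult by (rule tree_sum_daughters)
  also have "(\<Sum>i\<in>tree_upto r. (X (2 * i) \<omega>)\<^sup>2 + (X (2 * i + 1) \<omega>)\<^sup>2) =
      (\<Sum>i\<in>tree_upto r. (\<alpha>\<^sub>0\<^sup>2 + \<alpha>\<^sub>1\<^sup>2) * (X i \<omega>)\<^sup>2 + 2 * (\<alpha>\<^sub>0 * \<beta>\<^sub>0 + \<alpha>\<^sub>1 * \<beta>\<^sub>1) * X i \<omega> + (\<beta>\<^sub>0\<^sup>2 + \<beta>\<^sub>1\<^sup>2 + 2 * \<sigma>\<^sup>2)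
        + (2 * (drift 0 (X i \<omega>) * noise i \<omega> $ 1) + 2 * (drift 1 (X i \<omega>) * noise i \<omega> $ 2)
        + ((noise i \<omega> $ 1)\<^sup>2 - \<sigma>\<^sup>2) + ((noise i \<omega> $ 2)\<^sup>2 - \<sigma>\<^sup>2)))"
  proof (rule sum.cong[OF refl])
    fix i assume "i \<in> tree_upto r"
    from daughters[OF tree_upto_ge[OF this] \<omega>]
    show "(X (2 * i) \<omega>)\<^sup>2 + (X (2 * i + 1) \<omega>)\<^sup>2 = (\<alpha>\<^sub>0\<^sup>2 + \<alpha>\<^sub>1\<^sup>2) * (X i \<omega>)\<^sup>2 + 2 * (\<alpha>\<^sub>0 * \<beta>\<^sub>0 + \<alpha>\<^sub>1 * \<beta>\<^sub>1) * X i \<omega> + (\<beta>\<^sub>0\<^sup>2 + \<beta>\<^sub>1\<^sup>2 + 2 * \<sigma>\<^sup>2)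
        + (2 * (drift 0 (X i \<omega>) * noise i \<omega> $ 1) + 2 * (drift 1 (X i \<omega>) * noise i \<omega> $ 2)
        + ((noise i \<omega> $ 1)\<^sup>2 - \<sigma>\<^sup>2) + ((noise i \<omega> $ 2)\<^sup>2 - \<sigma>\<^sup>2))"
      by (simp only:) (simp add: drift_def power2_eq_square algebra_simps)
  qed
  also have "\<dots> = (\<alpha>\<^sub>0\<^sup>2 + \<alpha>\<^sub>1\<^sup>2) * (tsize r * mean2 r \<omega>) + 2 * (\<alpha>\<^sub>0 * \<beta>\<^sub>0 + \<alpha>\<^sub>1 * \<beta>\<^sub>1) * (tsize r * mean1 r \<omega>)
      + tsize r * (\<beta>\<^sub>0\<^sup>2 + \<beta>\<^sub>1\<^sup>2 + 2 * \<sigma>\<^sup>2)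
      + (2 * cross_sum 0 1 r \<omega> + 2 * cross_sum 1 2 r \<omega> + square_sum 1 r \<omega> + square_sum 2 r \<omega>)"
    unfolding tree_mean_mult cross_sum_def square_sum_def
    by (simp only: sum.distrib sum_distrib_left[symmetric] sum_constant) (simp add: algebra_simps)
  finally have 1: "tsize (Suc r) * mean2 (Suc r) \<omega> = (X 1 \<omega>)\<^sup>2 + \<dots>" .
  have 2: "tsize (Suc r) * \<mu>2 = \<mu>2 + tsize r * ((\<alpha>\<^sub>0\<^sup>2 + \<alpha>\<^sub>1\<^sup>2) * \<mu>2 + 2 * (\<alpha>\<^sub>0 * \<beta>\<^sub>0 + \<alpha>\<^sub>1 * \<beta>\<^sub>1) * \<mu>1 + (\<beta>\<^sub>0\<^sup>2 + \<beta>\<^sub>1\<^sup>2 + 2 * \<sigma>\<^sup>2))"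
    unfolding tsize_Suc using arg_cong[OF \<mu>2_fixpoint, of "\<lambda>x. 2 * tsize r * x"] by (simp add: field_simps)
  show ?thesis unfolding right_diff_distrib 1 2 by (simp add: field_simps)
qed

theorem mean1_tendsto: "(\<lambda>r. \<integral>\<omega>. \<bar>mean1 r \<omega> - \<mu>1\<bar> \<partial>M) \<longlonglongrightarrow> 0"
proof (rule contraction_tendsto_zero)
  let ?q = "\<bar>(\<alpha>\<^sub>0 + \<alpha>\<^sub>1) / 2\<bar>"
  let ?b = "\<lambda>r. (\<integral>\<omega>. \<bar>X 1 \<omega> - \<mu>1\<bar> \<partial>M) / tsize r + (\<integral>\<omega>. \<bar>noise_sum 1 r \<omega>\<bar> \<partial>M) / tsize r + (\<integral>\<omega>. \<bar>noise_sum 2 r \<omega>\<bar> \<partial>M) / tsize r"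
  show "0 \<le> ?q" "?q < 1" using a0 a1 by auto
  show "?b \<longlonglongrightarrow> 0"
    using tendsto_add[OF tendsto_add[OF const_over_tsize noise_sum(2)] noise_sum(2)] by simp
  show "(\<integral>\<omega>. \<bar>mean1 (Suc r) \<omega> - \<mu>1\<bar> \<partial>M) \<le> ?q * (\<integral>\<omega>. \<bar>mean1 r \<omega> - \<mu>1\<bar> \<partial>M) + ?b r" for r
  proof -
    have int: "integrable M (\<lambda>\<omega>. \<bar>mean1 r \<omega> - \<mu>1\<bar>)" "integrable M (\<lambda>\<omega>. \<bar>X 1 \<omega> - \<mu>1\<bar>)" for r
      using mean1_int X_int[of 1] by auto
    note ns = noise_sum(1)[of 1 r, THEN integrable_abs] noise_sum(1)[of 2 r, THEN integrable_abs]
    have "(\<integral>\<omega>. \<bar>mean1 (Suc r) \<omega> - \<mu>1\<bar> \<partial>M) \<le> (\<integral>\<omega>. ?q * \<bar>mean1 r \<omega> - \<mu>1\<bar> + (\<bar>X 1 \<omega> - \<mu>1\<bar> / tsize r + \<bar>noise_sum 1 r \<omega>\<bar> / tsize r + \<bar>noise_sum 2 r \<omega>\<bar> / tsize r) \<partial>M)"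
    proof (rule Bochner_Integration.integral_mono)
      fix \<omega> assume "\<omega> \<in> space M"
      from mean_step_bound[OF mean1_step[OF this, of r]]
      have "\<bar>mean1 (Suc r) \<omega> - \<mu>1\<bar> \<le> ?q * \<bar>mean1 r \<omega> - \<mu>1\<bar> + \<bar>X 1 \<omega> - \<mu>1 + noise_sum 1 r \<omega> + noise_sum 2 r \<omega>\<bar> / tsize r"
        unfolding abs_mult .
      also have "\<bar>X 1 \<omega> - \<mu>1 + noise_sum 1 r \<omega> + noise_sum 2 r \<omega>\<bar> / tsize r \<le> (\<bar>X 1 \<omega> - \<mu>1\<bar> + \<bar>noise_sum 1 r \<omega>\<bar> + \<bar>noise_sum 2 r \<omega>\<bar>) / tsize r"
        by (intro divide_right_mono) auto
      finally show "\<bar>mean1 (Suc r) \<omega> - \<mu>1\<bar> \<le> ?q * \<bar>mean1 r \<omega> - \<mu>1\<bar> + (\<bar>X 1 \<omega> - \<mu>1\<bar> / tsize r + \<bar>noise_sum 1 r \<omega>\<bar> / tsize r + \<bar>noise_sum 2 r \<omega>\<bar> / tsize r)"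
        by (simp add: add_divide_distrib)
    qed (use int ns in \<open>auto intro!: Bochner_Integration.integrable_add\<close>)
    also have "\<dots> = ?q * (\<integral>\<omega>. \<bar>mean1 r \<omega> - \<mu>1\<bar> \<partial>M) + ?b r"
      using int ns by (simp del: integral_abs_bound abs_divide)
    finally show ?thesis .
  qed
qed (intro integral_nonneg_AE, simp)

text \<open>The same contraction, in which the error of the first average, already known to vanish,
  joins the forcing term.\<close>

theorem mean2_tendsto: "(\<lambda>r. \<integral>\<omega>. \<bar>mean2 r \<omega> - \<mu>2\<bar> \<partial>M) \<longlonglongrightarrow> 0"
proof (rule contraction_tendsto_zero)
  let ?q = "(\<alpha>\<^sub>0\<^sup>2 + \<alpha>\<^sub>1\<^sup>2) / 2"
  let ?p = "\<bar>\<alpha>\<^sub>0 * \<beta>\<^sub>0 + \<alpha>\<^sub>1 * \<beta>\<^sub>1\<bar>"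
  let ?I = "\<lambda>f r. (\<integral>\<omega>. \<bar>f r \<omega>\<bar> \<partial>M) / tsize r"
  let ?b = "\<lambda>r. ?p * (\<integral>\<omega>. \<bar>mean1 r \<omega> - \<mu>1\<bar> \<partial>M) + ((\<integral>\<omega>. \<bar>(X 1 \<omega>)\<^sup>2 - \<mu>2\<bar> \<partial>M) / tsize r + 2 * ?I (cross_sum 0 1) r + 2 * ?I (cross_sum 1 2) r
      + ?I (square_sum 1) r + ?I (square_sum 2) r)"
  have "\<alpha>\<^sub>0\<^sup>2 < 1" "\<alpha>\<^sub>1\<^sup>2 < 1" using a0 a1 by (auto simp: abs_square_less_1)
  then show "0 \<le> ?q" "?q < 1" by auto
  have "?b \<longlonglongrightarrow> ?p * 0 + (0 + 2 * 0 + 2 * 0 + 0 + 0)"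
    by (intro tendsto_add tendsto_mult tendsto_const mean1_tendsto const_over_tsize cross_sum(2) square_sum(2))
  then show "?b \<longlonglongrightarrow> 0" by simp
  show "(\<integral>\<omega>. \<bar>mean2 (Suc r) \<omega> - \<mu>2\<bar> \<partial>M) \<le> ?q * (\<integral>\<omega>. \<bar>mean2 r \<omega> - \<mu>2\<bar> \<partial>M) + ?b r" for r
  proof -
    have int: "integrable M (\<lambda>\<omega>. \<bar>mean1 r \<omega> - \<mu>1\<bar>)" "integrable M (\<lambda>\<omega>. \<bar>mean2 r \<omega> - \<mu>2\<bar>)" "integrable M (\<lambda>\<omega>. \<bar>(X 1 \<omega>)\<^sup>2 - \<mu>2\<bar>)" for r
      using mean1_int mean2_int X_sq(1)[of 1] by auto
    note ns = cross_sum(1)[of 0 1 r, THEN integrable_abs] cross_sum(1)[of 1 2 r, THEN integrable_abs]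
      square_sum(1)[of 1 r, THEN integrable_abs] square_sum(1)[of 2 r, THEN integrable_abs]
    let ?R = "\<lambda>\<omega>. \<bar>(X 1 \<omega>)\<^sup>2 - \<mu>2\<bar> / tsize r + 2 * (\<bar>cross_sum 0 1 r \<omega>\<bar> / tsize r) + 2 * (\<bar>cross_sum 1 2 r \<omega>\<bar> / tsize r)
       + \<bar>square_sum 1 r \<omega>\<bar> / tsize r + \<bar>square_sum 2 r \<omega>\<bar> / tsize r"
    have "(\<integral>\<omega>. \<bar>mean2 (Suc r) \<omega> - \<mu>2\<bar> \<partial>M) \<le> (\<integral>\<omega>. ?q * \<bar>mean2 r \<omega> - \<mu>2\<bar> + (?p * \<bar>mean1 r \<omega> - \<mu>1\<bar> + ?R \<omega>) \<partial>M)"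
    proof (rule Bochner_Integration.integral_mono)
      fix \<omega> assume "\<omega> \<in> space M"
      let ?z = "(X 1 \<omega>)\<^sup>2 - \<mu>2 + 2 * cross_sum 0 1 r \<omega> + 2 * cross_sum 1 2 r \<omega> + square_sum 1 r \<omega> + square_sum 2 r \<omega>"
      from mean_step_bound[OF mean2_step[OF \<open>\<omega> \<in> space M\<close>, of r]]
      have "\<bar>mean2 (Suc r) \<omega> - \<mu>2\<bar> \<le> \<bar>?q * (mean2 r \<omega> - \<mu>2) + (\<alpha>\<^sub>0 * \<beta>\<^sub>0 + \<alpha>\<^sub>1 * \<beta>\<^sub>1) * (mean1 r \<omega> - \<mu>1)\<bar> + \<bar>?z\<bar> / tsize r" .
      also have "\<bar>?q * (mean2 r \<omega> - \<mu>2) + (\<alpha>\<^sub>0 * \<beta>\<^sub>0 + \<alpha>\<^sub>1 * \<beta>\<^sub>1) * (mean1 r \<omega> - \<mu>1)\<bar> \<le> ?q * \<bar>mean2 r \<omega> - \<mu>2\<bar> + ?p * \<bar>mean1 r \<omega> - \<mu>1\<bar>"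
        by (rule order_trans[OF abs_triangle_ineq]) (simp add: abs_mult)
      also have "\<bar>?z\<bar> / tsize r \<le> (\<bar>(X 1 \<omega>)\<^sup>2 - \<mu>2\<bar> + 2 * \<bar>cross_sum 0 1 r \<omega>\<bar> + 2 * \<bar>cross_sum 1 2 r \<omega>\<bar> + \<bar>square_sum 1 r \<omega>\<bar> + \<bar>square_sum 2 r \<omega>\<bar>) / tsize r"
        by (intro divide_right_mono) auto
      finally show "\<bar>mean2 (Suc r) \<omega> - \<mu>2\<bar> \<le> ?q * \<bar>mean2 r \<omega> - \<mu>2\<bar> + (?p * \<bar>mean1 r \<omega> - \<mu>1\<bar> + ?R \<omega>)"
        by (simp add: add_divide_distrib)
    next
      show "integrable M (\<lambda>\<omega>. \<bar>mean2 (Suc r) \<omega> - \<mu>2\<bar>)" by (rule int)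
      show "integrable M (\<lambda>\<omega>. ?q * \<bar>mean2 r \<omega> - \<mu>2\<bar> + (?p * \<bar>mean1 r \<omega> - \<mu>1\<bar> + ?R \<omega>))"
        by (intro Bochner_Integration.integrable_add integrable_mult_right integrable_divide int ns)
    qed
    also have "\<dots> = ?q * (\<integral>\<omega>. \<bar>mean2 r \<omega> - \<mu>2\<bar> \<partial>M) + ?b r"
      by (intro has_bochner_integral_integral_eq has_bochner_integral_add has_bochner_integral_mult_right
          has_bochner_integral_divide_zero has_bochner_integral_integrable int ns)
    finally show ?thesis .
  qed
qed (intro integral_nonneg_AE, simp)

end

section \<open>The martingale central limit theorem\<close>

text \<open>The range \<open>x \<le> 1 / 2\<close> is the one left by stopping the accumulated
  variance at \<open>v + 1\<close>, since half of its excess over \<open>v\<close> is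
  exponentiated.\<close>

lemma abs_exp_minus_one_le:
  fixes x :: real
  assumes "x \<le> 1 / 2"
  shows "\<bar>1 - exp x\<bar> \<le> 2 * \<bar>x\<bar>"
proof (cases "x \<le> 0")
  case True
  then have "\<bar>1 - exp x\<bar> = 1 - exp x" "\<bar>x\<bar> = - x" by simp_all
  then show ?thesis using exp_ge_add_one_self[of x] True by linarith
next
  case False
  then have "exp x \<le> 1 + x + x\<^sup>2" using assms by (intro exp_bound) auto
  also have "x\<^sup>2 \<le> x" using assms False by (simp add: power2_eq_square mult_left_le)
  finally show ?thesis using False by auto
qed

context bar_model
begin

text \<open>The variance of \<open>p\<close> times the first plus \<open>q\<close> times the second
  noise component, that is, the conditional variance of a martingale increment given the
  past.\<close>

definition cond_var :: "real \<Rightarrow> real \<Rightarrow> real" where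
  "cond_var p q = \<sigma>\<^sup>2 * (p\<^sup>2 + 2 * \<rho> * p * q + q\<^sup>2)"

lemma cond_var_nonneg: "0 \<le> cond_var p q"
proof -
  have "\<rho>\<^sup>2 \<le> 1" using rho_range by (auto simp: abs_square_le_1)
  then have "0 \<le> (p + \<rho> * q)\<^sup>2 + (1 - \<rho>\<^sup>2) * q\<^sup>2" by simp
  also have "\<dots> = p\<^sup>2 + 2 * \<rho> * p * q + q\<^sup>2" by (simp add: power2_eq_square algebra_simps)
  finally show ?thesis by (simp add: cond_var_def)
qed

lemma cond_var_measurable [measurable]:
  assumes [measurable]: "f \<in> borel_measurable N" "g \<in> borel_measurable N"
  shows "(\<lambda>x. cond_var (f x) (g x)) \<in> borel_measurable N"
  unfolding cond_var_def by measurable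

lemma noise_fourier:
  "(\<integral>y. iexp (p * y $ 1 + q * y $ 2) \<partial>noise_law) = of_real (exp (- cond_var p q / 2))"
proof -
  have "(vector [p, q] :: real^2) \<bullet> y = p * y $ 1 + q * y $ 2" for y
    by (simp add: inner_vec_def sum_2)
  then show ?thesis
    using fourier_noise_law[OF sigma_pos, of \<rho> "vector [p, q]"] rho_range
    by (simp add: fourier_def cond_var_def abs_less_iff)
qed

text \<open>An exponential martingale: the conditional characteristic function of an increment is
  exactly \<open>exp (- cond_var / 2)\<close>, and its reciprocal is known before the noise is drawn
  because the weights are predictable. The bound \<open>K\<close> makes the compensated exponential
  integrable.\<close>

lemma martingale_fourier_bounded:
  fixes p q :: "nat \<Rightarrow> 'a \<Rightarrow> real"
  assumes p: "\<And>i. i \<ge> 1 \<Longrightarrow> p i \<in> borel_measurable (past i)" and q: "\<And>i. i \<ge> 1 \<Longrightarrow> q i \<in> borel_measurable (past i)"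
    and K: "\<And>k \<omega>. (\<Sum>i = 1..k. cond_var (p i \<omega>) (q i \<omega>)) \<le> K"
  shows "(\<integral>\<omega>. iexp (\<Sum>i = 1..n. p i \<omega> * noise i \<omega> $ 1 + q i \<omega> * noise i \<omega> $ 2)
     * of_real (exp ((\<Sum>i = 1..n. cond_var (p i \<omega>) (q i \<omega>)) / 2)) \<partial>M) = 1"
proof (induction n)
  case 0 then show ?case by (simp add: prob_space)
next
  case (Suc n)
  define S where "S \<omega> = (\<Sum>i = 1..n. p i \<omega> * noise i \<omega> $ 1 + q i \<omega> * noise i \<omega> $ 2)" for \<omega>
  define V where "V k \<omega> = (\<Sum>i = 1..k. cond_var (p i \<omega>) (q i \<omega>))" for k \<omega>
  have pm: "p i \<in> borel_measurable (past (Suc n))" "q i \<in> borel_measurable (past (Suc n))" if "1 \<le> i" "i \<le> Suc n" for i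
    using that measurable_past_mono[OF p] measurable_past_mono[OF q] by auto
  have Sm: "S \<in> borel_measurable (past (Suc n))"
    unfolding S_def
  proof (intro borel_measurable_sum)
    fix i assume "i \<in> {1..n}"
    then have i: "1 \<le> i" "i \<le> Suc n" "i < Suc n" by auto
    note [measurable] = pm[OF i(1,2)] noise_past[OF i(1,3)]
    show "(\<lambda>\<omega>. p i \<omega> * noise i \<omega> $ 1 + q i \<omega> * noise i \<omega> $ 2) \<in> borel_measurable (past (Suc n))" by measurable
  qed
  have Vm: "V (Suc n) \<in> borel_measurable (past (Suc n))"
    unfolding V_def by (intro borel_measurable_sum cond_var_measurable pm) auto
  note [measurable] = Sm Vm pm[of "Suc n", simplified]
  have [measurable]: "S \<in> borel_measurable M" "V (Suc n) \<in> borel_measurable M" "noise (Suc n) \<in> borel_measurable M"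
    "p (Suc n) \<in> borel_measurable M" "q (Suc n) \<in> borel_measurable M"
    using measurable_past[OF Sm] measurable_past[OF Vm] measurable_past[OF pm(1)[of "Suc n"]] measurable_past[OF pm(2)[of "Suc n"]] by auto
  \<comment> \<open>\<open>G\<close> gathers all that is known before noise pair
    \<open>Suc n\<close>, including the variance of the increment that this pair is about to
    produce.\<close>
  define G where "G \<omega> = iexp (S \<omega>) * of_real (exp (V (Suc n) \<omega> / 2))" for \<omega>
  have Gm [measurable]: "G \<in> borel_measurable (past (Suc n))" unfolding G_def[abs_def] by measurable
  have GM [measurable]: "G \<in> borel_measurable M" unfolding G_def[abs_def] by measurable
  let ?H = "\<lambda>z. G (fst z) * iexp (p (Suc n) (fst z) * (snd z) $ 1 + q (Suc n) (fst z) * (snd z) $ 2)"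
  have Hm: "?H \<in> borel_measurable (past (Suc n) \<Otimes>\<^sub>M borel)" by measurable
  have V_le: "V k \<omega> \<le> K" for k \<omega> using K by (simp add: V_def)
  have int: "integrable M (\<lambda>\<omega>. ?H (\<omega>, noise (Suc n) \<omega>))"
  proof (rule integrable_const_bound[of _ "exp (K / 2)"])
    show "AE \<omega> in M. norm (?H (\<omega>, noise (Suc n) \<omega>)) \<le> exp (K / 2)"
      using V_le by (simp add: norm_mult G_def)
    show "(\<lambda>\<omega>. ?H (\<omega>, noise (Suc n) \<omega>)) \<in> borel_measurable M" by (simp, measurable)
  qed
  have "(\<integral>\<omega>. iexp (\<Sum>i = 1..Suc n. p i \<omega> * noise i \<omega> $ 1 + q i \<omega> * noise i \<omega> $ 2)
     * of_real (exp (V (Suc n) \<omega> / 2)) \<partial>M) = (\<integral>\<omega>. ?H (\<omega>, noise (Suc n) \<omega>) \<partial>M)"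
    by (rule Bochner_Integration.integral_cong) (simp_all add: G_def S_def exp_add distrib_left mult.commute mult.left_commute)
  also have "\<dots> = (\<integral>\<omega>. (\<integral>y. ?H (\<omega>, y) \<partial>noise_law) \<partial>M)"
    by (rule expectation_noise[OF _ Hm int]) simp
  also have "\<dots> = (\<integral>\<omega>. iexp (S \<omega>) * of_real (exp (V n \<omega> / 2)) \<partial>M)"
  proof (rule Bochner_Integration.integral_cong[OF refl])
    fix \<omega>
    have V: "V (Suc n) \<omega> = V n \<omega> + cond_var (p (Suc n) \<omega>) (q (Suc n) \<omega>)" by (simp add: V_def)
    have "(\<integral>y. ?H (\<omega>, y) \<partial>noise_law) = G \<omega> * (\<integral>y. iexp (p (Suc n) \<omega> * y $ 1 + q (Suc n) \<omega> * y $ 2) \<partial>noise_law)"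
      by simp
    also have "\<dots> = iexp (S \<omega>) * of_real (exp (V (Suc n) \<omega> / 2) * exp (- cond_var (p (Suc n) \<omega>) (q (Suc n) \<omega>) / 2))"
      unfolding noise_fourier G_def by simp
    also have "exp (V (Suc n) \<omega> / 2) * exp (- cond_var (p (Suc n) \<omega>) (q (Suc n) \<omega>) / 2) = exp (V n \<omega> / 2)"
      unfolding V exp_add[symmetric] by (simp add: field_simps)
    finally show "(\<integral>y. ?H (\<omega>, y) \<partial>noise_law) = iexp (S \<omega>) * of_real (exp (V n \<omega> / 2))" .
  qed
  also have "\<dots> = 1" using Suc unfolding S_def V_def .
  finally show ?case unfolding V_def .
qed

text \<open>The exponential identity above needs a deterministic bound on the accumulated variance. Setting the weights to
  zero once it exceeds \<open>v + 1\<close> enforces this bound and keeps them predictable; the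
  sums differ only where the variance is more than \<open>1\<close> away from \<open>v\<close>.\<close>

theorem martingale_fourier:
  fixes p q :: "nat \<Rightarrow> 'a \<Rightarrow> real"
  assumes p: "\<And>i. i \<ge> 1 \<Longrightarrow> p i \<in> borel_measurable (past i)" and q: "\<And>i. i \<ge> 1 \<Longrightarrow> q i \<in> borel_measurable (past i)"
    and v: "v \<ge> 0" and Vint: "integrable M (\<lambda>\<omega>. \<Sum>i = 1..n. cond_var (p i \<omega>) (q i \<omega>))"
  shows "cmod ((\<integral>\<omega>. iexp (\<Sum>i = 1..n. p i \<omega> * noise i \<omega> $ 1 + q i \<omega> * noise i \<omega> $ 2) \<partial>M) - of_real (exp (- v / 2)))
     \<le> 3 * (\<integral>\<omega>. \<bar>(\<Sum>i = 1..n. cond_var (p i \<omega>) (q i \<omega>)) - v\<bar> \<partial>M)"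
proof -
  define V where "V k \<omega> = (\<Sum>i = 1..k. cond_var (p i \<omega>) (q i \<omega>))" for k \<omega>
  \<comment> \<open>\<open>V i\<close> includes the variance of increment \<open>i\<close>, which is
    known from the past, so an increment that would cross the level is switched off in
    advance.\<close>
  define B where "B i \<omega> = (if V i \<omega> \<le> v + 1 then 1 else 0 :: real)" for i \<omega>
  define p' where "p' i \<omega> = B i \<omega> * p i \<omega>" for i \<omega>
  define q' where "q' i \<omega> = B i \<omega> * q i \<omega>" for i \<omega>
  define S where "S \<omega> = (\<Sum>i = 1..n. p i \<omega> * noise i \<omega> $ 1 + q i \<omega> * noise i \<omega> $ 2)" for \<omega>
  define S' where "S' \<omega> = (\<Sum>i = 1..n. p' i \<omega> * noise i \<omega> $ 1 + q' i \<omega> * noise i \<omega> $ 2)" for \<omega>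
  define V' where "V' k \<omega> = (\<Sum>i = 1..k. cond_var (p' i \<omega>) (q' i \<omega>))" for k \<omega>
  have Vm [measurable]: "V i \<in> borel_measurable (past i)" for i
    unfolding V_def
    by (intro borel_measurable_sum cond_var_measurable measurable_past_mono[OF p] measurable_past_mono[OF q]) auto
  have p'm: "p' i \<in> borel_measurable (past i)" "q' i \<in> borel_measurable (past i)" if "i \<ge> 1" for i
    using p[OF that] q[OF that] unfolding p'_def q'_def B_def by measurable
  have cv': "cond_var (p' i \<omega>) (q' i \<omega>) = B i \<omega> * cond_var (p i \<omega>) (q i \<omega>)" for i \<omega>
    by (auto simp: p'_def q'_def B_def cond_var_def)
  have V'_le: "V' k \<omega> \<le> v + 1" for k \<omega>
  proof (induction k)
    case 0 show ?case using v by (simp add: V'_def)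
  next
    case (Suc k)
    show ?case
    proof (cases "V (Suc k) \<omega> \<le> v + 1")
      case True
      have "V' (Suc k) \<omega> \<le> V (Suc k) \<omega>"
        unfolding V'_def V_def cv' by (intro sum_mono) (auto simp: B_def cond_var_nonneg)
      with True show ?thesis by simp
    next
      case False
      then have "V' (Suc k) \<omega> = V' k \<omega>" by (simp add: V'_def cv' B_def)
      with Suc show ?thesis by simp
    qed
  qed
  have V'_nonneg: "0 \<le> V' k \<omega>" for k \<omega> unfolding V'_def by (intro sum_nonneg cond_var_nonneg)
  \<comment> \<open>The accumulated variance is nondecreasing: if it ends below the level, no weight
    was ever switched off.\<close>
  have good: "S' \<omega> = S \<omega> \<and> V' n \<omega> = V n \<omega>" if "V n \<omega> \<le> v + 1" for \<omega>
  proof -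
    have "B i \<omega> = 1" if "i \<in> {1..n}" for i
    proof -
      have "V i \<omega> \<le> V n \<omega>" unfolding V_def
        by (rule sum_mono2) (use that cond_var_nonneg in auto)
      with \<open>V n \<omega> \<le> v + 1\<close> show ?thesis by (simp add: B_def)
    qed
    then show ?thesis unfolding S'_def S_def V'_def V_def cv' by (simp add: p'_def q'_def)
  qed
  have Sm [measurable]: "S \<in> borel_measurable M"
    unfolding S_def
    by (intro borel_measurable_sum borel_measurable_add borel_measurable_times measurable_past[OF p] measurable_past[OF q]
       measurable_compose[OF noise_measurable measurable_vec_nth]) auto
  have S'm [measurable]: "S' \<in> borel_measurable M"
    unfolding S'_def
    by (intro borel_measurable_sum borel_measurable_add borel_measurable_times measurable_past[OF p'm(1)] measurable_past[OF p'm(2)]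
       measurable_compose[OF noise_measurable measurable_vec_nth]) auto
  have V'm [measurable]: "V' n \<in> borel_measurable M"
    unfolding V'_def
    by (intro borel_measurable_sum cond_var_measurable measurable_past[OF p'm(1)] measurable_past[OF p'm(2)]) auto
  have one: "(\<integral>\<omega>. iexp (S' \<omega>) * of_real (exp (V' n \<omega> / 2)) \<partial>M) = 1"
    unfolding S'_def V'_def by (rule martingale_fourier_bounded[OF p'm]) (use V'_le in \<open>auto simp: V'_def\<close>)
  have i1: "integrable M (\<lambda>\<omega>. iexp (S \<omega>))" by (rule integrable_const_bound[of _ 1]) auto
  have i2: "integrable M (\<lambda>\<omega>. iexp (S' \<omega>) * of_real (exp ((V' n \<omega> - v) / 2)))"
  proof (rule integrable_const_bound[of _ "exp (1 / 2)"])
    show "AE \<omega> in M. norm (iexp (S' \<omega>) * complex_of_real (exp ((V' n \<omega> - v) / 2))) \<le> exp (1 / 2)"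
    proof (intro always_eventually allI)
      fix \<omega>
      have "(V' n \<omega> - v) / 2 \<le> 1 / 2" using V'_le[of n \<omega>] by simp
      then show "norm (iexp (S' \<omega>) * complex_of_real (exp ((V' n \<omega> - v) / 2))) \<le> exp (1 / 2)"
        by (simp add: norm_mult)
    qed
  qed measurable
  have "(\<integral>\<omega>. iexp (S' \<omega>) * of_real (exp ((V' n \<omega> - v) / 2)) \<partial>M)
     = (\<integral>\<omega>. of_real (exp (- v / 2)) * (iexp (S' \<omega>) * of_real (exp (V' n \<omega> / 2))) \<partial>M)"
  proof (rule Bochner_Integration.integral_cong[OF refl])
    fix \<omega>
    have "exp ((V' n \<omega> - v) / 2) = exp (- v / 2) * exp (V' n \<omega> / 2)"
      unfolding exp_add[symmetric] by (simp add: diff_divide_distrib)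
    then show "iexp (S' \<omega>) * complex_of_real (exp ((V' n \<omega> - v) / 2)) =
        of_real (exp (- v / 2)) * (iexp (S' \<omega>) * of_real (exp (V' n \<omega> / 2)))"
      by (simp only: of_real_mult mult.left_commute)
  qed
  also have "\<dots> = of_real (exp (- v / 2))" using one by (simp del: of_real_exp)
  \<comment> \<open>The target value becomes an integral over the stopped martingale, so that both
    quantities are compared pointwise under one integral.\<close>
  finally have v_eq: "of_real (exp (- v / 2)) = (\<integral>\<omega>. iexp (S' \<omega>) * of_real (exp ((V' n \<omega> - v) / 2)) \<partial>M)" ..
  have "cmod ((\<integral>\<omega>. iexp (S \<omega>) \<partial>M) - of_real (exp (- v / 2))) =
      cmod (\<integral>\<omega>. iexp (S \<omega>) - iexp (S' \<omega>) * of_real (exp ((V' n \<omega> - v) / 2)) \<partial>M)"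
    unfolding v_eq using i1 i2 by (subst Bochner_Integration.integral_diff) auto
  also have "\<dots> \<le> (\<integral>\<omega>. cmod (iexp (S \<omega>) - iexp (S' \<omega>) * of_real (exp ((V' n \<omega> - v) / 2))) \<partial>M)"
    by (rule integral_norm_bound)
  \<comment> \<open>Below the level the two sums agree and the exponential is Lipschitz with
    constant 2 at half the deviation. Above it the deviation exceeds 1 while the integrand is at
    most \<open>1 + exp (1 / 2) \<le> 3\<close>.\<close>
  also have "\<dots> \<le> (\<integral>\<omega>. 3 * \<bar>V n \<omega> - v\<bar> \<partial>M)"
  proof (rule Bochner_Integration.integral_mono)
    show "integrable M (\<lambda>\<omega>. cmod (iexp (S \<omega>) - iexp (S' \<omega>) * of_real (exp ((V' n \<omega> - v) / 2))))"
      using i1 i2 by (intro integrable_norm Bochner_Integration.integrable_diff)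
    show "integrable M (\<lambda>\<omega>. 3 * \<bar>V n \<omega> - v\<bar>)" using Vint by (simp add: V_def)
    fix \<omega>
    show "cmod (iexp (S \<omega>) - iexp (S' \<omega>) * of_real (exp ((V' n \<omega> - v) / 2))) \<le> 3 * \<bar>V n \<omega> - v\<bar>"
    proof (cases "V n \<omega> \<le> v + 1")
      case True
      have "iexp (S \<omega>) - iexp (S \<omega>) * of_real (exp ((V n \<omega> - v) / 2)) = iexp (S \<omega>) * of_real (1 - exp ((V n \<omega> - v) / 2))"
        by (simp add: algebra_simps)
      then have "cmod (iexp (S \<omega>) - iexp (S \<omega>) * of_real (exp ((V n \<omega> - v) / 2))) = \<bar>1 - exp ((V n \<omega> - v) / 2)\<bar>"
        by (simp only: norm_mult norm_iexp norm_of_real mult_1_left)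
      also have "\<dots> \<le> 2 * \<bar>(V n \<omega> - v) / 2\<bar>" by (rule abs_exp_minus_one_le) (use True in simp)
      also have "\<dots> \<le> 3 * \<bar>V n \<omega> - v\<bar>" by simp
      finally show ?thesis using good[OF True] by simp
    next
      case False
      have "cmod (iexp (S \<omega>) - iexp (S' \<omega>) * of_real (exp ((V' n \<omega> - v) / 2))) \<le> 1 + exp ((V' n \<omega> - v) / 2)"
        by (rule order_trans[OF norm_triangle_ineq4]) (simp add: norm_mult)
      also have "exp ((V' n \<omega> - v) / 2) \<le> exp (1 / 2)" using V'_le[of n \<omega>] by simp
      also have "exp (1 / 2 :: real) \<le> 2" using abs_exp_minus_one_le[of "1 / 2"] by simp
      finally show ?thesis using False by simp
    qed
  qed
  finally show ?thesis unfolding S_def V_def by simp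
qed

end

section \<open>Asymptotic normality of the least squares estimator\<close>

lemma iexp_lipschitz: "cmod (iexp x - iexp y) \<le> \<bar>x - y\<bar>"
proof -
  have "iexp x - iexp y = iexp y * (iexp (x - y) - 1)"
    by (simp add: right_diff_distrib exp_add[symmetric] algebra_simps)
  then have "cmod (iexp x - iexp y) = cmod (iexp (x - y) - 1)"
    by (simp only: norm_mult norm_iexp mult_1_left)
  also have "\<dots> \<le> \<bar>x - y\<bar>" using iexp_approx1[of "x - y" 0] by simp
  finally show ?thesis .
qed

lemma continuous_on_vector4:
  fixes a b c d :: "'b::topological_space \<Rightarrow> real"
  assumes "continuous_on S a" "continuous_on S b" "continuous_on S c" "continuous_on S d"
  shows "continuous_on S (\<lambda>x. vector [a x, b x, c x, d x] :: real^4)"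
proof -
  have "(\<lambda>x. vector [a x, b x, c x, d x] :: real^4) =
      (\<lambda>x. a x *\<^sub>R axis 1 1 + b x *\<^sub>R axis 2 1 + c x *\<^sub>R axis 3 1 + d x *\<^sub>R axis 4 1)"
    by (simp add: fun_eq_iff vec_eq_iff forall_4 axis_def)
  then show ?thesis using assms by (simp only:) (intro continuous_intros)
qed

lemma borel_measurable_vector4:
  fixes a b c d :: "'b \<Rightarrow> real"
  assumes [measurable]: "a \<in> borel_measurable N" "b \<in> borel_measurable N" "c \<in> borel_measurable N" "d \<in> borel_measurable N"
  shows "(\<lambda>x. vector [a x, b x, c x, d x] :: real^4) \<in> borel_measurable N"
proof -
  have "(\<lambda>x. vector [a x, b x, c x, d x] :: real^4) =
      (\<lambda>x. a x *\<^sub>R axis 1 1 + b x *\<^sub>R axis 2 1 + c x *\<^sub>R axis 3 1 + d x *\<^sub>R axis 4 1)"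
    by (simp add: fun_eq_iff vec_eq_iff forall_4 axis_def)
  then show ?thesis by simp
qed

lemma inner_vec4: "(x::real^4) \<bullet> y = x$1 * y$1 + x$2 * y$2 + x$3 * y$3 + x$4 * y$4"
  by (simp add: inner_vec_def sum_4)

section \<open>Least squares algebra on a fixed tree\<close>

lemma tree_mean_add: "tree_mean r (\<lambda>i. f i + g i) = tree_mean r f + tree_mean r g"
  by (simp add: tree_mean_def sum.distrib add_divide_distrib)

lemma tree_mean_cmult: "tree_mean r (\<lambda>i. c * f i) = c * tree_mean r f"
  by (simp add: tree_mean_def sum_distrib_left)

lemma tree_mean_const: "tree_mean r (\<lambda>i. c) = c"
  using card_tree_upto_pos[of r] by (simp add: tree_mean_def)

lemma tree_mean_cong: "(\<And>i. i \<in> tree_upto r \<Longrightarrow> f i = g i) \<Longrightarrow> tree_mean r f = tree_mean r g"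
  by (simp add: tree_mean_def)

text \<open>A deterministic identity: inserting the regression equation turns the numerator of the
  slope into \<open>a\<close> times the denominator plus the empirical covariance of regressor and
  noise.\<close>

lemma ls_error:
  assumes y: "\<And>i. i \<in> tree_upto r \<Longrightarrow> x (2 * i + e) = a * x i + b + n i"
    and d: "ls_denominator r x \<noteq> 0"
  defines "err \<equiv> (tree_mean r (\<lambda>i. x i * n i) - tree_mean r x * tree_mean r n) / ls_denominator r x"
  shows "ls_alpha e r x = a + err" and "ls_beta e r x = b + (tree_mean r n - err * tree_mean r x)"
proof -
  have 1: "tree_mean r (\<lambda>i. x (2 * i + e)) = a * tree_mean r x + b + tree_mean r n"
    by (subst tree_mean_cong[OF y]) (simp_all add: tree_mean_add tree_mean_cmult tree_mean_const)
  have "tree_mean r (\<lambda>i. x i * x (2 * i + e)) = tree_mean r (\<lambda>i. a * (x i)\<^sup>2 + b * x i + x i * n i)"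
    by (rule tree_mean_cong) (simp only: y, simp add: power2_eq_square algebra_simps)
  then have 2: "tree_mean r (\<lambda>i. x i * x (2 * i + e)) = a * tree_mean r (\<lambda>i. (x i)\<^sup>2) + b * tree_mean r x + tree_mean r (\<lambda>i. x i * n i)"
    by (simp add: tree_mean_add tree_mean_cmult)
  have "ls_alpha e r x = (a * ls_denominator r x + (tree_mean r (\<lambda>i. x i * n i) - tree_mean r x * tree_mean r n)) / ls_denominator r x"
    unfolding ls_alpha_def 1 2 by (rule arg_cong[where f = "\<lambda>z. z / _"]) (simp add: ls_denominator_def power2_eq_square algebra_simps)
  then show alpha: "ls_alpha e r x = a + err" using d by (simp add: add_divide_distrib err_def)
  show "ls_beta e r x = b + (tree_mean r n - err * tree_mean r x)"
    unfolding ls_beta_def alpha 1 by (simp add: algebra_simps)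
qed

context bar_model_sq
begin

abbreviation asym_var :: real where "asym_var \<equiv> \<mu>2 - \<mu>1\<^sup>2"

text \<open>The law of total variance in algebraic form: by the fixed point equations,
  \<open>(1 - ?a) * asym_var\<close> is the noise variance plus the squared half-difference of the
  two daughter means at \<mu>1.\<close>

lemma asym_var_pos: "asym_var > 0"
proof -
  let ?a = "(\<alpha>\<^sub>0\<^sup>2 + \<alpha>\<^sub>1\<^sup>2) / 2"
  let ?y0 = "\<alpha>\<^sub>0 * \<mu>1 + \<beta>\<^sub>0" and ?y1 = "\<alpha>\<^sub>1 * \<mu>1 + \<beta>\<^sub>1"
  have "\<alpha>\<^sub>0\<^sup>2 < 1" "\<alpha>\<^sub>1\<^sup>2 < 1" using a0 a1 by (auto simp: abs_square_less_1)
  then have a: "1 - ?a > 0" by auto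
  have m1: "\<mu>1 = (?y0 + ?y1) / 2" using \<mu>1_fixpoint by (simp add: field_simps)
  have "0 \<le> ((?y0 - ?y1) / 2)\<^sup>2" by simp
  also have "\<dots> = (?y0\<^sup>2 + ?y1\<^sup>2) / 2 - ((?y0 + ?y1) / 2)\<^sup>2" by (simp add: power2_eq_square field_simps)
  also have "\<dots> = (?y0\<^sup>2 + ?y1\<^sup>2) / 2 - \<mu>1\<^sup>2" unfolding m1[symmetric] ..
  also have "(?y0\<^sup>2 + ?y1\<^sup>2) / 2 = ?a * \<mu>1\<^sup>2 + (\<alpha>\<^sub>0 * \<beta>\<^sub>0 + \<alpha>\<^sub>1 * \<beta>\<^sub>1) * \<mu>1 + (\<beta>\<^sub>0\<^sup>2 + \<beta>\<^sub>1\<^sup>2) / 2"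
    by (simp add: power2_eq_square field_simps)
  finally have "\<mu>1\<^sup>2 \<le> ?a * \<mu>1\<^sup>2 + (\<alpha>\<^sub>0 * \<beta>\<^sub>0 + \<alpha>\<^sub>1 * \<beta>\<^sub>1) * \<mu>1 + (\<beta>\<^sub>0\<^sup>2 + \<beta>\<^sub>1\<^sup>2) / 2" by linarith
  then have "\<mu>1\<^sup>2 \<le> ?a * \<mu>1\<^sup>2 + (\<mu>2 - ?a * \<mu>2 - \<sigma>\<^sup>2)" using \<mu>2_fixpoint by linarith
  then have "\<sigma>\<^sup>2 \<le> (1 - ?a) * asym_var" by (simp only: left_diff_distrib right_diff_distrib mult_1_left)
  then have "0 < (1 - ?a) * asym_var" using sigma_pos by (smt (verit) zero_less_power)
  with a show ?thesis by (simp only: zero_less_mult_iff) linarith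
qed

definition scaled_noise :: "2 \<Rightarrow> nat \<Rightarrow> 'a \<Rightarrow> real" where
  "scaled_noise k r \<omega> = (\<Sum>i\<in>tree_upto r. noise i \<omega> $ k) / sqrt (tsize r)"

definition scaled_cross :: "2 \<Rightarrow> nat \<Rightarrow> 'a \<Rightarrow> real" where
  "scaled_cross k r \<omega> = (\<Sum>i\<in>tree_upto r. (X i \<omega> - \<mu>1) * noise i \<omega> $ k) / sqrt (tsize r)"

text \<open>The tree averages are carried along unscaled, since the estimation error needs the score
  and the empirical moments at the same sample point.\<close>

definition score :: "nat \<Rightarrow> 'a \<Rightarrow> (real^4) \<times> real \<times> real" where
  "score r \<omega> = (vector [scaled_noise 1 r \<omega>, scaled_cross 1 r \<omega>, scaled_noise 2 r \<omega>, scaled_cross 2 r \<omega>],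
     mean1 r \<omega>, mean2 r \<omega>)"

lemma score_measurable [measurable]: "score r \<in> borel_measurable M"
proof -
  have n [measurable]: "(\<lambda>\<omega>. noise i \<omega> $ k) \<in> borel_measurable M" if "i \<in> tree_upto r" for i k
    using that by (intro measurable_compose[OF noise_measurable measurable_vec_nth] tree_upto_ge)
  have x [measurable]: "X i \<in> borel_measurable M" if "i \<in> tree_upto r" for i
    using that by (intro X_measurable tree_upto_ge)
  have "scaled_noise k r \<in> borel_measurable M" "scaled_cross k r \<in> borel_measurable M" for k
    unfolding scaled_noise_def[abs_def] scaled_cross_def[abs_def] by measurable
  then show ?thesis
    unfolding score_def[abs_def] by (intro borel_measurable_Pair borel_measurable_vector4 mean1_measurable mean2_measurable)
qed

text \<open>The pairs \<open>(z$1, z$3)\<close> and \<open>(z$2, z$4)\<close> are independent and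
  each is mapped by the Cholesky factor of the noise, the second with the additional factor
  \<open>sqrt asym_var\<close>.\<close>

definition score_limit :: "real^4 \<Rightarrow> (real^4) \<times> real \<times> real" where
  "score_limit z = (vector [\<sigma> * z$1, \<sigma> * sqrt asym_var * z$2, \<sigma> * (\<rho> * z$1 + sqrt (1 - \<rho>\<^sup>2) * z$3),
     \<sigma> * sqrt asym_var * (\<rho> * z$2 + sqrt (1 - \<rho>\<^sup>2) * z$4)], \<mu>1, \<mu>2)"

lemma score_limit_measurable [measurable]: "score_limit \<in> borel_measurable borel"
  unfolding score_limit_def[abs_def]
  by (intro borel_measurable_Pair borel_measurable_vector4) measurable

abbreviation score_law :: "((real^4) \<times> real \<times> real) measure" where
  "score_law \<equiv> distr std_gaussian borel score_limit"

lemma fourier_score_law: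
  "fourier score_law (w, s, t) = iexp (s * \<mu>1 + t * \<mu>2) *
     of_real (exp (- (cond_var (w$1) (w$3) + asym_var * cond_var (w$2) (w$4)) / 2))"
proof -
  define d where "d = sqrt asym_var"
  define c where "c = sqrt (1 - \<rho>\<^sup>2)"
  have d: "d\<^sup>2 = asym_var" using asym_var_pos by (simp add: d_def)
  have "\<rho>\<^sup>2 \<le> 1" using rho_range by (auto simp: abs_square_le_1)
  then have c: "c\<^sup>2 = 1 - \<rho>\<^sup>2" by (simp add: c_def)
  let ?u = "vector [\<sigma> * (w$1 + \<rho> * w$3), \<sigma> * d * (w$2 + \<rho> * w$4), \<sigma> * c * w$3, \<sigma> * d * c * w$4] :: real^4"
  have "(w, s, t) \<bullet> score_limit z = (s * \<mu>1 + t * \<mu>2) + ?u \<bullet> z" for z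
    by (simp add: score_limit_def inner_vec4 d_def[symmetric] c_def[symmetric] algebra_simps)
  then have four: "fourier score_law (w, s, t) = iexp (s * \<mu>1 + t * \<mu>2) * fourier std_gaussian ?u"
    unfolding fourier_def
    by (subst integral_distr) (auto simp: distrib_left exp_add)
  have "(norm ?u)\<^sup>2 = \<sigma>\<^sup>2 * ((w$1 + \<rho> * w$3)\<^sup>2 + c\<^sup>2 * (w$3)\<^sup>2) + d\<^sup>2 * (\<sigma>\<^sup>2 * ((w$2 + \<rho> * w$4)\<^sup>2 + c\<^sup>2 * (w$4)\<^sup>2))"
    unfolding norm_vec4 by (simp add: power2_eq_square algebra_simps)
  also have "\<dots> = cond_var (w$1) (w$3) + asym_var * cond_var (w$2) (w$4)"
    unfolding c d by (simp add: cond_var_def power2_eq_square algebra_simps)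
  finally show ?thesis unfolding four fourier_std_gaussian by simp
qed

text \<open>A linear functional of the score is a martingale with predictable weights plus a
  combination of the tree averages. The averages are replaced by their limits at Lipschitz cost, the
  martingale is handled by \<open>martingale_fourier\<close>, and both errors are bounded by the
  \<open>L^1\<close> errors of the averages.\<close>

lemma fourier_score_tendsto: "(\<lambda>r. fourier (distr M borel (score r)) u) \<longlonglongrightarrow> fourier score_law u"
proof -
  obtain w s t where u: "u = (w, s, t)" by (metis prod.exhaust)
  define p where "p r i \<omega> = (w$1 + w$2 * (X i \<omega> - \<mu>1)) / sqrt (tsize r)" for r i \<omega>
  define q where "q r i \<omega> = (w$3 + w$4 * (X i \<omega> - \<mu>1)) / sqrt (tsize r)" for r i \<omega>
  define S where "S r \<omega> = (\<Sum>i\<in>tree_upto r. p r i \<omega> * noise i \<omega> $ 1 + q r i \<omega> * noise i \<omega> $ 2)" for r \<omega>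
  define V where "V r \<omega> = (\<Sum>i\<in>tree_upto r. cond_var (p r i \<omega>) (q r i \<omega>))" for r \<omega>
  define v where "v = cond_var (w$1) (w$3) + asym_var * cond_var (w$2) (w$4)"
  have v0: "v \<ge> 0" unfolding v_def using asym_var_pos cond_var_nonneg by (intro add_nonneg_nonneg mult_nonneg_nonneg) auto
  \<comment> \<open>\<open>A0\<close>, \<open>A1\<close> and \<open>A2\<close> are the coefficients
    of the conditional variance as a quadratic polynomial in \<open>x\<close>, expanded from powers
    of \<open>x - \<mu>1\<close>; the linear coefficient in \<open>x - \<mu>1\<close> is
    \<open>2 \<sigma>\<^sup>2 b\<close>.\<close>
  define b where "b = w$1 * w$2 + \<rho> * (w$1 * w$4 + w$2 * w$3) + w$3 * w$4"
  define A2 where "A2 = cond_var (w$2) (w$4)"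
  define A1 where "A1 = 2 * \<sigma>\<^sup>2 * b - 2 * \<mu>1 * A2"
  define A0 where "A0 = cond_var (w$1) (w$3) - 2 * \<sigma>\<^sup>2 * b * \<mu>1 + A2 * \<mu>1\<^sup>2"
  have inner_score: "u \<bullet> score r \<omega> = S r \<omega> + (s * mean1 r \<omega> + t * mean2 r \<omega>)" for r \<omega>
  proof -
    have "S r \<omega> = (\<Sum>i\<in>tree_upto r. (w$1 * noise i \<omega> $ 1 + w$2 * ((X i \<omega> - \<mu>1) * noise i \<omega> $ 1)
        + w$3 * noise i \<omega> $ 2 + w$4 * ((X i \<omega> - \<mu>1) * noise i \<omega> $ 2)) / sqrt (tsize r))"
      unfolding S_def p_def q_def
      unfolding times_divide_eq_left add_divide_distrib[symmetric]
      by (intro sum.cong refl arg_cong[where f = "\<lambda>z. z / _"]) (simp add: algebra_simps)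
    also have "\<dots> = w$1 * scaled_noise 1 r \<omega> + w$2 * scaled_cross 1 r \<omega> + w$3 * scaled_noise 2 r \<omega> + w$4 * scaled_cross 2 r \<omega>"
      unfolding sum_divide_distrib[symmetric] sum.distrib sum_distrib_left[symmetric] scaled_noise_def scaled_cross_def
      by (simp add: add_divide_distrib)
    finally show ?thesis by (simp add: u score_def inner_vec4)
  qed
  have V_eq: "V r \<omega> = A0 + A1 * mean1 r \<omega> + A2 * mean2 r \<omega>" for r \<omega>
  proof -
    have "cond_var (x / sqrt (tsize r)) (y / sqrt (tsize r)) = cond_var x y / tsize r" for x y
    proof -
      have "2 * \<rho> * (x / sqrt (tsize r)) * (y / sqrt (tsize r)) = 2 * \<rho> * x * y / (sqrt (tsize r) * sqrt (tsize r))"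
        by simp
      then have 1: "2 * \<rho> * (x / sqrt (tsize r)) * (y / sqrt (tsize r)) = 2 * \<rho> * x * y / tsize r" by simp
      have 2: "(z / sqrt (tsize r))\<^sup>2 = z\<^sup>2 / tsize r" for z by (simp add: power_divide)
      show ?thesis
        unfolding cond_var_def 1 2 by (simp only: add_divide_distrib[symmetric] times_divide_eq_right)
    qed
    then have "V r \<omega> = tree_mean r (\<lambda>i. cond_var (w$1 + w$2 * (X i \<omega> - \<mu>1)) (w$3 + w$4 * (X i \<omega> - \<mu>1)))"
      unfolding V_def p_def q_def tree_mean_def by (simp only: sum_divide_distrib[symmetric])
    also have "\<dots> = tree_mean r (\<lambda>i. A0 + A1 * X i \<omega> + A2 * (X i \<omega>)\<^sup>2)"
      by (rule tree_mean_cong) (simp add: A0_def A1_def A2_def b_def cond_var_def power2_eq_square algebra_simps)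
    also have "\<dots> = A0 + A1 * mean1 r \<omega> + A2 * mean2 r \<omega>"
      by (simp add: tree_mean_add tree_mean_cmult tree_mean_const)
    finally show ?thesis .
  qed
  \<comment> \<open>At the limiting moments the linear term in \<open>x - \<mu>1\<close> averages to
    zero, so \<open>b\<close> drops out and no covariance between noise sums and cross sums
    survives.\<close>
  have v_eq: "v = A0 + A1 * \<mu>1 + A2 * \<mu>2"
    by (simp add: v_def A0_def A1_def A2_def power2_eq_square algebra_simps)
  have Sm [measurable]: "S r \<in> borel_measurable M" for r
  proof -
    have 1: "X i \<in> borel_measurable M" "(\<lambda>\<omega>. noise i \<omega> $ k) \<in> borel_measurable M" if "i \<in> tree_upto r" for i k
      using that by (auto intro!: X_measurable measurable_compose[OF noise_measurable measurable_vec_nth] dest: tree_upto_ge)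
    note [measurable] = 1
    show ?thesis unfolding S_def p_def q_def by measurable
  qed
  have int1: "integrable M (\<lambda>\<omega>. \<bar>mean1 r \<omega> - \<mu>1\<bar>)" and int2: "integrable M (\<lambda>\<omega>. \<bar>mean2 r \<omega> - \<mu>2\<bar>)" for r
    using mean1_int mean2_int by auto
  have Vint: "integrable M (V r)" for r
    unfolding V_eq[abs_def] using mean1_int mean2_int by simp
  let ?a1 = "\<lambda>r. \<integral>\<omega>. \<bar>mean1 r \<omega> - \<mu>1\<bar> \<partial>M" and ?a2 = "\<lambda>r. \<integral>\<omega>. \<bar>mean2 r \<omega> - \<mu>2\<bar> \<partial>M"
  have lin: "(\<integral>\<omega>. \<bar>x * (mean1 r \<omega> - \<mu>1) + y * (mean2 r \<omega> - \<mu>2)\<bar> \<partial>M) \<le> \<bar>x\<bar> * ?a1 r + \<bar>y\<bar> * ?a2 r" for x y r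
  proof -
    have "(\<integral>\<omega>. \<bar>x * (mean1 r \<omega> - \<mu>1) + y * (mean2 r \<omega> - \<mu>2)\<bar> \<partial>M) \<le> (\<integral>\<omega>. \<bar>x\<bar> * \<bar>mean1 r \<omega> - \<mu>1\<bar> + \<bar>y\<bar> * \<bar>mean2 r \<omega> - \<mu>2\<bar> \<partial>M)"
    proof (rule Bochner_Integration.integral_mono)
      show "integrable M (\<lambda>\<omega>. \<bar>x * (mean1 r \<omega> - \<mu>1) + y * (mean2 r \<omega> - \<mu>2)\<bar>)" using mean1_int mean2_int by simp
      show "integrable M (\<lambda>\<omega>. \<bar>x\<bar> * \<bar>mean1 r \<omega> - \<mu>1\<bar> + \<bar>y\<bar> * \<bar>mean2 r \<omega> - \<mu>2\<bar>)"
        by (intro Bochner_Integration.integrable_add integrable_mult_right int1 int2)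
    qed (simp add: abs_mult[symmetric] abs_triangle_ineq)
    also have "\<dots> = \<bar>x\<bar> * ?a1 r + \<bar>y\<bar> * ?a2 r"
      by (intro has_bochner_integral_integral_eq has_bochner_integral_add has_bochner_integral_mult_right
          has_bochner_integral_integrable int1 int2)
    finally show ?thesis .
  qed
  have clt: "cmod ((\<integral>\<omega>. iexp (S r \<omega>) \<partial>M) - of_real (exp (- v / 2))) \<le> 3 * (\<bar>A1\<bar> * ?a1 r + \<bar>A2\<bar> * ?a2 r)" for r
  proof -
    have pm: "p r i \<in> borel_measurable (past i)" "q r i \<in> borel_measurable (past i)" if "i \<ge> 1" for i
      using X_past[OF that order_refl] unfolding p_def q_def by measurable
    have "cmod ((\<integral>\<omega>. iexp (S r \<omega>) \<partial>M) - of_real (exp (- v / 2))) \<le> 3 * (\<integral>\<omega>. \<bar>V r \<omega> - v\<bar> \<partial>M)"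
      using martingale_fourier[of "p r" "q r" v "card (tree_upto r)", OF pm v0] Vint[of r]
      unfolding tree_upto_eq[symmetric] S_def V_def by blast
    also have "(\<integral>\<omega>. \<bar>V r \<omega> - v\<bar> \<partial>M) = (\<integral>\<omega>. \<bar>A1 * (mean1 r \<omega> - \<mu>1) + A2 * (mean2 r \<omega> - \<mu>2)\<bar> \<partial>M)"
      unfolding V_eq v_eq by (simp add: algebra_simps)
    also have "\<dots> \<le> \<bar>A1\<bar> * ?a1 r + \<bar>A2\<bar> * ?a2 r" by (rule lin)
    finally show ?thesis by simp
  qed
  let ?c = "s * \<mu>1 + t * \<mu>2"
  have bound: "cmod (fourier (distr M borel (score r)) u - fourier score_law u)
      \<le> (\<bar>s\<bar> * ?a1 r + \<bar>t\<bar> * ?a2 r) + 3 * (\<bar>A1\<bar> * ?a1 r + \<bar>A2\<bar> * ?a2 r)" for r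
  proof -
    let ?m = "\<lambda>\<omega>. s * mean1 r \<omega> + t * mean2 r \<omega>"
    have i1: "integrable M (\<lambda>\<omega>. iexp (S r \<omega>) * iexp (?m \<omega>))"
      by (rule integrable_const_bound[of _ 1]) (auto simp: norm_mult)
    have i2: "integrable M (\<lambda>\<omega>. iexp (S r \<omega>) * iexp ?c)"
      by (rule integrable_const_bound[of _ 1]) (auto simp: norm_mult)
    have "fourier (distr M borel (score r)) u = (\<integral>\<omega>. iexp (S r \<omega>) * iexp (?m \<omega>) \<partial>M)"
    proof -
      have iexp_add: "iexp (a + b) = iexp a * iexp b" for a b by (simp add: distrib_left exp_add)
      have "fourier (distr M borel (score r)) u = (\<integral>\<omega>. iexp (u \<bullet> score r \<omega>) \<partial>M)"
        unfolding fourier_def by (subst integral_distr) auto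
      then show ?thesis unfolding inner_score iexp_add .
    qed
    then have "fourier (distr M borel (score r)) u - fourier score_law u =
       (\<integral>\<omega>. iexp (S r \<omega>) * iexp (?m \<omega>) - iexp (S r \<omega>) * iexp ?c \<partial>M) + iexp ?c * ((\<integral>\<omega>. iexp (S r \<omega>) \<partial>M) - of_real (exp (- v / 2)))"
      unfolding u fourier_score_law v_def[symmetric] Bochner_Integration.integral_diff[OF i1 i2]
      by (simp add: algebra_simps)
    then have 1: "cmod (fourier (distr M borel (score r)) u - fourier score_law u)
       \<le> cmod (\<integral>\<omega>. iexp (S r \<omega>) * iexp (?m \<omega>) - iexp (S r \<omega>) * iexp ?c \<partial>M)
         + cmod ((\<integral>\<omega>. iexp (S r \<omega>) \<partial>M) - of_real (exp (- v / 2)))"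
      by (simp only:) (rule order_trans[OF norm_triangle_ineq], simp only: norm_mult norm_iexp mult_1_left order_refl)
    have "cmod (\<integral>\<omega>. iexp (S r \<omega>) * iexp (?m \<omega>) - iexp (S r \<omega>) * iexp ?c \<partial>M)
       \<le> (\<integral>\<omega>. cmod (iexp (S r \<omega>) * iexp (?m \<omega>) - iexp (S r \<omega>) * iexp ?c) \<partial>M)"
      by (rule integral_norm_bound)
    also have "\<dots> \<le> (\<integral>\<omega>. \<bar>s * (mean1 r \<omega> - \<mu>1) + t * (mean2 r \<omega> - \<mu>2)\<bar> \<partial>M)"
    proof (rule Bochner_Integration.integral_mono)
      show "integrable M (\<lambda>\<omega>. cmod (iexp (S r \<omega>) * iexp (?m \<omega>) - iexp (S r \<omega>) * iexp ?c))"
        by (intro integrable_norm Bochner_Integration.integrable_diff i1 i2)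
      show "integrable M (\<lambda>\<omega>. \<bar>s * (mean1 r \<omega> - \<mu>1) + t * (mean2 r \<omega> - \<mu>2)\<bar>)" using mean1_int mean2_int by simp
      fix \<omega>
      have "cmod (iexp (S r \<omega>) * iexp (?m \<omega>) - iexp (S r \<omega>) * iexp ?c) = cmod (iexp (?m \<omega>) - iexp ?c)"
        unfolding right_diff_distrib[symmetric] norm_mult norm_iexp by simp
      also have "\<dots> \<le> \<bar>?m \<omega> - ?c\<bar>" by (rule iexp_lipschitz)
      also have "?m \<omega> - ?c = s * (mean1 r \<omega> - \<mu>1) + t * (mean2 r \<omega> - \<mu>2)" by (simp add: algebra_simps)
      finally show "cmod (iexp (S r \<omega>) * iexp (?m \<omega>) - iexp (S r \<omega>) * iexp ?c) \<le> \<bar>s * (mean1 r \<omega> - \<mu>1) + t * (mean2 r \<omega> - \<mu>2)\<bar>" .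
    qed
    also have "\<dots> \<le> \<bar>s\<bar> * ?a1 r + \<bar>t\<bar> * ?a2 r" by (rule lin)
    finally show ?thesis using clt[of r] 1 by linarith
  qed
  have lim: "(\<lambda>r. (\<bar>s\<bar> * ?a1 r + \<bar>t\<bar> * ?a2 r) + 3 * (\<bar>A1\<bar> * ?a1 r + \<bar>A2\<bar> * ?a2 r)) \<longlonglongrightarrow> (\<bar>s\<bar> * 0 + \<bar>t\<bar> * 0) + 3 * (\<bar>A1\<bar> * 0 + \<bar>A2\<bar> * 0)"
    by (intro tendsto_add tendsto_mult tendsto_const mean1_tendsto mean2_tendsto)
  have "(\<lambda>r. fourier (distr M borel (score r)) u - fourier score_law u) \<longlonglongrightarrow> 0"
    by (rule Lim_null_comparison[OF always_eventually[OF allI[OF bound]]]) (use lim in simp)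
  then show ?thesis by (simp add: LIM_zero_iff)
qed

lemma score_converges:
  fixes g :: "(real^4) \<times> real \<times> real \<Rightarrow> real"
  assumes g: "continuous_on UNIV g" "bounded (range g)"
  shows "(\<lambda>r. \<integral>\<omega>. g (score r \<omega>) \<partial>M) \<longlonglongrightarrow> (\<integral>z. g (score_limit z) \<partial>std_gaussian)"
proof -
  interpret G: prob_space "std_gaussian :: (real^4) measure" by (rule prob_space_std_gaussian)
  have [measurable]: "g \<in> borel_measurable borel" by (rule borel_measurable_continuous_onI) (rule g)
  have "(\<lambda>r. \<integral>x. g x \<partial>distr M borel (score r)) \<longlonglongrightarrow> (\<integral>x. g x \<partial>score_law)"
    by (rule levy_continuity_euclidean[OF _ _ _ _ fourier_score_tendsto g])
       (auto intro!: prob_space_distr G.prob_space_distr)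
  then show ?thesis by (simp add: integral_distr)
qed

text \<open>The estimation error as a function of the score. The maximum keeps the map continuous where the
  denominator of the estimator vanishes.\<close>

definition ls_map :: "(real^4) \<times> real \<times> real \<Rightarrow> real^4" where
  "ls_map x = (let u = fst x; m1 = fst (snd x); D = max (snd (snd x) - m1\<^sup>2) (asym_var / 2);
       a0 = (u$2 + (\<mu>1 - m1) * u$1) / D; a1 = (u$4 + (\<mu>1 - m1) * u$3) / D
     in vector [a0, u$1 - a0 * m1, a1, u$3 - a1 * m1])"

lemma continuous_on_ls_map: "continuous_on UNIV ls_map"
proof -
  have "max (snd (snd x) - (fst (snd x))\<^sup>2) (asym_var / 2) \<noteq> 0" for x :: "(real^4) \<times> real \<times> real"
  proof -
    have "0 < max (snd (snd x) - (fst (snd x))\<^sup>2) (asym_var / 2)"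
      unfolding less_max_iff_disj using half_gt_zero[OF asym_var_pos] by blast
    then show ?thesis by (rule less_imp_neq[symmetric])
  qed
  then show ?thesis
    unfolding ls_map_def[abs_def] Let_def
    by (intro continuous_on_vector4 continuous_intros) auto
qed

text \<open>At the limit point the correction \<open>\<mu>1 - m1\<close> is zero and the maximum
  equals \<open>asym_var\<close>, so the map becomes linear in \<open>z\<close>.\<close>

lemma ls_map_limit: "ls_map (score_limit z) = limit_factor \<sigma> \<rho> \<mu>1 asym_var *v z"
proof -
  define d where "d = sqrt asym_var"
  have d: "d > 0" "asym_var = d * d" using asym_var_pos by (simp_all add: d_def)
  have m: "max asym_var (asym_var / 2) = d * d" using asym_var_pos d(2) by simp
  show ?thesis
    unfolding limit_factor_mult ls_map_def score_limit_def Let_def fst_conv snd_conv m d_def[symmetric]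
    using d(1) by (simp add: vec_eq_iff forall_4 field_simps)
qed

text \<open>Where the empirical variance is at least half its limit, the scaled error is exactly the
  map of the score, with no remainder term.\<close>

lemma ls_map_score:
  assumes \<omega>: "\<omega> \<in> space M" and D: "mean2 r \<omega> - (mean1 r \<omega>)\<^sup>2 \<ge> asym_var / 2"
  shows "ls_denominator r (\<lambda>i. X i \<omega>) \<noteq> 0"
    and "sqrt (tsize r) *\<^sub>R (ls_theta r (\<lambda>i. X i \<omega>) - vector [\<alpha>\<^sub>0, \<beta>\<^sub>0, \<alpha>\<^sub>1, \<beta>\<^sub>1]) = ls_map (score r \<omega>)"
proof -
  let ?x = "\<lambda>i. X i \<omega>"
  let ?D = "mean2 r \<omega> - (mean1 r \<omega>)\<^sup>2"
  let ?n = "\<lambda>k i. noise i \<omega> $ k"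
  have den: "ls_denominator r ?x = ?D" by (simp add: ls_denominator_def)
  have "?D > 0" using half_gt_zero[OF asym_var_pos] D by (rule less_le_trans)
  then show d0: "ls_denominator r ?x \<noteq> 0" unfolding den by (rule less_imp_neq[symmetric])
  have mx: "max ?D (asym_var / 2) = ?D" using D by simp
  have y0: "X (2 * i + 0) \<omega> = \<alpha>\<^sub>0 * X i \<omega> + \<beta>\<^sub>0 + ?n 1 i" and y1: "X (2 * i + 1) \<omega> = \<alpha>\<^sub>1 * X i \<omega> + \<beta>\<^sub>1 + ?n 2 i"
    if "i \<in> tree_upto r" for i
    using daughters[OF tree_upto_ge[OF that] \<omega>] by (simp_all add: drift_def)
  define N where "N = sqrt (tsize r)"
  have N: "N > 0" "tsize r = N * N"
    unfolding N_def by (rule real_sqrt_gt_zero, rule tsize_pos) simp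
  have sn: "scaled_noise k r \<omega> = N * tree_mean r (?n k)" for k
    using N(1) unfolding scaled_noise_def tree_mean_def N_def[symmetric] N(2) by (simp add: field_simps)
  \<comment> \<open>The correction term moves the centring of the cross sum from the limit \<mu>1 to
    the empirical mean used by the estimator.\<close>
  have sc: "scaled_cross k r \<omega> + (\<mu>1 - mean1 r \<omega>) * scaled_noise k r \<omega> =
      N * (tree_mean r (\<lambda>i. X i \<omega> * ?n k i) - mean1 r \<omega> * tree_mean r (?n k))" for k
  proof -
    have "scaled_cross k r \<omega> = N * tree_mean r (\<lambda>i. X i \<omega> * ?n k i + (- \<mu>1) * ?n k i)"
      using N(1) unfolding scaled_cross_def tree_mean_def N_def[symmetric] N(2) by (simp add: field_simps)
    then show ?thesis unfolding tree_mean_add tree_mean_cmult sn by (simp add: algebra_simps)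
  qed
  define err where "err k = (tree_mean r (\<lambda>i. X i \<omega> * ?n k i) - mean1 r \<omega> * tree_mean r (?n k)) / ?D" for k
  have e: "(scaled_cross k r \<omega> + (\<mu>1 - mean1 r \<omega>) * scaled_noise k r \<omega>) / ?D = N * err k" for k
    unfolding sc err_def by simp
  have th: "ls_theta r ?x = vector [\<alpha>\<^sub>0 + err 1, \<beta>\<^sub>0 + (tree_mean r (?n 1) - err 1 * mean1 r \<omega>),
      \<alpha>\<^sub>1 + err 2, \<beta>\<^sub>1 + (tree_mean r (?n 2) - err 2 * mean1 r \<omega>)]"
    unfolding ls_theta_def err_def den[symmetric]
    using ls_error[of r ?x 0, OF y0 d0] ls_error[of r ?x 1, OF y1 d0] by simp
  show "sqrt (tsize r) *\<^sub>R (ls_theta r ?x - vector [\<alpha>\<^sub>0, \<beta>\<^sub>0, \<alpha>\<^sub>1, \<beta>\<^sub>1]) = ls_map (score r \<omega>)"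
    unfolding ls_map_def score_def Let_def fst_conv snd_conv mx vector_4 e th N_def[symmetric]
    by (simp add: vec_eq_iff forall_4 sn algebra_simps)
qed

text \<open>The value of the estimator at a vanishing denominator is arbitrary, so it is compared
  with \<open>ls_map\<close> of the score in expectation: the two can differ only where
  \<open>h\<close> is 1, which costs at most \<open>2 * B\<close> times the integral of
  \<open>h\<close>, and that integral tends to its value 0 at the limit point.\<close>

theorem ls_converges_in_law:
  assumes m: "\<And>r. \<theta>_hat r \<in> borel_measurable M"
    and est: "\<And>r \<omega>. \<omega> \<in> space M \<Longrightarrow> ls_denominator r (\<lambda>i. X i \<omega>) \<noteq> 0 \<Longrightarrow> \<theta>_hat r \<omega> = ls_theta r (\<lambda>i. X i \<omega>)"
  shows "converges_in_law M (\<lambda>r \<omega>. sqrt (tsize r) *\<^sub>R (\<theta>_hat r \<omega> - vector [\<alpha>\<^sub>0, \<beta>\<^sub>0, \<alpha>\<^sub>1, \<beta>\<^sub>1]))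
     (multivariate_normal 0 (asymptotic_covariance \<sigma> \<rho> (asymptotic_K \<mu>1 \<mu>2)))"
proof -
  define Z where "Z r \<omega> = sqrt (tsize r) *\<^sub>R (\<theta>_hat r \<omega> - vector [\<alpha>\<^sub>0, \<beta>\<^sub>0, \<alpha>\<^sub>1, \<beta>\<^sub>1])" for r \<omega>
  note [measurable] = m
  have Zm [measurable]: "Z r \<in> borel_measurable M" for r unfolding Z_def[abs_def] by measurable
  have lsm [measurable]: "ls_map \<in> borel_measurable borel"
    by (rule borel_measurable_continuous_onI) (rule continuous_on_ls_map)
  \<comment> \<open>\<open>h\<close> is a continuous majorant of the indicator of the event that the maximum in \<open>ls_map\<close> is active;
    it vanishes at the limit point.\<close>
  define h where "h x = max 0 (min 1 (3 - 4 / asym_var * (snd (snd x) - (fst (snd x))\<^sup>2)))" for x :: "(real^4) \<times> real \<times> real"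
  have hc: "continuous_on UNIV h" unfolding h_def[abs_def] by (intro continuous_intros)
  have h01: "0 \<le> h x" "h x \<le> 1" for x by (auto simp: h_def)
  have hb: "bounded (range h)" by (rule boundedI[of _ 1]) (use h01 in auto)
  have [measurable]: "h \<in> borel_measurable borel" by (rule borel_measurable_continuous_onI) (rule hc)
  have "4 / a * a = 4" if "a > 0" for a :: real using that by simp
  from this[OF asym_var_pos] have "h (score_limit z) = 0" for z
    unfolding h_def score_limit_def fst_conv snd_conv by (simp only:)
  then have h_tendsto: "(\<lambda>r. \<integral>\<omega>. h (score r \<omega>) \<partial>M) \<longlonglongrightarrow> 0"
    using score_converges[OF hc hb] by simp
  \<comment> \<open>Origin of the constants in \<open>h\<close>: the inner affine function equals
    \<open>3 - 4 = -1\<close> at the limiting variance and reaches \<open>3 - 2 = 1\<close> when the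
    empirical variance drops to half of it.\<close>
  have bad: "h (score r \<omega>) = 1 \<or> Z r \<omega> = ls_map (score r \<omega>)" if "\<omega> \<in> space M" for r \<omega>
  proof (cases "mean2 r \<omega> - (mean1 r \<omega>)\<^sup>2 \<ge> asym_var / 2")
    case True
    from ls_map_score[OF that True] est[OF that] show ?thesis by (simp add: Z_def)
  next
    case False
    then have "4 / asym_var * (mean2 r \<omega> - (mean1 r \<omega>)\<^sup>2) \<le> 4 / asym_var * (asym_var / 2)"
      using asym_var_pos by (intro mult_left_mono) auto
    moreover have "4 / a * (a / 2) = 2" if "a > 0" for a :: real using that by simp
    from this[OF asym_var_pos] have "4 / asym_var * (asym_var / 2) = 2" .
    ultimately have "4 / asym_var * (mean2 r \<omega> - (mean1 r \<omega>)\<^sup>2) \<le> 2" by (simp only:)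
    then show ?thesis by (simp add: h_def score_def)
  qed
  have "(\<lambda>r. \<integral>\<omega>. f (Z r \<omega>) \<partial>M) \<longlonglongrightarrow> (\<integral>x. f x \<partial>multivariate_normal 0 (asymptotic_covariance \<sigma> \<rho> (asymptotic_K \<mu>1 \<mu>2)))"
    if fc: "continuous_on UNIV f" and fb: "bounded (range f)" for f :: "real^4 \<Rightarrow> real"
  proof -
    have [measurable]: "f \<in> borel_measurable borel" by (rule borel_measurable_continuous_onI) (rule fc)
    obtain B where B: "B > 0" "\<And>x. \<bar>f x\<bar> \<le> B" using fb by (auto simp: bounded_pos)
    have "(\<lambda>r. \<integral>\<omega>. f (ls_map (score r \<omega>)) \<partial>M) \<longlonglongrightarrow> (\<integral>z. f (ls_map (score_limit z)) \<partial>std_gaussian)"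
    proof (rule score_converges)
      show "continuous_on UNIV (\<lambda>x. f (ls_map x))"
        using continuous_on_compose2[OF fc continuous_on_ls_map] by simp
      show "bounded (range (\<lambda>x. f (ls_map x)))" by (rule boundedI[of _ B]) (use B in auto)
    qed
    also have "(\<integral>z. f (ls_map (score_limit z)) \<partial>std_gaussian) =
        (\<integral>x. f x \<partial>multivariate_normal 0 (asymptotic_covariance \<sigma> \<rho> (asymptotic_K \<mu>1 \<mu>2)))"
    proof -
      have "multivariate_normal 0 (asymptotic_covariance \<sigma> \<rho> (asymptotic_K \<mu>1 \<mu>2)) =
          distr std_gaussian borel (\<lambda>z. limit_factor \<sigma> \<rho> \<mu>1 asym_var *v z)"
        by (rule limit_factor) (use sigma_pos rho_range asym_var_pos in auto)
      then show ?thesis by (simp add: integral_distr ls_map_limit)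
    qed
    finally have 1: "(\<lambda>r. \<integral>\<omega>. f (ls_map (score r \<omega>)) \<partial>M) \<longlonglongrightarrow> (\<integral>x. f x \<partial>multivariate_normal 0 (asymptotic_covariance \<sigma> \<rho> (asymptotic_K \<mu>1 \<mu>2)))" .
    have bound: "norm ((\<integral>\<omega>. f (Z r \<omega>) \<partial>M) - (\<integral>\<omega>. f (ls_map (score r \<omega>)) \<partial>M)) \<le> 2 * B * (\<integral>\<omega>. h (score r \<omega>) \<partial>M)" for r
    proof -
      have i1: "integrable M (\<lambda>\<omega>. f (Z r \<omega>))" by (rule integrable_const_bound[of _ B]) (simp_all add: B(2))
      have i2: "integrable M (\<lambda>\<omega>. f (ls_map (score r \<omega>)))" by (rule integrable_const_bound[of _ B]) (simp_all add: B(2))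
      have i3: "integrable M (\<lambda>\<omega>. h (score r \<omega>))" by (rule integrable_const_bound[of _ 1]) (simp_all add: h01)
      have "norm ((\<integral>\<omega>. f (Z r \<omega>) \<partial>M) - (\<integral>\<omega>. f (ls_map (score r \<omega>)) \<partial>M)) = \<bar>\<integral>\<omega>. f (Z r \<omega>) - f (ls_map (score r \<omega>)) \<partial>M\<bar>"
        using i1 i2 by simp
      also have "\<dots> \<le> (\<integral>\<omega>. \<bar>f (Z r \<omega>) - f (ls_map (score r \<omega>))\<bar> \<partial>M)" by (rule integral_abs_bound)
      also have "\<dots> \<le> (\<integral>\<omega>. 2 * B * h (score r \<omega>) \<partial>M)"
      proof (rule Bochner_Integration.integral_mono)
        fix \<omega> assume "\<omega> \<in> space M"
        from bad[OF this, of r] show "\<bar>f (Z r \<omega>) - f (ls_map (score r \<omega>))\<bar> \<le> 2 * B * h (score r \<omega>)"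
        proof
          assume "h (score r \<omega>) = 1"
          then show ?thesis using B(2)[of "Z r \<omega>"] B(2)[of "ls_map (score r \<omega>)"] by simp
        next
          assume "Z r \<omega> = ls_map (score r \<omega>)"
          then show ?thesis using B(1) h01(1)[of "score r \<omega>"] by simp
        qed
      qed (use i1 i2 i3 in auto)
      also have "\<dots> = 2 * B * (\<integral>\<omega>. h (score r \<omega>) \<partial>M)" by simp
      finally show ?thesis .
    qed
    have "(\<lambda>r. 2 * B * (\<integral>\<omega>. h (score r \<omega>) \<partial>M)) \<longlonglongrightarrow> 2 * B * 0"
      by (intro tendsto_mult tendsto_const h_tendsto)
    then have "(\<lambda>r. (\<integral>\<omega>. f (Z r \<omega>) \<partial>M) - (\<integral>\<omega>. f (ls_map (score r \<omega>)) \<partial>M)) \<longlonglongrightarrow> 0"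
      by (intro Lim_null_comparison[OF always_eventually[OF allI[OF bound]]]) simp
    from tendsto_add[OF this 1] show ?thesis by simp
  qed
  then show ?thesis unfolding converges_in_law_def using Zm by (simp add: Z_def[abs_def])
qed

end

theorem proposition33:
  fixes M :: "'a measure"
    and X \<epsilon> :: "nat \<Rightarrow> 'a \<Rightarrow> real"
    and \<nu> :: "real measure"
    and \<alpha>\<^sub>0 \<beta>\<^sub>0 \<alpha>\<^sub>1 \<beta>\<^sub>1 \<sigma> \<rho> :: real
    and \<theta>_hat :: "nat \<Rightarrow> 'a \<Rightarrow> real^4"
  assumes model: "bar_model M X \<epsilon> \<nu> \<alpha>\<^sub>0 \<beta>\<^sub>0 \<alpha>\<^sub>1 \<beta>\<^sub>1 \<sigma> \<rho>"
    and moments: "\<And>k :: nat. integrable \<nu> (\<lambda>x. x ^ k)"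
    and estimator_measurable: "\<And>r. \<theta>_hat r \<in> borel_measurable M"
    and estimator: "\<And>r \<omega>. \<omega> \<in> space M \<Longrightarrow> ls_denominator r (\<lambda>i. X i \<omega>) \<noteq> 0 \<Longrightarrow>
                      \<theta>_hat r \<omega> = ls_theta r (\<lambda>i. X i \<omega>)"
  shows "\<exists>\<mu>. stationary_distribution (bar_kernel \<alpha>\<^sub>0 \<beta>\<^sub>0 \<alpha>\<^sub>1 \<beta>\<^sub>1 \<sigma>) \<mu>
           \<and> (\<forall>\<mu>'. stationary_distribution (bar_kernel \<alpha>\<^sub>0 \<beta>\<^sub>0 \<alpha>\<^sub>1 \<beta>\<^sub>1 \<sigma>) \<mu>' \<longrightarrow> \<mu>' = \<mu>)
           \<and> integrable \<mu> (\<lambda>x. x) \<and> (\<integral>x. x \<partial>\<mu>) = bar_mu1 \<alpha>\<^sub>0 \<beta>\<^sub>0 \<alpha>\<^sub>1 \<beta>\<^sub>1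
           \<and> integrable \<mu> (\<lambda>x. x\<^sup>2) \<and> (\<integral>x. x\<^sup>2 \<partial>\<mu>) = bar_mu2 \<alpha>\<^sub>0 \<beta>\<^sub>0 \<alpha>\<^sub>1 \<beta>\<^sub>1 \<sigma>
           \<and> converges_in_law M
               (\<lambda>r \<omega>. sqrt (real (card (tree_upto r))) *\<^sub>R
                        (\<theta>_hat r \<omega> - vector [\<alpha>\<^sub>0, \<beta>\<^sub>0, \<alpha>\<^sub>1, \<beta>\<^sub>1]))
               (multivariate_normal 0
                 (asymptotic_covariance \<sigma> \<rho>
                   (asymptotic_K (bar_mu1 \<alpha>\<^sub>0 \<beta>\<^sub>0 \<alpha>\<^sub>1 \<beta>\<^sub>1) (bar_mu2 \<alpha>\<^sub>0 \<beta>\<^sub>0 \<alpha>\<^sub>1 \<beta>\<^sub>1 \<sigma>))))"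
proof -
  interpret bar_model M X \<epsilon> \<nu> \<alpha>\<^sub>0 \<beta>\<^sub>0 \<alpha>\<^sub>1 \<beta>\<^sub>1 \<sigma> \<rho> by (rule model)
  have "integrable M (\<lambda>\<omega>. (X 1 \<omega>)\<^sup>2)"
    using moments[of 2] ancestor_measurable unfolding ancestor_law[symmetric] by (simp add: integrable_distr_eq)
  then interpret bar_model_sq M X \<epsilon> \<nu> \<alpha>\<^sub>0 \<beta>\<^sub>0 \<alpha>\<^sub>1 \<beta>\<^sub>1 \<sigma> \<rho> by unfold_locales
  obtain \<mu> where \<mu>: "stationary_distribution (bar_kernel \<alpha>\<^sub>0 \<beta>\<^sub>0 \<alpha>\<^sub>1 \<beta>\<^sub>1 \<sigma>) \<mu>" "(\<integral>\<^sup>+x. ennreal (x\<^sup>2) \<partial>\<mu>) < \<infinity>"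
    using stationary_exists by blast
  show ?thesis
    using \<mu>(1) stationary_unique[OF \<mu>(1)] stationary_moments[OF \<mu>]
      ls_converges_in_law[OF estimator_measurable estimator]
    by blast
qed

end
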